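(* Let $Q$ be the square, the isosceles right triangle (the triangle with angles $\left(\frac{\pi}{2},\frac{\pi}{4},\frac{\pi}{4}\right)$), or the equilateral triangle, and let $p$ be the complexity function of the billiard in $Q$ coded by its sides. Then the limit $$\lim_{n\to\infty}\frac{p(n)}{n^3}$$ exists, and its value is $$\frac{4}{\pi^2}\ \text{ if } Q \text{ is the square},\qquad \frac{2}{3\pi^2}\ \text{ if } Q \text{ is the } \left(\tfrac{\pi}{2},\tfrac{\pi}{4},\tfrac{\pi}{4}\right)\text{-triangle},\qquad \frac{3}{4\pi^2}\ \text{ if } Q \text{ is the equilateral triangle}.$$
   Context: Billiard: a point mass moves inside a polygon $Q\subset\mathbb{R}^2$ with unit speed along a straight line until it reaches the boundary $\partial Q$, where it changes direction by the law "angle of incidence equals angle of reflection", and then continues along the new line. An orbit is not continued after it reaches a vertex. Complexity: label the sides of $Q$ by distinct symbols of a finite alphabet $\mathcal{A}$ whose cardinality is the number of sides of $Q$ (so four symbols for the square, three for a triangle). Code a billiard orbit (avoiding the vertices) by the sequence of sides it hits. $\mathcal{L}(n)$ is the set of all words of length $n$ over $\mathcal{A}$ that arise as $n$ consecutive sides hit by such an orbit, and $p(n)=\#\mathcal{L}(n)$. *)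

theory Defs
  imports "HOL-Analysis.Analysis"
begin

definition is_square :: "(real^2) set \<Rightarrow> bool" where
  "is_square Q \<longleftrightarrow> (\<exists>a u v. u \<noteq> 0 \<and> norm u = norm v \<and> orthogonal u v \<and>
     Q = convex hull {a, a + u, a + u + v, a + v})"

definition is_isosceles_right_triangle :: "(real^2) set \<Rightarrow> bool" where
  "is_isosceles_right_triangle Q \<longleftrightarrow> (\<exists>a b c. a \<noteq> b \<and> dist a b = dist a c \<and>
     orthogonal (b - a) (c - a) \<and> Q = convex hull {a, b, c})"

definition is_equilateral_triangle :: "(real^2) set \<Rightarrow> bool" where
  "is_equilateral_triangle Q \<longleftrightarrow> (\<exists>a b c. a \<noteq> b \<and> dist a b = dist b c \<and>
     dist b c = dist c a \<and> Q = convex hull {a, b, c})"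

text \<open>
  Below, \<open>Q\<close> is a convex polygon, given as a closed region of the plane, so that its sides are its
  one-dimensional faces and its vertices are its extreme points.
\<close>

definition sides :: "(real^2) set \<Rightarrow> (real^2) set set" where
  "sides Q = {e. e edge_of Q}"

text \<open>
  Angle of incidence equals angle of reflection: \<open>d'\<close> is the mirror image of the direction \<open>d\<close> in the
  line parallel to the side \<open>e\<close>.  The normal vector \<open>n\<close> of \<open>e\<close> is unique up to a scalar factor, on
  which the right-hand side does not depend.
\<close>

definition reflects :: "(real^2) set \<Rightarrow> real^2 \<Rightarrow> real^2 \<Rightarrow> bool" where
  "reflects e d d' \<longleftrightarrow> (\<exists>n. n \<noteq> 0 \<and> (\<forall>x\<in>e. \<forall>y\<in>e. orthogonal n (x - y)) \<and>
     d' = d - (2 * (d \<bullet> n) / (n \<bullet> n)) *\<^sub>R n)"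

text \<open>
  An orbit that never reaches a vertex: the point mass starts at the interior point \<open>x 0\<close> in the unit
  direction \<open>d 0\<close>.  Its \<open>k\<close>-th hit (counted from \<open>0\<close>) is at the point \<open>x (Suc k)\<close> of the side \<open>s k\<close>,
  which it leaves in direction \<open>d (Suc k)\<close>.  Since the speed is \<open>1\<close>, \<open>t\<close> is the time between two hits.
\<close>

definition billiard_orbit ::
  "(real^2) set \<Rightarrow> (nat \<Rightarrow> real^2) \<Rightarrow> (nat \<Rightarrow> real^2) \<Rightarrow> (nat \<Rightarrow> (real^2) set) \<Rightarrow> bool" where
  "billiard_orbit Q x d s \<longleftrightarrow>
     x 0 \<in> interior Q \<and> norm (d 0) = 1 \<and>
     (\<forall>k. (\<exists>t>0. x (Suc k) = x k + t *\<^sub>R d k) \<and>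
          open_segment (x k) (x (Suc k)) \<subseteq> interior Q \<and>
          s k \<in> sides Q \<and> x (Suc k) \<in> s k \<and> \<not> x (Suc k) extreme_point_of Q \<and>
          reflects (s k) (d k) (d (Suc k)))"

definition billiard_language :: "(real^2) set \<Rightarrow> ((real^2) set \<Rightarrow> 'a) \<Rightarrow> nat \<Rightarrow> 'a list set" where
  "billiard_language Q lab n =
     {map (\<lambda>i. lab (s i)) [m..<m + n] | x d s m. billiard_orbit Q x d s}"

definition billiard_complexity :: "(real^2) set \<Rightarrow> ((real^2) set \<Rightarrow> 'a) \<Rightarrow> nat \<Rightarrow> nat" where
  "billiard_complexity Q lab n = card (billiard_language Q lab n)"

end

theory Submission
  imports Defs "HOL-Real_Asymp.Real_Asymp"
begin

text \<open>
  Unfold the billiard: a word is the sequence of edges of reflected copies of the polygon that a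
  straight line crosses.  A word is realised iff some affine function \<open>f\<close> (with the line as its zero
  set) separates the end points of every unfolded edge, and for a fixed word these \<open>f\<close> form an open
  convex cone.

  Hence a word of length \<open>n\<close> has one extension more than there are vertices of its last tile which
  the line of such an \<open>f\<close> can hit.  Read backwards, these pairs of words and vertices are the words of
  length \<open>n\<close> of the rays issuing from the vertices of the polygon.  The same splitting, applied to the
  rays from one vertex, shows that the number of their words grows by the number of generalised
  diagonals with exactly \<open>n\<close> crossings.

  In affine coordinates in which the vertices of the tiling are the points of \<open>\<int>\<^sup>2\<close>, a generalised
  diagonal is a primitive lattice vector in a corner of the polygon, and the number of its crossings is,
  up to a bounded error, a piecewise linear function of that vector.  So the complexity is asymptotically
  a double sum over counts of coprime pairs \<open>(a, b)\<close> with \<open>p a + q b \<le> n\<close>, which are asymptotic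
  to \<open>3 n\<^sup>2 / (\<pi>\<^sup>2 p q)\<close>.
\<close>

section \<open>Affine functions and convex polygons\<close>

text \<open>The surplus of one comes from convexity. Once a sign is fixed, the functions realising a
  word form a convex set, so the sides by which their lines can leave the last tile are consecutive;
  a vertex between two of them is hit by an intermediate function, and a line through a vertex can
  be moved to either side of it. The rays from a vertex \<open>c\<close> obey the same count under
  the linear condition \<open>f c = 0\<close>, which is why the set \<open>L\<close> of allowed
  functions is a parameter. No angle occurs before \<open>billiard_coordinates\<close>: until then a
  reflection is any affine involution that fixes a side, and the three polygons differ only in
  finite data. A billiard orbit is infinite and misses the vertices, whereas a word is finite.
  Openness closes this gap: a function realising the word is moved off the countable lattice, and
  its line then continues forever. The limit is one third of the sum of the quadratic rates of
  diagonals over all vertices and the sides opposite to them; the third comes from summing squares.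
  A rate is the area \<open>1 / (2 p q)\<close> divided by \<open>\<zeta>(2)\<close>, or twice such
  a number.\<close>

definition affine_fun :: "(real \<times> real \<Rightarrow> real) \<Rightarrow> bool" where
  "affine_fun f \<longleftrightarrow> (\<exists>a b c. \<forall>x y. f (x, y) = a * x + b * y + c)"

lemma affine_funI: "(\<And>x y. f (x, y) = a * x + b * y + c) \<Longrightarrow> affine_fun f"
  unfolding affine_fun_def by blast

lemma affine_fun_lincomb:
  assumes "affine_fun f" "affine_fun g"
  shows "affine_fun (\<lambda>p. s * f p + t * g p)"
proof -
  obtain a b c where f: "\<And>x y. f (x, y) = a * x + b * y + c"
    using assms(1) unfolding affine_fun_def by blast
  obtain a' b' c' where g: "\<And>x y. g (x, y) = a' * x + b' * y + c'"
    using assms(2) unfolding affine_fun_def by blast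
  show ?thesis
    by (rule affine_funI[where a = "s * a + t * a'" and b = "s * b + t * b'" and c = "s * c + t * c'"])
      (simp add: f g algebra_simps)
qed

lemma affine_fun_const: "affine_fun (\<lambda>p. c)"
  by (rule affine_funI[where a = 0 and b = 0 and c = c]) simp

lemma affine_fun_uminus: "affine_fun f \<Longrightarrow> affine_fun (\<lambda>p. - f p)"
  using affine_fun_lincomb[of f f "-1" 0] by simp

lemma affine_fun_line:
  assumes "affine_fun f"
  shows "f (x + t *\<^sub>R d) = f x + t * (f d - f 0)"
proof -
  obtain a b c where f: "\<And>x y. f (x, y) = a * x + b * y + c"
    using assms unfolding affine_fun_def by blast
  show ?thesis
    by (cases x; cases d) (simp add: f zero_prod_def algebra_simps)
qed

lemma affine_fun_add: "affine_fun f \<Longrightarrow> f (x + d) = f x + (f d - f 0)"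
  using affine_fun_line[of f x 1 d] by simp

lemma affine_fun_segment:
  assumes "affine_fun f"
  shows "f ((1 - t) *\<^sub>R x + t *\<^sub>R y) = (1 - t) * f x + t * f y"
proof -
  obtain a b c where f: "\<And>x y. f (x, y) = a * x + b * y + c"
    using assms unfolding affine_fun_def by blast
  show ?thesis
    by (cases x; cases y) (simp add: f algebra_simps)
qed

text \<open>Reflections have this form, with \<open>l = lam i\<close> and \<open>d = nu i\<close>,
  so pulling back along an unfolding never leaves the affine functions.\<close>

lemma affine_fun_comp_shear:
  assumes "affine_fun f" "affine_fun l"
  shows "affine_fun (\<lambda>p. f (p - l p *\<^sub>R d))"
proof -
  obtain a b c where f: "\<And>x y. f (x, y) = a * x + b * y + c"
    using assms unfolding affine_fun_def by blast
  obtain a' b' c' where g: "\<And>x y. l (x, y) = a' * x + b' * y + c'"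
    using assms(2) unfolding affine_fun_def by blast
  obtain d1 d2 where d: "d = (d1, d2)" by (cases d)
  show ?thesis
    by (rule affine_funI[where a = "a - (a * d1 + b * d2) * a'" and b = "b - (a * d1 + b * d2) * b'"
          and c = "c - (a * d1 + b * d2) * c'"]) (simp add: f g d algebra_simps)
qed

text \<open>The witness is the inner product of \<open>z - p\<close> with \<open>q - p\<close>; its
  value at \<open>q\<close> is the squared distance.\<close>

lemma affine_fun_separating:
  assumes "(p :: real \<times> real) \<noteq> q"
  obtains f where "affine_fun f" "f p = 0" "f q \<noteq> 0"
proof -
  let ?f = "\<lambda>z. (fst q - fst p) * (fst z - fst p) + (snd q - snd p) * (snd z - snd p)"
  have "affine_fun ?f"
    by (rule affine_funI[where a = "fst q - fst p" and b = "snd q - snd p"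
          and c = "- (fst q - fst p) * fst p - (snd q - snd p) * snd p"])
      (simp add: algebra_simps)
  moreover have "?f q \<noteq> 0"
    using assms by (auto simp: prod_eq_iff sum_squares_eq_zero_iff)
  ultimately show ?thesis using that[of ?f] by simp
qed

lemma convex_comb_pos: "(a :: real) > 0 \<Longrightarrow> b > 0 \<Longrightarrow> 0 \<le> s \<Longrightarrow> s \<le> 1 \<Longrightarrow> (1 - s) * a + s * b > 0"
  by (cases "s = 0") (auto intro: add_nonneg_pos)

text \<open>
  Side \<open>i\<close> joins \<open>P i\<close> to \<open>P (Suc i)\<close>, with indices read modulo \<open>k\<close>; \<open>lam i\<close> vanishes on it and
  is nonnegative on the polygon, and \<open>p \<mapsto> p - lam i p \<cdot> nu i\<close> is the reflection in it.  The last
  axiom is convexity: on a tour of the vertices \<open>f\<close> changes its sign only twice.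
\<close>

locale convex_polygon =
  fixes k :: nat and P :: "nat \<Rightarrow> real \<times> real"
    and lam :: "nat \<Rightarrow> real \<times> real \<Rightarrow> real" and nu :: "nat \<Rightarrow> real \<times> real"
  assumes k3: "3 \<le> k"
    and P_periodic: "P (n + k) = P n"
    and P_inj: "inj_on P {..<k}"
    and lam_affine: "affine_fun (lam i)"
    and lam_edge: "i < k \<Longrightarrow> lam i (P i) = 0" "i < k \<Longrightarrow> lam i (P (Suc i)) = 0"
    and lam_pos: "\<lbrakk>i < k; 2 \<le> l; l < k\<rbrakk> \<Longrightarrow> lam i (P (i + l)) > 0"
    and lam_nu: "i < k \<Longrightarrow> lam i (nu i) - lam i 0 = 2"
    and sign_change: "\<lbrakk>affine_fun f; f (P i) < 0; f (P (Suc i)) > 0; 1 \<le> l; l < m; m \<le> k;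
      f (P (i + l)) \<le> 0\<rbrakk> \<Longrightarrow> f (P (i + m)) < 0"
begin

definition V :: "(real \<times> real) set" where
  "V = P ` {..<k}"

text \<open>Orthogonality is not assumed: by \<open>lam_nu\<close> this is an involution that
  negates \<open>lam i\<close>, possibly an oblique one.\<close>

definition refl :: "nat \<Rightarrow> real \<times> real \<Rightarrow> real \<times> real" where
  "refl i p = p - lam i p *\<^sub>R nu i"

text \<open>Strict, so that a line through an end of the side does not count as crossing it, and the
  condition is open in \<open>f\<close>.\<close>

definition sep :: "(real \<times> real \<Rightarrow> real) \<Rightarrow> nat \<Rightarrow> bool" where
  "sep f i \<longleftrightarrow> f (P i) * f (P (Suc i)) < 0"

text \<open>
  Instead of unfolding the polygon, \<open>feas\<close> pulls \<open>f\<close> back to it.  The last tile of the unfolding along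
  \<open>w\<close> is the image of the polygon under \<open>unf w\<close>.
\<close>

primrec feas :: "(real \<times> real \<Rightarrow> real) \<Rightarrow> nat list \<Rightarrow> bool" where
  "feas f [] \<longleftrightarrow> True"
| "feas f (i # w) \<longleftrightarrow> sep f i \<and> feas (\<lambda>p. f (refl i p)) w"

primrec unf :: "nat list \<Rightarrow> real \<times> real \<Rightarrow> real \<times> real" where
  "unf [] p = p"
| "unf (i # w) p = refl i (unf w p)"

text \<open>Repeated letters have to be excluded separately: \<open>refl i\<close> fixes both ends
  of side \<open>i\<close>, so \<open>feas\<close> would accept a second crossing of the same side
  at once.\<close>

definition adm :: "nat list \<Rightarrow> bool" where
  "adm w \<longleftrightarrow> distinct_adj w \<and> set w \<subseteq> {..<k}"

lemma finite_V: "finite V"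
  by (simp add: V_def)

lemma P_mod: "P (n mod k) = P n"
proof -
  have "P (m + k * j) = P m" for m j
  proof (induction j)
    case (Suc j)
    have "P (m + k * Suc j) = P (m + k * j + k)" by (simp add: algebra_simps)
    then show ?case using Suc P_periodic by simp
  qed simp
  from this[of "n mod k" "n div k"] show ?thesis by simp
qed

lemma P_in_V: "P n \<in> V"
  using k3 P_mod[of n] by (auto simp: V_def intro!: image_eqI[of _ _ "n mod k"])

lemma sep_mod: "sep f (n mod k) \<longleftrightarrow> sep f n"
  using P_mod[of "Suc (n mod k)"] P_mod[of "Suc n"] P_mod[of n]
  by (simp add: sep_def mod_Suc_eq)

text \<open>After rotating the indices so that side \<open>i\<close> comes first, the offsets 0 and
  1 are its ends and \<open>lam_pos\<close> covers the rest.\<close>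

lemma lam_nonneg: "i < k \<Longrightarrow> q \<in> V \<Longrightarrow> lam i q \<ge> 0"
  and lam_V_zero: "i < k \<Longrightarrow> q \<in> V \<Longrightarrow> lam i q = 0 \<Longrightarrow> q = P i \<or> q = P (Suc i)"
proof -
  have "lam i q \<ge> 0 \<and> (lam i q = 0 \<longrightarrow> q = P i \<or> q = P (Suc i))" if "i < k" "q \<in> V"
  proof -
    obtain n where n: "n < k" "q = P n" using \<open>q \<in> V\<close> unfolding V_def by blast
    obtain l where l: "l < k" "P n = P (i + l)"
    proof (cases "i \<le> n")
      case True
      then show ?thesis using that[of "n - i"] n by auto
    next
      case False
      have "P n = P (i + (n + k - i))" using P_periodic[of n] \<open>i < k\<close> by simp
      then show ?thesis using that[of "n + k - i"] False n \<open>i < k\<close> by auto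
    qed
    show ?thesis
    proof (cases "2 \<le> l")
      case True
      then show ?thesis using lam_pos[OF \<open>i < k\<close> True l(1)] n l by auto
    next
      case False
      then have "l = 0 \<or> l = 1" by linarith
      then show ?thesis using n l lam_edge[OF \<open>i < k\<close>] by auto
    qed
  qed
  then show "i < k \<Longrightarrow> q \<in> V \<Longrightarrow> lam i q \<ge> 0"
    and "i < k \<Longrightarrow> q \<in> V \<Longrightarrow> lam i q = 0 \<Longrightarrow> q = P i \<or> q = P (Suc i)" by blast+
qed

lemma lam_refl: "i < k \<Longrightarrow> lam i (refl i p) = - lam i p"
  using affine_fun_line[OF lam_affine, of i p "- lam i p" "nu i"] lam_nu[of i]
  by (simp add: refl_def)

lemma refl_refl: "i < k \<Longrightarrow> refl i (refl i p) = p"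
  unfolding refl_def[of i "refl i p"] lam_refl by (simp add: refl_def)

lemma refl_fix: "lam i p = 0 \<Longrightarrow> refl i p = p"
  by (simp add: refl_def)

lemma refl_edge: "i < k \<Longrightarrow> refl i (P i) = P i" "i < k \<Longrightarrow> refl i (P (Suc i)) = P (Suc i)"
  by (simp_all add: refl_fix lam_edge)

lemma affine_fun_refl: "affine_fun f \<Longrightarrow> affine_fun (\<lambda>p. f (refl i p))"
  using affine_fun_comp_shear[OF _ lam_affine, of f i "nu i"] by (simp add: refl_def)

lemma affine_fun_unf: "affine_fun f \<Longrightarrow> affine_fun (\<lambda>p. f (unf w p))"
proof (induction w arbitrary: f)
  case (Cons i w)
  show ?case using Cons.IH[OF affine_fun_refl[OF Cons.prems], of i] by simp
qed simp

lemma sep_refl: "i < k \<Longrightarrow> sep (\<lambda>p. f (refl i p)) i \<longleftrightarrow> sep f i"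
  by (simp add: sep_def refl_edge)

lemma unf_append: "unf (v @ w) p = unf v (unf w p)"
  by (induction v) auto

lemma feas_append: "feas f (v @ w) \<longleftrightarrow> feas f v \<and> feas (\<lambda>p. f (unf v p)) w"
  by (induction v arbitrary: f) auto

lemma unf_rev: "set w \<subseteq> {..<k} \<Longrightarrow> unf w (unf (rev w) p) = p"
  by (induction w arbitrary: p) (auto simp: unf_append refl_refl)

lemma adm_rev: "adm (rev w) \<longleftrightarrow> adm w"
  by (simp add: adm_def)

lemma adm_Cons: "adm (i # w) \<longleftrightarrow> i < k \<and> adm w \<and> (w \<noteq> [] \<longrightarrow> hd w \<noteq> i)"
  by (auto simp: adm_def distinct_adj_Cons)

lemma adm_snoc: "adm (w @ [i]) \<longleftrightarrow> i < k \<and> adm w \<and> (w \<noteq> [] \<longrightarrow> last w \<noteq> i)"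
  by (auto simp: adm_def distinct_adj_append_iff)

text \<open>Time reversal: composition with \<open>unf w\<close> moves the last tile onto the
  polygon, and from there the same line crosses the sides in the opposite order. Since
  \<open>refl i\<close> fixes side \<open>i\<close>, it does not matter from which of the two
  adjacent tiles a crossing is tested.\<close>

lemma feas_rev: "set w \<subseteq> {..<k} \<Longrightarrow> feas (\<lambda>p. f (unf w p)) (rev w) \<longleftrightarrow> feas f w"
proof (induction w arbitrary: f)
  case (Cons i w)
  have "feas (\<lambda>p. f (refl i (unf w p))) (rev w) \<longleftrightarrow> feas (\<lambda>p. f (refl i p)) w"
    using Cons.IH[of "\<lambda>p. f (refl i p)"] Cons.prems by simp
  then show ?case using Cons.prems
    by (auto simp: feas_append unf_rev sep_refl)
qed simp

lemma feas_uminus: "feas (\<lambda>p. - f p) w \<longleftrightarrow> feas f w"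
proof (induction w arbitrary: f)
  case (Cons i w)
  then show ?case using Cons.IH[of "\<lambda>p. f (refl i p)"] by (simp add: sep_def)
qed simp

lemma sep_uminus: "sep (\<lambda>p. - f p) i \<longleftrightarrow> sep f i"
  by (simp add: sep_def)

lemma index_shift:
  assumes "i < k" "j < k" "j \<noteq> i"
  obtains l where "1 \<le> l" "l < k" "j = (i + l) mod k"
proof (cases "i \<le> j")
  case True
  then show ?thesis using assms that[of "j - i"] by auto
next
  case False
  then have "(i + (j + k - i)) mod k = j" using assms by simp
  then show ?thesis using assms False that[of "j + k - i"] by auto
qed

text \<open>After the rise along side \<open>i\<close> the only other sign change is a fall, because
  by convexity the values stay negative once they have ceased to be positive.\<close>

lemma sep_oriented:
  assumes "affine_fun f" "f (P i) < 0" "f (P (Suc i)) > 0" "sep f (i + l)" "1 \<le> l" "l < k"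
  shows "f (P (i + l)) > 0" "f (P (Suc (i + l))) < 0"
proof -
  show "f (P (i + l)) > 0"
    using sign_change[OF assms(1-3,5), of "Suc l"] assms(4,6)
    by (auto simp: sep_def mult_less_0_iff)
  then show "f (P (Suc (i + l))) < 0"
    using assms(4) by (auto simp: sep_def mult_less_0_iff)
qed

lemma sep_coherent_neg:
  assumes "affine_fun f" "f (P i) < 0" "sep f i" "sep f j" "i < k" "j < k" "i \<noteq> j"
  shows "f (P j) > 0"
proof -
  obtain l where l: "1 \<le> l" "l < k" "j = (i + l) mod k" using index_shift assms by metis
  have "f (P (Suc i)) > 0" using assms by (auto simp: sep_def mult_less_0_iff)
  then show ?thesis using sep_oriented(1)[OF assms(1,2) _ _ l(1,2)] assms(4) l
    by (simp add: sep_mod P_mod)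
qed

text \<open>The sign of a function on the side of entry forces its sign on the side of exit. Hence
  agreement in sign between two functions propagates along a word.\<close>

lemma sep_coherent:
  assumes f: "affine_fun f" "sep f i" "sep f j" and g: "affine_fun g" "sep g i" "sep g j"
    and ij: "i < k" "j < k" "i \<noteq> j" and s: "f (P i) * g (P i) > 0"
  shows "f (P j) * g (P j) > 0"
proof (cases "f (P i) < 0")
  case True
  then have "g (P i) < 0" using s by (auto simp: zero_less_mult_iff)
  then show ?thesis using sep_coherent_neg[OF f(1) True f(2,3) ij]
     sep_coherent_neg[OF g(1) _ g(2,3) ij] by simp
next
  case False
  then have *: "f (P i) > 0" "g (P i) > 0" using s by (auto simp: zero_less_mult_iff)
  have "- f (P j) > 0"
    using sep_coherent_neg[OF affine_fun_uminus[OF f(1)] _ _ _ ij] * f by (simp add: sep_uminus)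
  moreover have "- g (P j) > 0"
    using sep_coherent_neg[OF affine_fun_uminus[OF g(1)] _ _ _ ij] * g by (simp add: sep_uminus)
  ultimately show ?thesis by (simp add: mult_neg_neg)
qed

lemma sep_convex:
  assumes "sep f i" "sep g i" "f (P i) * g (P i) > 0" "0 \<le> s" "s \<le> 1"
  shows "sep (\<lambda>p. (1 - s) * f p + s * g p) i"
proof -
  let ?a = "f (P i)" and ?b = "f (P (Suc i))" and ?c = "g (P i)" and ?d = "g (P (Suc i))"
  consider "?a > 0" "?b < 0" "?c > 0" "?d < 0" | "?a < 0" "?b > 0" "?c < 0" "?d > 0"
    using assms(1-3) by (auto simp: sep_def mult_less_0_iff zero_less_mult_iff)
  then show ?thesis
  proof cases
    case 1
    then show ?thesis
      using convex_comb_pos[of ?a ?c s] convex_comb_pos[of "-?b" "-?d" s] assms(4,5)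
      by (auto simp: sep_def mult_less_0_iff)
  next
    case 2
    then show ?thesis
      using convex_comb_pos[of "-?a" "-?c" s] convex_comb_pos[of "?b" "?d" s] assms(4,5)
      by (auto simp: sep_def mult_less_0_iff)
  qed
qed

text \<open>The sign condition at the first side cannot be dropped: \<open>f\<close> and
  \<open>- f\<close> realise the same words, and their midpoint is zero. \<open>sep_coherent\<close>
  renews it at every letter.\<close>

lemma feas_convex:
  assumes "affine_fun f" "affine_fun g" "feas f w" "feas g w" "adm w" "w \<noteq> []"
    "f (P (hd w)) * g (P (hd w)) > 0" "0 \<le> s" "s \<le> 1"
  shows "feas (\<lambda>p. (1 - s) * f p + s * g p) w"
  using assms
proof (induction w arbitrary: f g)
  case (Cons i w)
  have i: "i < k" "sep f i" "sep g i" "adm w" using Cons.prems by (auto simp: adm_Cons)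
  have 1: "sep (\<lambda>p. (1 - s) * f p + s * g p) i"
    using sep_convex i Cons.prems by simp
  have "feas (\<lambda>p. (1 - s) * f (refl i p) + s * g (refl i p)) w"
  proof (cases "w = []")
    case False
    then obtain j w' where w: "w = j # w'" by (cases w) auto
    have j: "j < k" "i \<noteq> j" using Cons.prems w by (auto simp: adm_Cons)
    have "f (refl i (P j)) * g (refl i (P j)) > 0"
      using sep_coherent[OF affine_fun_refl _ _ affine_fun_refl, of f i i j g i]
        Cons.prems w i j refl_edge(1)[of i] by (simp add: sep_refl)
    then show ?thesis
      using Cons.IH[OF affine_fun_refl affine_fun_refl, of f g i i] Cons.prems w i by simp
  qed simp
  then show ?case using 1 by simp
qed simp

text \<open>A word imposes finitely many strict inequalities, each continuous in
  \<open>e\<close>.\<close>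

lemma feas_perturb:
  "feas f w \<Longrightarrow> \<forall>\<^sub>F e in nhds 0. feas (\<lambda>p. f p + e * g p) w"
proof (induction w arbitrary: f g)
  case (Cons i w)
  have "((\<lambda>e. (f (P i) + e * g (P i)) * (f (P (Suc i)) + e * g (P (Suc i)))) \<longlongrightarrow>
          (f (P i) + 0 * g (P i)) * (f (P (Suc i)) + 0 * g (P (Suc i)))) (nhds 0)"
    by (intro tendsto_intros filterlim_ident)
  then have "\<forall>\<^sub>F e in nhds 0. sep (\<lambda>p. f p + e * g p) i"
    unfolding sep_def using Cons.prems by (intro order_tendstoD(2)) (auto simp: sep_def)
  moreover have "\<forall>\<^sub>F e in nhds 0. feas (\<lambda>p. f (refl i p) + e * g (refl i p)) w"
    using Cons.IH[of "\<lambda>p. f (refl i p)"] Cons.prems by simp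
  ultimately show ?case by eventually_elim simp
qed simp

end

section \<open>Splitting the words of length n\<close>

lemma eventually_perturb:
  fixes a b :: real
  shows "a < 0 \<Longrightarrow> \<forall>\<^sub>F t in nhds 0. a + t * b < 0"
    and "a > 0 \<Longrightarrow> \<forall>\<^sub>F t in nhds 0. a + t * b > 0"
proof -
  have "((\<lambda>t. a + t * b) \<longlongrightarrow> a + 0 * b) (nhds 0)"
    by (intro tendsto_intros filterlim_ident)
  then have *: "((\<lambda>t. a + t * b) \<longlongrightarrow> a) (nhds 0)" by simp
  show "a < 0 \<Longrightarrow> \<forall>\<^sub>F t in nhds 0. a + t * b < 0" using order_tendstoD(2)[OF *] by blast
  show "a > 0 \<Longrightarrow> \<forall>\<^sub>F t in nhds 0. a + t * b > 0" using order_tendstoD(1)[OF *] by blast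
qed

context convex_polygon
begin

lemma shift_mod_inj: "inj_on (\<lambda>l. (i + l) mod k) {..<k}"
proof (rule inj_onI)
  fix l m assume lm: "l \<in> {..<k}" "m \<in> {..<k}" and eq: "(i + l) mod k = (i + m) mod k"
  show "l = m"
  proof (rule ccontr)
    assume "l \<noteq> m"
    then consider "l < m" | "m < l" by linarith
    then show False
    proof cases
      case 1
      then have "k dvd (i + m) - (i + l)" using eq by (intro mod_eq_dvd_iff_nat[THEN iffD1]) auto
      then show False using 1 lm by (auto dest: dvd_imp_le)
    next
      case 2
      then have "k dvd (i + l) - (i + m)" using eq by (intro mod_eq_dvd_iff_nat[THEN iffD1]) auto
      then show False using 2 lm by (auto dest: dvd_imp_le)
    qed
  qed
qed

lemma P_shift_inj: "inj_on (\<lambda>l. P (i + l)) {..<k}"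
proof (rule inj_onI)
  fix l m assume lm: "l \<in> {..<k}" "m \<in> {..<k}" and "P (i + l) = P (i + m)"
  then have "P ((i + l) mod k) = P ((i + m) mod k)" by (simp add: P_mod)
  then have "(i + l) mod k = (i + m) mod k"
    using P_inj k3 by (auto dest: inj_onD)
  then show "l = m" using shift_mod_inj[of i] lm by (auto dest: inj_onD)
qed

lemma forward_vertices: "i < k \<Longrightarrow> {q \<in> V. lam i q > 0} = (\<lambda>l. P (i + l)) ` {2..<k}"
proof (intro equalityI subsetI)
  fix q assume i: "i < k" and q: "q \<in> {q \<in> V. lam i q > 0}"
  then obtain n where n: "n < k" "q = P n" by (auto simp: V_def)
  have "n \<noteq> i" using n q lam_edge[OF i] by auto
  then obtain l where l: "1 \<le> l" "l < k" "n = (i + l) mod k" using index_shift i n by metis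
  then have "q = P (i + l)" using n P_mod by simp
  moreover have "l \<noteq> 1" using calculation q lam_edge[OF i] by auto
  ultimately show "q \<in> (\<lambda>l. P (i + l)) ` {2..<k}" using l by auto
qed (auto simp: P_in_V lam_pos)

lemma exit_exists:
  fixes h :: "real \<times> real \<Rightarrow> real"
  assumes h: "h (P i) < 0" "h (P (Suc i)) > 0"
    and nonzero: "\<And>l. 2 \<le> l \<Longrightarrow> l < k \<Longrightarrow> h (P (i + l)) \<noteq> 0"
  obtains l where "1 \<le> l" "l < k" "h (P (i + l)) > 0" "h (P (i + Suc l)) < 0"
proof -
  have nz: "h (P (i + l)) \<noteq> 0" if "1 \<le> l" "l \<le> k" for l
  proof -
    have "l = 1 \<or> l = k \<or> 2 \<le> l \<and> l < k" using that by linarith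
    then consider "l = 1" | "l = k" | "2 \<le> l" "l < k" by blast
    then show ?thesis
    proof cases
      case 1
      then show ?thesis using h(2) by simp
    next
      case 2
      then show ?thesis using h(1) P_periodic by simp
    next
      case 3
      then show ?thesis using nonzero by simp
    qed
  qed
  \<comment> \<open>The last vertex with a positive value. It is not the vertex of index
    \<open>i + k\<close>, which is \<open>P i\<close> again.\<close>
  define l where "l = Max {l \<in> {1..k}. h (P (i + l)) > 0}"
  have "1 \<in> {l \<in> {1..k}. h (P (i + l)) > 0}" using h(2) k3 by simp
  then have ne: "{l \<in> {1..k}. h (P (i + l)) > 0} \<noteq> {}" by blast
  have "l \<in> {l \<in> {1..k}. h (P (i + l)) > 0}" unfolding l_def by (rule Max_in[OF _ ne]) simp
  then have l: "1 \<le> l" "l \<le> k" "h (P (i + l)) > 0" by auto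
  have "l \<noteq> k"
  proof
    assume "l = k"
    then have "h (P i) > 0" using l(3) P_periodic by simp
    then show False using h(1) by simp
  qed
  then have "Suc l \<le> k" using l by linarith
  have "\<not> h (P (i + Suc l)) > 0"
  proof
    assume "h (P (i + Suc l)) > 0"
    then have "Suc l \<le> l" unfolding l_def using \<open>Suc l \<le> k\<close>
      by (intro Max_ge) (auto simp: l_def)
    then show False by simp
  qed
  then have "h (P (i + Suc l)) < 0" using nz[of "Suc l"] \<open>Suc l \<le> k\<close> by force
  then show ?thesis using that[of l] l \<open>Suc l \<le> k\<close> by auto
qed

text \<open>Measured by the offset from side \<open>i\<close>, the exit sides \<open>X\<close> form
  an interval \<open>{a..b}\<close>, and the vertices \<open>Y\<close> that can be hit are those
  separating consecutive exits, \<open>{a<..b}\<close>. A zero at a vertex can be perturbed to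
  either sign, so both adjacent sides are exits; two functions with exits on either side of a vertex
  have opposite signs there, so a convex combination vanishes at it.\<close>

lemma card_exits_eq_Suc_card_zeros:
  assumes i: "i < k" and "D \<noteq> {}"
    and D: "\<And>h. h \<in> D \<Longrightarrow> affine_fun h" "\<And>h. h \<in> D \<Longrightarrow> h (P i) < 0" "\<And>h. h \<in> D \<Longrightarrow> h (P (Suc i)) > 0"
    and conv: "\<And>h h' s. h \<in> D \<Longrightarrow> h' \<in> D \<Longrightarrow> 0 \<le> s \<Longrightarrow> s \<le> 1 \<Longrightarrow> (\<lambda>p. (1 - s) * h p + s * h' p) \<in> D"
    and pert: "\<And>h q. h \<in> D \<Longrightarrow> q \<in> V \<Longrightarrow> lam i q > 0 \<Longrightarrow>
      \<exists>e. e q \<noteq> 0 \<and> (\<forall>\<^sub>F t in nhds 0. (\<lambda>p. h p + t * e p) \<in> D)"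
  shows "card {j. j < k \<and> j \<noteq> i \<and> (\<exists>h\<in>D. sep h j)} = Suc (card {q \<in> V. lam i q > 0 \<and> (\<exists>h\<in>D. h q = 0)})"
proof -
  define X where "X = {l \<in> {1..<k}. \<exists>h\<in>D. h (P (i + l)) > 0 \<and> h (P (i + Suc l)) < 0}"
  define Y where "Y = {l \<in> {2..<k}. \<exists>h\<in>D. h (P (i + l)) = 0}"
  have mono: "h (P (i + m)) < 0" if "h \<in> D" "1 \<le> l" "l < m" "m \<le> k" "h (P (i + l)) \<le> 0" for h l m
    using sign_change D that by blast
  have monopos: "h (P (i + l)) > 0" if "h \<in> D" "1 \<le> l" "l < m" "m \<le> k" "h (P (i + m)) \<ge> 0" for h l m
    using mono[OF that(1-4)] that(5) by linarith
  have Y_X: "l \<in> X \<and> l - 1 \<in> X" if l: "l \<in> Y" for l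
  proof -
    obtain h where h: "h \<in> D" "h (P (i + l)) = 0" using l by (auto simp: Y_def)
    have l2: "2 \<le> l" "l < k" using l by (auto simp: Y_def)
    obtain e where e: "e (P (i + l)) \<noteq> 0" and "\<forall>\<^sub>F t in nhds (0::real). (\<lambda>p. h p + t * e p) \<in> D"
      using pert[OF h(1) P_in_V lam_pos[OF i l2]] by blast
    then obtain d where d: "d > 0" "\<And>t. \<bar>t\<bar> < d \<Longrightarrow> (\<lambda>p. h p + t * e p) \<in> D"
      by (auto simp: eventually_nhds_metric dist_real_def)
    have nh: "h (P (i + Suc l)) < 0" "h (P (i + (l - 1))) > 0"
      using mono[OF h(1), of l "Suc l"] monopos[OF h(1), of "l - 1" l] l2 h(2) by auto
    have "\<forall>\<^sub>F t in nhds (0::real). h (P (i + Suc l)) + t * e (P (i + Suc l)) < 0 \<and>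
        h (P (i + (l - 1))) + t * e (P (i + (l - 1))) > 0"
      using eventually_perturb nh by (intro eventually_conj) blast+
    then obtain d' where d': "d' > 0" "\<And>t. \<bar>t\<bar> < d' \<Longrightarrow> h (P (i + Suc l)) + t * e (P (i + Suc l)) < 0 \<and>
        h (P (i + (l - 1))) + t * e (P (i + (l - 1))) > 0"
      by (auto simp: eventually_nhds_metric dist_real_def)
    \<comment> \<open>Small enough for both neighbourhoods, and with the sign of \<open>e\<close> at
      the vertex: adding \<open>u * e\<close> makes the value there positive, subtracting it makes
      it negative.\<close>
    define u where "u = (min d d' / 2) * sgn (e (P (i + l)))"
    have u: "\<bar>u\<bar> < d" "\<bar>-u\<bar> < d" "\<bar>u\<bar> < d'" "\<bar>-u\<bar> < d'"
      using d d' by (auto simp: u_def abs_mult sgn_if)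
    have "u * e (P (i + l)) = (min d d' / 2) * \<bar>e (P (i + l))\<bar>"
      by (simp add: u_def sgn_if)
    then have ue: "u * e (P (i + l)) > 0" using e d(1) d'(1) by (simp only:) (intro mult_pos_pos, auto)
    have "l \<in> X" using d(2)[OF u(1)] d'(2)[OF u(3)] l2 h(2) ue
      by (auto simp: X_def intro!: bexI[of _ "\<lambda>p. h p + u * e p"])
    moreover have "l - 1 \<in> X" using d(2)[OF u(2)] d'(2)[OF u(4)] l2 h(2) ue
      by (auto simp: X_def intro!: bexI[of _ "\<lambda>p. h p + (- u) * e p"])
    ultimately show ?thesis ..
  qed
  have X_Y: "m \<in> Y" if "a \<in> X" "b \<in> X" "a < m" "m \<le> b" for a b m
  proof -
    obtain f where f: "f \<in> D" "f (P (i + Suc a)) < 0" using \<open>a \<in> X\<close> by (auto simp: X_def)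
    obtain g where g: "g \<in> D" "g (P (i + b)) > 0" using \<open>b \<in> X\<close> by (auto simp: X_def)
    have ab: "1 \<le> a" "b < k" using that by (auto simp: X_def)
    have fm: "f (P (i + m)) < 0"
      using mono[OF f(1), of "Suc a" m] f(2) ab that by (cases "m = Suc a") auto
    have gm: "g (P (i + m)) > 0"
      using monopos[OF g(1), of m b] g(2) ab that by (cases "m = b") auto
    \<comment> \<open>The weight at which the interpolation between \<open>f\<close> and
      \<open>g\<close> vanishes at the vertex of offset \<open>m\<close>.\<close>
    define s where "s = - f (P (i + m)) / (g (P (i + m)) - f (P (i + m)))"
    have s: "0 \<le> s" "s \<le> 1" "(1 - s) * f (P (i + m)) + s * g (P (i + m)) = 0"
      using fm gm by (auto simp: s_def field_simps)
    show ?thesis using conv[OF f(1) g(1) s(1,2)] s(3) that ab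
      by (auto simp: Y_def intro!: bexI[of _ "\<lambda>p. (1 - s) * f p + s * g p"])
  qed
  have "X \<noteq> {}"
  proof (cases "Y = {}")
    case True
    obtain h where h: "h \<in> D" using \<open>D \<noteq> {}\<close> by blast
    obtain l where "1 \<le> l" "l < k" "h (P (i + l)) > 0" "h (P (i + Suc l)) < 0"
      using exit_exists[OF D(2,3)[OF h]] True h by (auto simp: Y_def)
    then have "l \<in> X" using h by (auto simp: X_def)
    then show ?thesis by blast
  qed (use Y_X in auto)
  have fX: "finite X" by (simp add: X_def)
  define a b where "a = Min X" and "b = Max X"
  have ab: "a \<in> X" "b \<in> X" "a \<le> b" using fX \<open>X \<noteq> {}\<close> by (auto simp: a_def b_def)
  have "Y = {a<..b}"
  proof (intro equalityI subsetI)
    fix l assume l: "l \<in> Y"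
    then have "l \<le> b" "a \<le> l - 1" "2 \<le> l" using Y_X[OF l] fX by (auto simp: a_def b_def Y_def)
    then show "l \<in> {a<..b}" by auto
  qed (use X_Y ab in auto)
  moreover have "X = {a..b}"
  proof (intro equalityI subsetI)
    fix l assume "l \<in> {a..b}"
    then show "l \<in> X" using ab Y_X \<open>Y = {a<..b}\<close> by (cases "l = a") auto
  qed (use fX in \<open>auto simp: a_def b_def\<close>)
  ultimately have "card X = Suc (card Y)" using ab by simp
  moreover have "{j. j < k \<and> j \<noteq> i \<and> (\<exists>h\<in>D. sep h j)} = (\<lambda>l. (i + l) mod k) ` X"
  proof (intro equalityI subsetI)
    fix j assume "j \<in> {j. j < k \<and> j \<noteq> i \<and> (\<exists>h\<in>D. sep h j)}"
    then obtain h where h: "j < k" "j \<noteq> i" "h \<in> D" "sep h j" by blast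
    obtain l where l: "1 \<le> l" "l < k" "j = (i + l) mod k" using index_shift i h by metis
    have "sep h (i + l)" using h l sep_mod by simp
    then have "l \<in> X" using sep_oriented[OF D[OF h(3)] _ l(1,2)] l h by (auto simp: X_def)
    then show "j \<in> (\<lambda>l. (i + l) mod k) ` X" using l by blast
  next
    fix j assume "j \<in> (\<lambda>l. (i + l) mod k) ` X"
    then obtain l where l: "l \<in> X" "j = (i + l) mod k" by blast
    then obtain h where h: "h \<in> D" "h (P (i + l)) > 0" "h (P (i + Suc l)) < 0" by (auto simp: X_def)
    have "sep h (i + l)" using h by (auto simp: sep_def mult_less_0_iff)
    then have "sep h j" using l sep_mod by simp
    moreover have "j \<noteq> i"
    proof
      assume "j = i"
      then have "P (i + l) = P i" using l P_mod[of "i + l"] by simp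
      then show False using h D(2)[of h] by simp
    qed
    ultimately show "j \<in> {j. j < k \<and> j \<noteq> i \<and> (\<exists>h\<in>D. sep h j)}" using h l k3 by auto
  qed
  moreover have "inj_on (\<lambda>l. (i + l) mod k) X"
    by (rule inj_on_subset[OF shift_mod_inj]) (auto simp: X_def)
  moreover have "{q \<in> V. lam i q > 0 \<and> (\<exists>h\<in>D. h q = 0)} = (\<lambda>l. P (i + l)) ` Y"
  proof -
    have "{q \<in> V. lam i q > 0 \<and> (\<exists>h\<in>D. h q = 0)} = {q \<in> {q \<in> V. lam i q > 0}. \<exists>h\<in>D. h q = 0}"
      by blast
    also have "\<dots> = (\<lambda>l. P (i + l)) ` Y" unfolding forward_vertices[OF i] Y_def
      by (simp only: Compr_image_eq)
    finally show ?thesis .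
  qed
  moreover have "inj_on (\<lambda>l. P (i + l)) Y"
    by (rule inj_on_subset[OF P_shift_inj]) (auto simp: Y_def)
  ultimately show ?thesis by (simp add: card_image)
qed

text \<open>
  The lines are restricted to those of \<open>f \<in> L\<close>, and the first letter to \<open>J\<close>: this covers both all lines
  (\<open>lang\<close>) and the rays from a vertex \<open>c\<close> (\<open>beam c\<close>).
\<close>

definition W :: "nat set \<Rightarrow> (real \<times> real \<Rightarrow> real) set \<Rightarrow> nat \<Rightarrow> nat list set" where
  "W J L n = {w. length w = n \<and> adm w \<and> hd w \<in> J \<and> (\<exists>f\<in>L. affine_fun f \<and> feas f w)}"

definition Z :: "nat set \<Rightarrow> (real \<times> real \<Rightarrow> real) set \<Rightarrow> nat \<Rightarrow> (nat list \<times> (real \<times> real)) set" where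
  "Z J L n = {(w, q). length w = n \<and> adm w \<and> hd w \<in> J \<and> q \<in> V \<and> lam (last w) q > 0 \<and>
     (\<exists>f\<in>L. affine_fun f \<and> feas f w \<and> f (unf w q) = 0)}"

lemma finite_W: "finite (W J L n)"
  by (rule finite_subset[OF _ finite_lists_length_eq[of "{..<k}" n]]) (auto simp: W_def adm_def)

text \<open>For each word the extensions outnumber the reachable vertices by one, by
  \<open>card_exits_eq_Suc_card_zeros\<close> in the last tile. Closure of \<open>L\<close> under
  linear combinations supplies convexity and the change of sign, \<open>nonvanish\<close> the
  perturbation; summing over the words gives the claim.\<close>

lemma card_W_Suc:
  assumes n: "n \<ge> 1"
    and L: "\<And>f g s t. f \<in> L \<Longrightarrow> g \<in> L \<Longrightarrow> (\<lambda>p. s * f p + t * g p) \<in> L"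
    and nonvanish: "\<And>w q. w \<in> W J L n \<Longrightarrow> q \<in> V \<Longrightarrow> lam (last w) q > 0 \<Longrightarrow>
      \<exists>e\<in>L. affine_fun e \<and> e (unf w q) \<noteq> 0"
  shows "card (W J L (Suc n)) = card (W J L n) + card (Z J L n)"
proof -
  define X where "X w = {j. j < k \<and> j \<noteq> last w \<and> (\<exists>f\<in>L. affine_fun f \<and> feas f (w @ [j]))}" for w
  define Y where "Y w = {q \<in> V. lam (last w) q > 0 \<and> (\<exists>f\<in>L. affine_fun f \<and> feas f w \<and> f (unf w q) = 0)}" for w
  have XY: "card (X w) = Suc (card (Y w))" if w: "w \<in> W J L n" for w
  proof -
    have w0: "length w = n" "adm w" "w \<noteq> []" using w n by (auto simp: W_def)
    define i where "i = last w"
    have sw: "set w \<subseteq> {..<k}" using w0 by (auto simp: adm_def)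
    then have i: "i < k" using w0(3) last_in_set[of w] unfolding i_def by blast
    \<comment> \<open>The functions of \<open>L\<close> realising \<open>w\<close>, seen from the
      last tile and normalised to rise along the side by which it is entered. Without the
      normalisation, \<open>h\<close> and \<open>- h\<close> would both belong to \<open>D\<close>
      and spoil convexity.\<close>
    define D where "D = {h. affine_fun h \<and> (\<lambda>p. h (unf (rev w) p)) \<in> L \<and> feas h (rev w) \<and>
      h (P i) < 0 \<and> h (P (Suc i)) > 0}"
    have rw: "hd (rev w) = i" "rev w \<noteq> []" using w0 by (auto simp: i_def hd_rev)
    have D_of: "\<exists>h\<in>D. h = (\<lambda>p. f (unf w p)) \<or> h = (\<lambda>p. - f (unf w p))"
      if f: "f \<in> L" "affine_fun f" "feas f w" for f
    proof -
      let ?h = "\<lambda>p. f (unf w p)"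
      have fr: "feas ?h (rev w)" using feas_rev sw f by simp
      have *: "?h \<in> D" if "?h (P i) < 0" "?h (P (Suc i)) > 0"
        using that f fr affine_fun_unf[OF f(2), of w] sw by (simp add: D_def unf_rev)
      have mL: "(\<lambda>p. - f p) \<in> L" using L[OF f(1) f(1), of "-1" 0] by simp
      have **: "(\<lambda>p. - f (unf w p)) \<in> D" if "?h (P i) > 0" "?h (P (Suc i)) < 0"
        using that f fr affine_fun_uminus[OF affine_fun_unf[OF f(2), of w]] sw mL feas_uminus[of ?h "rev w"]
        by (simp add: D_def unf_rev)
      have "sep ?h i" using fr rw by (cases "rev w") auto
      then show ?thesis using * ** by (auto simp: sep_def mult_less_0_iff)
    qed
    have D_L: "\<exists>f\<in>L. affine_fun f \<and> feas f w \<and> (\<lambda>p. f (unf w p)) = h" if h: "h \<in> D" for h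
      using h feas_rev[of "rev w" h] affine_fun_unf[of h "rev w"] sw unf_rev[of "rev w"]
      by (intro bexI[of _ "\<lambda>p. h (unf (rev w) p)"]) (auto simp: D_def)
    have "X w = {j. j < k \<and> j \<noteq> i \<and> (\<exists>h\<in>D. sep h j)}"
    proof -
      have "(\<exists>f\<in>L. affine_fun f \<and> feas f (w @ [j])) \<longleftrightarrow> (\<exists>h\<in>D. sep h j)" for j
      proof
        assume "\<exists>f\<in>L. affine_fun f \<and> feas f (w @ [j])"
        then obtain f where f: "f \<in> L" "affine_fun f" "feas f w" "sep (\<lambda>p. f (unf w p)) j"
          by (auto simp: feas_append)
        moreover obtain h where "h \<in> D" "h = (\<lambda>p. f (unf w p)) \<or> h = (\<lambda>p. - f (unf w p))"
          using D_of f by blast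
        ultimately show "\<exists>h\<in>D. sep h j" by (intro bexI[of _ h]) (auto simp: sep_uminus)
      next
        assume "\<exists>h\<in>D. sep h j"
        then obtain h where "h \<in> D" "sep h j" by blast
        moreover obtain f where "f \<in> L" "affine_fun f" "feas f w" "(\<lambda>p. f (unf w p)) = h"
          using D_L calculation by blast
        ultimately show "\<exists>f\<in>L. affine_fun f \<and> feas f (w @ [j])"
          by (intro bexI[of _ f]) (simp_all add: feas_append)
      qed
      then show ?thesis by (simp add: X_def i_def)
    qed
    moreover have "Y w = {q \<in> V. lam i q > 0 \<and> (\<exists>h\<in>D. h q = 0)}"
    proof -
      have "(\<exists>f\<in>L. affine_fun f \<and> feas f w \<and> f (unf w q) = 0) \<longleftrightarrow> (\<exists>h\<in>D. h q = 0)" for q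
      proof
        assume "\<exists>f\<in>L. affine_fun f \<and> feas f w \<and> f (unf w q) = 0"
        then obtain f where "f \<in> L" "affine_fun f" "feas f w" "f (unf w q) = 0" by blast
        moreover obtain h where "h \<in> D" "h = (\<lambda>p. f (unf w p)) \<or> h = (\<lambda>p. - f (unf w p))"
          using D_of calculation by blast
        ultimately show "\<exists>h\<in>D. h q = 0" by (intro bexI[of _ h]) auto
      next
        assume "\<exists>h\<in>D. h q = 0"
        then obtain h where "h \<in> D" "h q = 0" by blast
        moreover obtain f where "f \<in> L" "affine_fun f" "feas f w" "(\<lambda>p. f (unf w p)) = h"
          using D_L calculation by blast
        ultimately show "\<exists>f\<in>L. affine_fun f \<and> feas f w \<and> f (unf w q) = 0"
          by (intro bexI[of _ f]) auto
      qed
      then show ?thesis by (simp add: Y_def i_def)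
    qed
    moreover have "card {j. j < k \<and> j \<noteq> i \<and> (\<exists>h\<in>D. sep h j)} = Suc (card {q \<in> V. lam i q > 0 \<and> (\<exists>h\<in>D. h q = 0)})"
    proof (rule card_exits_eq_Suc_card_zeros[OF i])
      show "D \<noteq> {}" using w D_of unfolding W_def by blast
    next
      fix h h' :: "real \<times> real \<Rightarrow> real" and s :: real
      assume h: "h \<in> D" "h' \<in> D" and s: "0 \<le> s" "s \<le> 1"
      have "feas (\<lambda>p. (1 - s) * h p + s * h' p) (rev w)"
        by (rule feas_convex) (use h s rw w0 in \<open>auto simp: D_def adm_rev mult_neg_neg\<close>)
      moreover have "(1 - s) * h (P i) + s * h' (P i) < 0"
        using convex_comb_pos[of "- h (P i)" "- h' (P i)" s] h s by (auto simp: D_def)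
      moreover have "(1 - s) * h (P (Suc i)) + s * h' (P (Suc i)) > 0"
        using convex_comb_pos[of "h (P (Suc i))" "h' (P (Suc i))" s] h s by (auto simp: D_def)
      ultimately show "(\<lambda>p. (1 - s) * h p + s * h' p) \<in> D"
        using h affine_fun_lincomb[of h h' "1 - s" s] 
          L[of "\<lambda>p. h (unf (rev w) p)" "\<lambda>p. h' (unf (rev w) p)" "1 - s" s]
        by (simp add: D_def)
    next
      fix h q assume h: "h \<in> D" and q: "q \<in> V" "lam i q > 0"
      obtain e0 where e0: "e0 \<in> L" "affine_fun e0" "e0 (unf w q) \<noteq> 0"
        using nonvanish[OF w q(1)] q(2) by (auto simp: i_def)
      define e where "e = (\<lambda>p. e0 (unf w p))"
      have e: "affine_fun e" "(\<lambda>p. e (unf (rev w) p)) \<in> L"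
        using e0 affine_fun_unf sw by (auto simp: e_def unf_rev)
      have "\<forall>\<^sub>F t in nhds 0. feas (\<lambda>p. h p + t * e p) (rev w)"
        using h by (intro feas_perturb) (auto simp: D_def)
      moreover have "\<forall>\<^sub>F t in nhds (0::real). h (P i) + t * e (P i) < 0"
        using h by (intro eventually_perturb) (simp add: D_def)
      moreover have "\<forall>\<^sub>F t in nhds (0::real). h (P (Suc i)) + t * e (P (Suc i)) > 0"
        using h by (intro eventually_perturb) (simp add: D_def)
      ultimately have "\<forall>\<^sub>F t in nhds 0. (\<lambda>p. h p + t * e p) \<in> D"
      proof eventually_elim
        case (elim t)
        then show ?case using h e affine_fun_lincomb[of h e 1 t]
          L[of "\<lambda>p. h (unf (rev w) p)" "\<lambda>p. e (unf (rev w) p)" 1 t] by (simp add: D_def)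
      qed
      then show "\<exists>e. e q \<noteq> 0 \<and> (\<forall>\<^sub>F t in nhds 0. (\<lambda>p. h p + t * e p) \<in> D)"
        using e0(3) by (intro exI[of _ e]) (simp add: e_def)
    qed (auto simp: D_def)
    ultimately show ?thesis by simp
  qed
  have "W J L (Suc n) = (\<lambda>(w, j). w @ [j]) ` Sigma (W J L n) X"
  proof (intro equalityI subsetI)
    fix w' assume w': "w' \<in> W J L (Suc n)"
    then obtain w j where w: "w' = w @ [j]" by (cases w' rule: rev_cases) (auto simp: W_def)
    have "w \<noteq> []" using w w' n by (auto simp: W_def)
    then have "w \<in> W J L n \<and> j \<in> X w"
      using w' unfolding w W_def X_def by (auto simp: adm_snoc feas_append)
    then show "w' \<in> (\<lambda>(w, j). w @ [j]) ` Sigma (W J L n) X" using w by force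
  next
    fix w' assume "w' \<in> (\<lambda>(w, j). w @ [j]) ` Sigma (W J L n) X"
    then obtain w j where w: "w' = w @ [j]" "w \<in> W J L n" "j \<in> X w" by auto
    moreover have "w \<noteq> []" using w n by (auto simp: W_def)
    ultimately show "w' \<in> W J L (Suc n)"
      by (auto simp: W_def X_def adm_snoc)
  qed
  moreover have "inj_on (\<lambda>(w, j). w @ [j]) (Sigma (W J L n) X)"
    by (auto simp: inj_on_def)
  ultimately have "card (W J L (Suc n)) = card (Sigma (W J L n) X)"
    by (simp add: card_image)
  also have "\<dots> = (\<Sum>w\<in>W J L n. card (X w))"
    by (rule card_SigmaI) (auto simp: finite_W X_def)
  also have "\<dots> = (\<Sum>w\<in>W J L n. 1 + card (Y w))"
    by (rule sum.cong) (auto simp: XY)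
  also have "\<dots> = card (W J L n) + (\<Sum>w\<in>W J L n. card (Y w))"
    by (simp only: sum.distrib) simp
  also have "(\<Sum>w\<in>W J L n. card (Y w)) = card (Sigma (W J L n) Y)"
    by (rule card_SigmaI[symmetric]) (auto simp: finite_W Y_def finite_V)
  also have "Sigma (W J L n) Y = Z J L n"
    by (auto simp: W_def Y_def Z_def)
  finally show ?thesis .
qed

text \<open>Seen from the last tile, a line through the vertex \<open>q\<close> is a ray from
  \<open>q\<close> that reads the word backwards.\<close>

lemma feas_rev_iff:
  assumes "set w \<subseteq> {..<k}"
  shows "(\<exists>f. affine_fun f \<and> feas f w \<and> f (unf w q) = 0) \<longleftrightarrow>
    (\<exists>f\<in>{f. f q = 0}. affine_fun f \<and> feas f (rev w))"
proof
  assume "\<exists>f. affine_fun f \<and> feas f w \<and> f (unf w q) = 0"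
  then obtain f where "affine_fun f" "feas f w" "f (unf w q) = 0" by blast
  then show "\<exists>f\<in>{f. f q = 0}. affine_fun f \<and> feas f (rev w)"
    using affine_fun_unf feas_rev[OF assms] by (intro bexI[of _ "\<lambda>p. f (unf w p)"]) auto
next
  assume "\<exists>f\<in>{f. f q = 0}. affine_fun f \<and> feas f (rev w)"
  then obtain f where "affine_fun f" "feas f (rev w)" "f q = 0" by blast
  then show "\<exists>f. affine_fun f \<and> feas f w \<and> f (unf w q) = 0"
    using affine_fun_unf[of f "rev w"] feas_rev[of "rev w" f] assms unf_rev[of "rev w"]
    by (intro exI[of _ "\<lambda>p. f (unf (rev w) p)"]) auto
qed

definition lang :: "nat \<Rightarrow> nat list set" where
  "lang n = W UNIV UNIV n"

definition beam :: "real \<times> real \<Rightarrow> nat \<Rightarrow> nat list set" where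
  "beam c n = W {i. lam i c > 0} {f. f c = 0} n"

text \<open>A generalised diagonal is coded by the word \<open>w\<close> that it crosses and the
  vertex \<open>q\<close> of the last tile in which it ends.\<close>

definition diag :: "real \<times> real \<Rightarrow> nat \<Rightarrow> (nat list \<times> (real \<times> real)) set" where
  "diag c n = Z {i. lam i c > 0} {f. f c = 0} n"

text \<open>When all lines are allowed, the constant 1 serves as perturbation at every vertex.
  Reversal carries \<open>(w, q)\<close> to a ray from \<open>q\<close> with word
  \<open>rev w\<close>, and the condition on the last letter becomes the one on the first letter in
  \<open>beam\<close>.\<close>

lemma card_lang_Suc:
  assumes n: "n \<ge> 1"
  shows "card (lang (Suc n)) = card (lang n) + (\<Sum>c\<in>V. card (beam c n))"
proof -
  have "\<exists>e\<in>UNIV. affine_fun e \<and> e p \<noteq> 0" for p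
    by (intro bexI[of _ "\<lambda>p. 1"]) (auto simp: affine_fun_const)
  then have "card (lang (Suc n)) = card (lang n) + card (Z UNIV UNIV n)"
    unfolding lang_def by (intro card_W_Suc[OF n]) auto
  moreover have "card (Z UNIV UNIV n) = card (Sigma V (\<lambda>c. beam c n))"
  proof (rule bij_betw_same_card[of "\<lambda>(w, q). (q, rev w)"], rule bij_betw_byWitness[where f' = "\<lambda>(q, w). (rev w, q)"])
    have *: "(w, q) \<in> Z UNIV UNIV n \<longleftrightarrow> q \<in> V \<and> rev w \<in> beam q n" for w q
    proof (cases "adm w \<and> length w = n")
      case True
      then have "set w \<subseteq> {..<k}" "hd (rev w) = last w" by (simp_all add: adm_def hd_rev)
      then show ?thesis using True feas_rev_iff[of w q]
        by (simp only: Z_def beam_def W_def adm_rev mem_Collect_eq split_conv length_rev UNIV_I bex_UNIV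
          simp_thms conj_ac)
    next
      case False
      then show ?thesis by (simp only: Z_def beam_def W_def adm_rev mem_Collect_eq split_conv length_rev) blast
    qed
    show "(\<lambda>(w, q). (q, rev w)) ` Z UNIV UNIV n \<subseteq> Sigma V (\<lambda>c. beam c n)"
    proof
      fix z :: "(real \<times> real) \<times> nat list" assume "z \<in> (\<lambda>(w, q). (q, rev w)) ` Z UNIV UNIV n"
      then obtain w q where "z = (q, rev w)" "(w, q) \<in> Z UNIV UNIV n" by (auto elim!: imageE)
      then show "z \<in> Sigma V (\<lambda>c. beam c n)" using *[of w q] by blast
    qed
    show "(\<lambda>(q, w). (rev w, q)) ` Sigma V (\<lambda>c. beam c n) \<subseteq> Z UNIV UNIV n"
    proof
      fix z :: "nat list \<times> (real \<times> real)" assume "z \<in> (\<lambda>(q, w). (rev w, q)) ` Sigma V (\<lambda>c. beam c n)"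
      then obtain w q where "z = (rev w, q)" "q \<in> V" "w \<in> beam q n" by (auto elim!: imageE)
      then show "z \<in> Z UNIV UNIV n" using *[of "rev w" q] by simp
    qed
  qed auto
  moreover have "\<dots> = (\<Sum>c\<in>V. card (beam c n))"
    by (rule card_SigmaI) (auto simp: finite_V beam_def finite_W)
  ultimately show ?thesis by simp
qed

end

section \<open>Following a ray through the tiling\<close>

lemma affine_fun_kernel_line:
  assumes f: "affine_fun f" "f u \<noteq> f v" and "d \<noteq> 0" "f x = 0" "f (x + d) = 0" "f y = 0"
  obtains t where "y = x + t *\<^sub>R d"
proof -
  obtain a b c where f: "\<And>x y. f (x, y) = a * x + b * y + c"
    using assms(1) unfolding affine_fun_def by blast
  obtain x1 x2 where x: "x = (x1, x2)" by (cases x)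
  obtain y1 y2 where y: "y = (y1, y2)" by (cases y)
  obtain d1 d2 where d: "d = (d1, d2)" by (cases d)
  have ab: "a \<noteq> 0 \<or> b \<noteq> 0"
    using \<open>f u \<noteq> f v\<close> by (cases u; cases v) (auto simp: f)
  have 1: "a * d1 + b * d2 = 0" and 2: "a * (y1 - x1) + b * (y2 - x2) = 0"
    using assms(4-6) by (simp_all add: f x y d algebra_simps)
  \<comment> \<open>Elimination: both coefficients of \<open>f\<close> annihilate the cross product
    of \<open>y - x\<close> and \<open>d\<close>, and they are not both zero.\<close>
  have "a * ((y1 - x1) * d2 - (y2 - x2) * d1) = d2 * (a * (y1 - x1) + b * (y2 - x2)) - (y2 - x2) * (a * d1 + b * d2)"
    "b * ((y1 - x1) * d2 - (y2 - x2) * d1) = (y1 - x1) * (a * d1 + b * d2) - d1 * (a * (y1 - x1) + b * (y2 - x2))"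
    by (simp_all add: algebra_simps)
  then have 3: "(y1 - x1) * d2 = (y2 - x2) * d1" using ab 1 2 by auto
  show ?thesis
  proof (cases "d1 = 0")
    case True
    then show ?thesis using 3 d \<open>d \<noteq> 0\<close> that[of "(y2 - x2) / d2"] by (simp add: x y zero_prod_def)
  next
    case False
    then show ?thesis using 3 that[of "(y1 - x1) / d1"] by (simp add: x y d field_simps)
  qed
qed

text \<open>The combination \<open>f u * g - g u * f\<close> vanishes at \<open>x\<close>,
  \<open>y\<close> and \<open>u\<close>, which are not collinear, hence everywhere.\<close>

lemma affine_fun_proportional:
  assumes "affine_fun f" "affine_fun g" "f x = 0" "f y = 0" "g x = 0" "g y = 0" "x \<noteq> y" "f u \<noteq> 0"
  obtains s where "\<And>p. g p = s * f p"
proof -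
  have "affine_fun (\<lambda>p. f u * g p + (- g u) * f p)" (is "affine_fun ?h")
    by (rule affine_fun_lincomb) (use assms in auto)
  moreover have "?h p = 0" for p
  proof (rule ccontr)
    assume "?h p \<noteq> 0"
    then have "?h p \<noteq> ?h u" by simp
    then obtain t where "u = x + t *\<^sub>R (y - x)"
      by (rule affine_fun_kernel_line[OF calculation, of p u "y - x" x u]) (use assms in auto)
    then have "f u = 0" using affine_fun_line[OF assms(1), of x t "y - x"]
        affine_fun_line[OF assms(1), of x 1 "y - x"] assms(3,4) by simp
    then show False using assms by simp
  qed
  ultimately have "g p = (g u / f u) * f p" for p
    using assms(8) by (simp add: field_simps)
  then show ?thesis using that by blast
qed

lemma affine_fun_between:
  assumes f: "affine_fun f" and t: "s < t" "t < s'" and "f (x + s *\<^sub>R d) \<ge> 0" "f (x + s' *\<^sub>R d) \<ge> 0"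
    "f (x + s *\<^sub>R d) > 0 \<or> f (x + s' *\<^sub>R d) > 0"
  shows "f (x + t *\<^sub>R d) > 0"
proof -
  define r where "r = (t - s) / (s' - s)"
  have r: "0 < r" "r < 1" using t by (auto simp: r_def field_simps)
  have "r * (s' - s) = t - s" using t by (simp add: r_def)
  then have "x + t *\<^sub>R d = (1 - r) *\<^sub>R (x + s *\<^sub>R d) + r *\<^sub>R (x + s' *\<^sub>R d)"
    by (simp add: algebra_simps flip: scaleR_add_left scaleR_left_diff_distrib)
  then have "f (x + t *\<^sub>R d) = (1 - r) * f (x + s *\<^sub>R d) + r * f (x + s' *\<^sub>R d)"
    by (simp only: affine_fun_segment[OF f])
  then show ?thesis using r assms(4-6) by (auto intro: add_pos_nonneg add_nonneg_pos)
qed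

definition lat :: "real \<times> real \<Rightarrow> bool" where
  "lat p \<longleftrightarrow> fst p \<in> \<int> \<and> snd p \<in> \<int>"

context convex_polygon
begin

text \<open>Different sides share at most one vertex, and the vertices not on side \<open>l\<close>
  lie strictly inside its half plane.\<close>

lemma lam_edge_other:
  assumes "l < k" "i < k" "l \<noteq> i"
  shows "lam l (P i) \<ge> 0" "lam l (P (Suc i)) \<ge> 0" "lam l (P i) > 0 \<or> lam l (P (Suc i)) > 0"
proof -
  note l = assms(1) and i = assms(2)
  obtain m where m: "1 \<le> m" "m < k" "i = (l + m) mod k" using index_shift[of l i] assms by metis
  have Pi: "P i = P (l + m)" "P (Suc i) = P (l + Suc m)"
    using m P_mod[of "l + m"] P_mod[of "Suc (l + m)"] P_mod[of "Suc i"] by (simp_all add: mod_Suc_eq)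
  show "lam l (P i) \<ge> 0" "lam l (P (Suc i)) \<ge> 0" using lam_nonneg P_in_V l by auto
  show "lam l (P i) > 0 \<or> lam l (P (Suc i)) > 0"
  proof (cases "m = 1")
    case True
    then show ?thesis using lam_pos[OF l, of 2] k3 Pi by (simp add: numeral_2_eq_2)
  next
    case False
    then show ?thesis using lam_pos[OF l, of m] m Pi by simp
  qed
qed

text \<open>The zero of \<open>f\<close> on side \<open>i\<close>, by linear interpolation between
  the ends; meaningful when \<open>sep f i\<close>, which makes the denominator nonzero.\<close>

definition cross :: "(real \<times> real \<Rightarrow> real) \<Rightarrow> nat \<Rightarrow> real \<times> real" where
  "cross f i = (1 - f (P i) / (f (P i) - f (P (Suc i)))) *\<^sub>R P i
     + (f (P i) / (f (P i) - f (P (Suc i)))) *\<^sub>R P (Suc i)"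

lemma cross:
  assumes f: "affine_fun f" "sep f i" and i: "i < k"
  shows "f (cross f i) = 0"
    and "lam i (cross f i) = 0"
    and "\<And>l. l < k \<Longrightarrow> l \<noteq> i \<Longrightarrow> lam l (cross f i) > 0"
    and "cross f i \<in> open_segment (P i) (P (Suc i))"
proof -
  define r where "r = f (P i) / (f (P i) - f (P (Suc i)))"
  have ne: "f (P i) \<noteq> f (P (Suc i))" using f by (auto simp: sep_def mult_less_0_iff)
  have r: "0 < r" "r < 1" using f by (auto simp: r_def sep_def mult_less_0_iff field_simps)
  have c: "cross f i = (1 - r) *\<^sub>R P i + r *\<^sub>R P (Suc i)" by (simp add: cross_def r_def)
  have v: "g (cross f i) = (1 - r) * g (P i) + r * g (P (Suc i))" if "affine_fun g" for g
    unfolding c by (rule affine_fun_segment[OF that])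
  show "f (cross f i) = 0" unfolding v[OF f(1)] using ne by (simp add: r_def field_simps)
  show "lam i (cross f i) = 0" unfolding v[OF lam_affine] using lam_edge[OF i] by simp
  show "lam l (cross f i) > 0" if l: "l < k" "l \<noteq> i" for l
  proof -
    show ?thesis unfolding v[OF lam_affine] using r lam_edge_other[OF l(1) i l(2)]
      by (auto intro: add_pos_nonneg add_nonneg_pos)
  qed
  have "P i \<noteq> P (Suc i)" using ne by auto
  then show "cross f i \<in> open_segment (P i) (P (Suc i))"
    using r unfolding c by (auto simp: in_segment)
qed

lemma P_Suc_neq: "P i \<noteq> P (Suc i)"
  using P_shift_inj[of i] k3 by (auto dest!: inj_onD[of _ _ 0 1])

text \<open>The two end values have opposite signs unless both are zero. In that case the zero line
  of \<open>f\<close> would be the line of the side, which does not contain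
  \<open>y\<close>.\<close>

lemma sep_of_weighted_zero:
  assumes f: "affine_fun f" "f u \<noteq> 0" and i: "i < k" and ab: "a > 0" "b > 0"
    and zero: "a * f (P i) + b * f (P (Suc i)) = 0" and y: "lam i y > 0" "f y = 0"
  shows "sep f i"
proof -
  have "f (P i) \<noteq> 0"
  proof
    assume 0: "f (P i) = 0"
    then have 1: "f (P (Suc i)) = 0" using zero ab by simp
    have "P (Suc i) - P i \<noteq> 0" using P_Suc_neq[of i] by simp
    then obtain t where "y = P i + t *\<^sub>R (P (Suc i) - P i)"
      using affine_fun_kernel_line[OF f(1), of u y "P (Suc i) - P i" "P i" y] 0 1 f(2) y(2) by auto
    then have "lam i y = 0"
      using affine_fun_line[OF lam_affine, of i "P i" t "P (Suc i) - P i"]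
        affine_fun_line[OF lam_affine, of i "P i" 1 "P (Suc i) - P i"] lam_edge[OF i] by simp
    then show False using y by simp
  qed
  then have "f (P i) * f (P i) > 0" by (metis not_real_square_gt_zero)
  moreover have "b * (f (P i) * f (P (Suc i))) = - (a * (f (P i) * f (P i)))"
  proof -
    have "b * f (P (Suc i)) = - (a * f (P i))" using zero by simp
    moreover have "b * (f (P i) * f (P (Suc i))) = f (P i) * (b * f (P (Suc i)))" by simp
    ultimately show ?thesis by simp
  qed
  ultimately have "b * (f (P i) * f (P (Suc i))) < 0" using ab by simp
  then show ?thesis using ab by (simp add: sep_def mult_less_0_iff)
qed

text \<open>Every exit is a fall by \<open>sep_oriented\<close>, and after the first fall the values
  stay negative until the tour is back at side \<open>i\<close>.\<close>

lemma sep_unique: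
  assumes f: "affine_fun f" "sep f i" "sep f j" "sep f j'" and ij: "i < k" "j < k" "j' < k" "j \<noteq> i" "j' \<noteq> i"
  shows "j = j'"
proof -
  have *: "l = l'" if g: "affine_fun g" "g (P i) < 0" "g (P (Suc i)) > 0" "sep g (i + l)" "sep g (i + l')"
    and "1 \<le> l" "l < k" "1 \<le> l'" "l' < k" for g l l'
  proof -
    have **: False if "sep g (i + a)" "sep g (i + b)" "1 \<le> a" "a < b" "b < k" for a b
      using sign_change[OF g(1-3), of "Suc a" b] sep_oriented[OF g(1-3), of a] sep_oriented[OF g(1-3), of b] that
      by (cases "Suc a = b") auto
    show ?thesis using **[of l l'] **[of l' l] that by (metis linorder_neqE_nat)
  qed
  obtain l where l: "1 \<le> l" "l < k" "j = (i + l) mod k" using index_shift ij by metis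
  obtain l' where l': "1 \<le> l'" "l' < k" "j' = (i + l') mod k" using index_shift ij by metis
  have s: "sep f (i + l)" "sep f (i + l')" using f l l' sep_mod by auto
  consider "f (P i) < 0" "f (P (Suc i)) > 0" | "f (P i) > 0" "f (P (Suc i)) < 0"
    using f(2) by (auto simp: sep_def mult_less_0_iff)
  then have "l = l'"
  proof cases
    case 1
    then show ?thesis using *[OF f(1)] s l l' by blast
  next
    case 2
    then show ?thesis using *[OF affine_fun_uminus[OF f(1)]] s l l' by (simp add: sep_uminus)
  qed
  then show ?thesis using l l' by simp
qed

lemma sep_exit:
  assumes f: "affine_fun f" "sep f i" and i: "i < k"
    and nz: "\<And>q. q \<in> V \<Longrightarrow> lam i q > 0 \<Longrightarrow> f q \<noteq> 0"
  obtains j where "j < k" "j \<noteq> i" "sep f j"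
proof -
  have *: "\<exists>j<k. j \<noteq> i \<and> sep g j"
    if g: "g (P i) < 0" "g (P (Suc i)) > 0" "\<And>q. q \<in> V \<Longrightarrow> lam i q > 0 \<Longrightarrow> g q \<noteq> 0" for g
  proof -
    obtain l where l: "1 \<le> l" "l < k" "g (P (i + l)) > 0" "g (P (i + Suc l)) < 0"
      by (rule exit_exists[OF g(1,2)]) (use g(3) P_in_V lam_pos[OF i] in auto)
    then have "sep g ((i + l) mod k)" unfolding sep_mod by (simp add: sep_def mult_less_0_iff)
    moreover have "(i + l) mod k \<noteq> i" using l(3) g(1) P_mod[of "i + l"] by auto
    ultimately show ?thesis using k3 by (intro exI[of _ "(i + l) mod k"]) auto
  qed
  consider "f (P i) < 0" "f (P (Suc i)) > 0" | "f (P i) > 0" "f (P (Suc i)) < 0"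
    using f(2) by (auto simp: sep_def mult_less_0_iff)
  then show ?thesis
  proof cases
    case 1
    then show ?thesis using *[of f] nz that by blast
  next
    case 2
    then show ?thesis using *[of "\<lambda>p. - f p"] nz that by (auto simp: sep_uminus)
  qed
qed

lemma refl_line: "refl i (x + t *\<^sub>R d) = refl i x + t *\<^sub>R (refl i (x + d) - refl i x)"
proof -
  have "lam i (x + t *\<^sub>R d) = lam i x + t * (lam i (x + d) - lam i x)"
    using affine_fun_line[OF lam_affine, of i x t d] affine_fun_line[OF lam_affine, of i x 1 d] by simp
  then show ?thesis unfolding refl_def by (simp only:) (simp add: algebra_simps)
qed

lemma refl_dir:
  assumes i: "i < k"
  shows "d \<noteq> 0 \<Longrightarrow> refl i (x + d) - refl i x \<noteq> 0"
    and "lam i (refl i x + (refl i (x + d) - refl i x)) - lam i (refl i x) = - (lam i (x + d) - lam i x)"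
proof -
  show "d \<noteq> 0 \<Longrightarrow> refl i (x + d) - refl i x \<noteq> 0"
    using refl_refl[OF i, of "x + d"] refl_refl[OF i, of x] by (metis add_cancel_left_right eq_iff_diff_eq_0)
  show "lam i (refl i x + (refl i (x + d) - refl i x)) - lam i (refl i x) = - (lam i (x + d) - lam i x)"
    by (simp add: lam_refl[OF i])
qed

end

text \<open>
  The sides of all tiles lie on the walls, the lines on which some \<open>\<phi> \<in> Phi\<close> takes an integer value.
\<close>

locale lattice_polygon = convex_polygon +
  fixes Phi :: "(real \<times> real \<Rightarrow> real) set"
  assumes finite_Phi: "finite Phi"
    and Phi_affine: "\<phi> \<in> Phi \<Longrightarrow> affine_fun \<phi>"
    and Phi_edge: "i < k \<Longrightarrow> lam i p = 0 \<Longrightarrow> \<exists>\<phi>\<in>Phi. \<phi> p \<in> \<int>"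
    and Phi_interior: "(\<And>i. i < k \<Longrightarrow> lam i p > 0) \<Longrightarrow> \<phi> \<in> Phi \<Longrightarrow> \<phi> p \<notin> \<int>"
    and Phi_refl: "i < k \<Longrightarrow> \<phi> \<in> Phi \<Longrightarrow> \<phi> (refl i p) \<in> \<int> \<Longrightarrow> \<exists>\<psi>\<in>Phi. \<psi> p \<in> \<int>"
    and Phi_meet: "\<phi> \<in> Phi \<Longrightarrow> \<psi> \<in> Phi \<Longrightarrow> \<phi> \<noteq> \<psi> \<Longrightarrow> \<phi> p \<in> \<int> \<Longrightarrow> \<psi> p \<in> \<int> \<Longrightarrow> lat p"
    and lat_V: "q \<in> V \<Longrightarrow> lat q"
    and V_lat: "(\<And>i. i < k \<Longrightarrow> lam i p \<ge> 0) \<Longrightarrow> lat p \<Longrightarrow> p \<in> V"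
    and lat_refl': "i < k \<Longrightarrow> lat p \<Longrightarrow> lat (refl i p)"
begin

definition wall :: "real \<times> real \<Rightarrow> bool" where
  "wall p \<longleftrightarrow> (\<exists>\<phi>\<in>Phi. \<phi> p \<in> \<int>)"

lemma lat_refl: "i < k \<Longrightarrow> lat (refl i p) \<longleftrightarrow> lat p"
  using lat_refl'[of i p] lat_refl'[of i "refl i p"] by (auto simp: refl_refl)

lemma wall_refl: "i < k \<Longrightarrow> wall (refl i p) \<longleftrightarrow> wall p"
  using Phi_refl[of i _ p] Phi_refl[of i _ "refl i p"] unfolding wall_def by (auto simp: refl_refl)

lemma V_two_edges:
  assumes "q \<in> V"
  obtains i j where "i < k" "j < k" "i \<noteq> j" "lam i q = 0" "lam j q = 0"
proof -
  obtain n where n: "n < k" "q = P n" using assms by (auto simp: V_def)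
  \<comment> \<open>The side before the vertex, with \<open>k - 1\<close> in place of
    \<open>-1\<close> to stay within the natural numbers.\<close>
  define j where "j = (n + (k - 1)) mod k"
  have "Suc (n + (k - 1)) = n + k" using k3 by simp
  then have "P (Suc j) = P n" using P_mod[of "Suc j"] P_mod[of "n + k"]
    unfolding j_def by (simp add: mod_Suc_eq P_periodic)
  moreover have j: "j < k" "j \<noteq> n"
    using k3 n by (auto simp: j_def mod_if)
  ultimately show ?thesis using that[of n j] n lam_edge(1)[of n] lam_edge(2)[of j] by auto
qed

text \<open>A lattice point of the polygon is a vertex, and a vertex lies on two different
  sides.\<close>

lemma not_lat:
  assumes "\<And>l. l < k \<Longrightarrow> l \<noteq> i \<Longrightarrow> lam l p > 0" "i < k \<Longrightarrow> lam i p \<ge> 0"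
  shows "\<not> lat p"
proof
  assume "lat p"
  moreover have "lam l p \<ge> 0" if "l < k" for l
    using assms that by (cases "l = i") (auto intro: less_imp_le)
  ultimately have "p \<in> V" using V_lat by blast
  then obtain a b where "a < k" "b < k" "a \<noteq> b" "lam a p = 0" "lam b p = 0" using V_two_edges by blast
  then show False using assms(1)[of a] assms(1)[of b] by (cases "a = i") auto
qed

text \<open>
  A ray is followed through successive tiles by reflecting it back into the polygon at every
  crossing; the time parameter is never rescaled.
\<close>

lemma ray_step:
  assumes f: "affine_fun f" "f x = 0" "f (x + d) = 0" "d \<noteq> 0" "sep f i" and i: "i < k"
    and start: "\<And>l. l < k \<Longrightarrow> lam l (x + s *\<^sub>R d) \<ge> 0" "lam i (x + s *\<^sub>R d) > 0" "lam i (x + d) < lam i x"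
  obtains t where "s < t" "x + t *\<^sub>R d = cross f i"
    "\<And>r. s < r \<Longrightarrow> r < t \<Longrightarrow> \<not> wall (x + r *\<^sub>R d) \<and> \<not> lat (x + r *\<^sub>R d)"
    "wall (x + t *\<^sub>R d)" "\<not> lat (x + t *\<^sub>R d)"
    "refl i x + t *\<^sub>R (refl i (x + d) - refl i x) = cross f i"
proof -
  note c = cross[OF f(1,5) i]
  obtain t where t: "cross f i = x + t *\<^sub>R d"
    using affine_fun_kernel_line[OF f(1), of "P i" "P (Suc i)" d x "cross f i"] f c
    by (metis mult_less_0_iff order_less_asym sep_def)
  have sl: "lam i (x + r *\<^sub>R d) = lam i x + r * (lam i (x + d) - lam i x)" for r
    using affine_fun_line[OF lam_affine, of i x r d] affine_fun_line[OF lam_affine, of i x 1 d] by simp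
  have "lam i (x + t *\<^sub>R d) < lam i (x + s *\<^sub>R d)" using c(2) t start by simp
  then have "s < t" using start(3) unfolding sl
    by (smt (verit, best) mult_less_cancel_right)
  have int: "lam l (x + r *\<^sub>R d) > 0" if "l < k" "s < r" "r < t" for l r
    using affine_fun_between[OF lam_affine that(2,3), of l x d] c(2) c(3)[of l] start(1,2) t that(1)
    by (cases "l = i") (force intro: less_imp_le)+
  show ?thesis
  proof (rule that[OF \<open>s < t\<close> t[symmetric]])
    show "\<not> wall (x + r *\<^sub>R d) \<and> \<not> lat (x + r *\<^sub>R d)" if "s < r" "r < t" for r
      using int[OF _ that] Phi_interior not_lat[of i "x + r *\<^sub>R d"] unfolding wall_def
      by (meson order_less_imp_le)
    show "wall (x + t *\<^sub>R d)" using Phi_edge[OF i] c(2) t unfolding wall_def by simp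
    show "\<not> lat (x + t *\<^sub>R d)" using not_lat[of i] c(2,3) t by simp
    show "refl i x + t *\<^sub>R (refl i (x + d) - refl i x) = cross f i"
      using refl_line[of i x t d] t refl_fix[OF c(2)] by simp
  qed
qed

text \<open>The last piece of a diagonal. At the crossing only \<open>lam i\<close> vanishes, and it
  is positive at \<open>q\<close>, so the piece in between is interior to the tile.\<close>

lemma ray_final:
  assumes f: "affine_fun f" "sep f i" and i: "i < k" and z: "x + t *\<^sub>R d = cross f i"
    and q: "q \<in> V" "lam i q > 0" "q = x + T *\<^sub>R d" and d: "lam i (x + d) > lam i x"
  shows "t < T" "\<And>r. t < r \<Longrightarrow> r < T \<Longrightarrow> \<not> wall (x + r *\<^sub>R d) \<and> \<not> lat (x + r *\<^sub>R d)"
proof -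
  note c = cross[OF f i]
  have sl: "lam i (x + r *\<^sub>R d) = lam i x + r * (lam i (x + d) - lam i x)" for r
    using affine_fun_line[OF lam_affine, of i x r d] affine_fun_line[OF lam_affine, of i x 1 d] by simp
  have "lam i (x + t *\<^sub>R d) < lam i (x + T *\<^sub>R d)" using c(2) z q by simp
  then show "t < T" using d unfolding sl by (smt (verit, best) mult_less_cancel_right)
  fix r assume r: "t < r" "r < T"
  have int: "lam l (x + r *\<^sub>R d) > 0" if "l < k" for l
    using affine_fun_between[OF lam_affine r, of l x d] c(2) c(3)[of l] lam_nonneg[of l q] q z that
    by (cases "l = i") (force intro: less_imp_le)+
  then show "\<not> wall (x + r *\<^sub>R d) \<and> \<not> lat (x + r *\<^sub>R d)"
    using Phi_interior not_lat[of i "x + r *\<^sub>R d"] unfolding wall_def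
    by (meson order_less_imp_le)
qed

text \<open>Since \<open>lam i\<close> grows along the ray, the point on side \<open>i\<close> comes
  before the one on side \<open>j\<close>; from the first to the second, \<open>lam j\<close> falls
  from a positive value to zero. This restores the hypothesis on the direction for the next
  tile.\<close>

lemma ray_turn:
  assumes f: "affine_fun f" "sep f i" and i: "i < k" and z: "x + t *\<^sub>R d = cross f i"
    and f': "affine_fun g" "sep g j" "g x = 0" "g (x + d) = 0" "d \<noteq> 0" and j: "j < k" "j \<noteq> i"
    and d: "lam i (x + d) > lam i x"
  shows "lam j (x + d) < lam j x"
proof -
  note c = cross[OF f i] and c' = cross[OF f'(1,2) j(1)]
  obtain t' where t': "cross g j = x + t' *\<^sub>R d"
    using affine_fun_kernel_line[OF f'(1), of "P j" "P (Suc j)" d x "cross g j"] f' c'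
    by (metis mult_less_0_iff order_less_asym sep_def)
  have sl: "lam l (x + r *\<^sub>R d) = lam l x + r * (lam l (x + d) - lam l x)" for l r
    using affine_fun_line[OF lam_affine, of l x r d] affine_fun_line[OF lam_affine, of l x 1 d] by simp
  have "lam i (x + t *\<^sub>R d) < lam i (x + t' *\<^sub>R d)" using c(2) c'(3)[OF i] j z t' by simp
  then have "t < t'" using d unfolding sl by (smt (verit, best) mult_less_cancel_right)
  moreover have "lam j (x + t' *\<^sub>R d) < lam j (x + t *\<^sub>R d)" using c'(2) c(3)[OF j] z t' by simp
  ultimately show ?thesis unfolding sl by (smt (verit, best) mult_less_cancel_right)
qed

text \<open>Reflecting the function, the base point and the direction together does not change the
  times at which walls or lattice points are met. So the times for the remaining letters can be
  added to the first crossing.\<close>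

lemma ray_crossings:
  assumes "affine_fun f" "f x = 0" "f (x + d) = 0" "d \<noteq> 0"
    and "feas f w" "adm w" "w \<noteq> []"
    and "\<And>l. l < k \<Longrightarrow> lam l (x + s *\<^sub>R d) \<ge> 0" "lam (hd w) (x + s *\<^sub>R d) > 0" "lam (hd w) (x + d) < lam (hd w) x"
    and "q \<in> V" "lam (last w) q > 0" "f (unf w q) = 0"
  shows "\<exists>T>s. unf w q = x + T *\<^sub>R d \<and> finite {t. s < t \<and> t < T \<and> wall (x + t *\<^sub>R d)} \<and>
    card {t. s < t \<and> t < T \<and> wall (x + t *\<^sub>R d)} = length w \<and> (\<forall>t. s < t \<and> t < T \<longrightarrow> \<not> lat (x + t *\<^sub>R d))"
  using assms
proof (induction w arbitrary: f x d s)
  case (Cons i w)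
  have i: "i < k" "sep f i" using Cons.prems by (auto simp: adm_Cons)
  have st: "lam i (x + s *\<^sub>R d) > 0" "lam i (x + d) < lam i x" using Cons.prems(9,10) by simp_all
  obtain t where t: "s < t" "x + t *\<^sub>R d = cross f i"
    "\<And>r. s < r \<Longrightarrow> r < t \<Longrightarrow> \<not> wall (x + r *\<^sub>R d) \<and> \<not> lat (x + r *\<^sub>R d)"
    "wall (x + t *\<^sub>R d)" "\<not> lat (x + t *\<^sub>R d)"
    "refl i x + t *\<^sub>R (refl i (x + d) - refl i x) = cross f i"
    using ray_step[OF Cons.prems(1-4) i(2,1) Cons.prems(8) st] by blast
  define f' where "f' = (\<lambda>p. f (refl i p))"
  define x' where "x' = refl i x"
  define d' where "d' = refl i (x + d) - refl i x"
  have line: "refl i (x + r *\<^sub>R d) = x' + r *\<^sub>R d'" for r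
    by (simp add: x'_def d'_def refl_line)
  have wl: "wall (x' + r *\<^sub>R d') \<longleftrightarrow> wall (x + r *\<^sub>R d)" "lat (x' + r *\<^sub>R d') \<longleftrightarrow> lat (x + r *\<^sub>R d)" for r
    using wall_refl[OF i(1)] lat_refl[OF i(1)] line by metis+
  have f': "affine_fun f'" "f' x' = 0" "f' (x' + d') = 0" "d' \<noteq> 0" "sep f' i"
    using Cons.prems(1-4) refl_dir(1)[OF i(1)] i affine_fun_refl
    by (auto simp: f'_def x'_def d'_def refl_refl sep_refl)
  have dir: "lam i (x' + d') > lam i x'"
    using refl_dir(2)[OF i(1), of x d] st by (simp add: x'_def d'_def)
  have z: "x' + t *\<^sub>R d' = cross f i" using t(6) by (simp add: x'_def d'_def)
  have "\<exists>T>t. unf w q = x' + T *\<^sub>R d' \<and> finite {r. t < r \<and> r < T \<and> wall (x + r *\<^sub>R d)} \<and>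
    card {r. t < r \<and> r < T \<and> wall (x + r *\<^sub>R d)} = length w \<and> (\<forall>r. t < r \<and> r < T \<longrightarrow> \<not> lat (x + r *\<^sub>R d))"
  proof (cases "w = []")
    case True
    then have q: "lam i q > 0" "f' q = 0" using Cons.prems by (auto simp: f'_def)
    have "f' (P i) \<noteq> f' (P (Suc i))" using f'(5) by (auto simp: sep_def mult_less_0_iff)
    then obtain T where T: "q = x' + T *\<^sub>R d'"
      using affine_fun_kernel_line[OF f'(1) _ f'(4,2,3) q(2)] by blast
    have *: "{r. t < r \<and> r < T \<and> wall (x + r *\<^sub>R d)} = {}"
      using ray_final(2)[OF Cons.prems(1) i(2,1) z Cons.prems(11) q(1) T dir] wl by auto
    show ?thesis
      using ray_final[OF Cons.prems(1) i(2,1) z Cons.prems(11) q(1) T dir] T True wl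
      by (intro exI[of _ T]) (simp add: *)
  next
    case False
    then obtain j w' where w: "w = j # w'" by (cases w) auto
    have j: "j < k" "j \<noteq> i" "sep f' j" using Cons.prems(5,6) w by (auto simp: adm_Cons f'_def)
    have "\<exists>T>t. unf w q = x' + T *\<^sub>R d' \<and> finite {r. t < r \<and> r < T \<and> wall (x' + r *\<^sub>R d')} \<and>
      card {r. t < r \<and> r < T \<and> wall (x' + r *\<^sub>R d')} = length w \<and> (\<forall>r. t < r \<and> r < T \<longrightarrow> \<not> lat (x' + r *\<^sub>R d'))"
    proof (rule Cons.IH[OF f'(1-4)])
      show "feas f' w" "adm w" "w \<noteq> []" "q \<in> V" "lam (last w) q > 0" "f' (unf w q) = 0"
        using Cons.prems False by (auto simp: f'_def adm_Cons)
      show "lam l (x' + t *\<^sub>R d') \<ge> 0" if "l < k" for l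
        using cross[OF Cons.prems(1) i(2,1)] that unfolding z by (cases "l = i") (auto intro: less_imp_le)
      show "lam (hd w) (x' + t *\<^sub>R d') > 0"
        using cross[OF Cons.prems(1) i(2,1)] j w unfolding z by simp
      show "lam (hd w) (x' + d') < lam (hd w) x'"
        using ray_turn[OF Cons.prems(1) i(2,1) z f'(1) j(3) f'(2-4) j(1,2) dir] w by simp
    qed
    then show ?thesis unfolding wl .
  qed
  then obtain T where T: "T > t" "unf w q = x' + T *\<^sub>R d'" "finite {r. t < r \<and> r < T \<and> wall (x + r *\<^sub>R d)}"
    "card {r. t < r \<and> r < T \<and> wall (x + r *\<^sub>R d)} = length w" "\<And>r. t < r \<Longrightarrow> r < T \<Longrightarrow> \<not> lat (x + r *\<^sub>R d)"
    by blast
  \<comment> \<open>No wall is met before the crossing time \<open>t\<close>, and exactly one time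
    is added at it.\<close>
  have set: "{r. s < r \<and> r < T \<and> wall (x + r *\<^sub>R d)} = insert t {r. t < r \<and> r < T \<and> wall (x + r *\<^sub>R d)}"
  proof (intro equalityI subsetI)
    fix r assume "r \<in> {r. s < r \<and> r < T \<and> wall (x + r *\<^sub>R d)}"
    then show "r \<in> insert t {r. t < r \<and> r < T \<and> wall (x + r *\<^sub>R d)}"
      using t(3)[of r] by (cases r t rule: linorder_cases) auto
  qed (use t T(1) in auto)
  have "unf (i # w) q = x + T *\<^sub>R d"
    using T(2) line[of T] refl_refl[OF i(1), of "x + T *\<^sub>R d"] by simp
  moreover have "\<not> lat (x + r *\<^sub>R d)" if "s < r" "r < T" for r
    using t(3)[of r] t(5) T(5)[of r] that by (cases r t rule: linorder_cases) auto
  moreover have "finite {r. s < r \<and> r < T \<and> wall (x + r *\<^sub>R d)}"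
    "card {r. s < r \<and> r < T \<and> wall (x + r *\<^sub>R d)} = length (i # w)"
    unfolding set using T(3,4) by auto
  moreover have "T > s" using T t by simp
  ultimately show ?case by blast
qed simp

text \<open>Converse of \<open>ray_crossings\<close>, by induction on the number of walls still
  ahead. In each tile the line either hits a vertex, where the word ends, or leaves by another side;
  finiteness of the wall times makes this stop.\<close>

lemma ray_reaches:
  assumes "affine_fun f" "f x = 0" "f (x + d) = 0" "d \<noteq> 0" "i < k" "sep f i"
    and "\<And>l. l < k \<Longrightarrow> lam l (x + s *\<^sub>R d) \<ge> 0" "lam i (x + s *\<^sub>R d) > 0" "lam i (x + d) < lam i x"
    and "s < 1" "lat (x + d)" "\<And>t. s < t \<Longrightarrow> t < 1 \<Longrightarrow> \<not> lat (x + t *\<^sub>R d)"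
    and "finite {t. s < t \<and> t < 1 \<and> wall (x + t *\<^sub>R d)}"
  shows "\<exists>w q. hd w = i \<and> w \<noteq> [] \<and> adm w \<and> feas f w \<and> q \<in> V \<and> lam (last w) q > 0 \<and> unf w q = x + d"
  using assms
proof (induction "card {t. s < t \<and> t < 1 \<and> wall (x + t *\<^sub>R d)}" arbitrary: f x d i s rule: less_induct)
  case less
  note i = less.prems(5,6)
  obtain t where t: "s < t" "x + t *\<^sub>R d = cross f i"
    "\<And>r. s < r \<Longrightarrow> r < t \<Longrightarrow> \<not> wall (x + r *\<^sub>R d) \<and> \<not> lat (x + r *\<^sub>R d)"
    "wall (x + t *\<^sub>R d)" "\<not> lat (x + t *\<^sub>R d)"
    "refl i x + t *\<^sub>R (refl i (x + d) - refl i x) = cross f i"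
    using ray_step[OF less.prems(1-4) i(2,1) less.prems(7-9)] by blast
  have "t < 1"
  proof (rule ccontr)
    assume "\<not> t < 1"
    then have "\<not> lat (x + 1 *\<^sub>R d)" using t(3)[of 1] t(5) \<open>s < 1\<close> by (cases "t = 1") auto
    then show False using less.prems(11) by simp
  qed
  define f' where "f' = (\<lambda>p. f (refl i p))"
  define x' where "x' = refl i x"
  define d' where "d' = refl i (x + d) - refl i x"
  have line: "refl i (x + r *\<^sub>R d) = x' + r *\<^sub>R d'" for r
    by (simp add: x'_def d'_def refl_line)
  have wl: "wall (x' + r *\<^sub>R d') \<longleftrightarrow> wall (x + r *\<^sub>R d)" "lat (x' + r *\<^sub>R d') \<longleftrightarrow> lat (x + r *\<^sub>R d)" for r
    using wall_refl[OF i(1)] lat_refl[OF i(1)] line by metis+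
  have f': "affine_fun f'" "f' x' = 0" "f' (x' + d') = 0" "d' \<noteq> 0" "sep f' i"
    using less.prems(1-4) refl_dir(1)[OF i(1)] i affine_fun_refl
    by (auto simp: f'_def x'_def d'_def refl_refl sep_refl)
  have dir: "lam i (x' + d') > lam i x'"
    using refl_dir(2)[OF i(1), of x d] less.prems(9) by (simp add: x'_def d'_def)
  have z: "x' + t *\<^sub>R d' = cross f i" using t(6) by (simp add: x'_def d'_def)
  have end': "refl i (x' + d') = x + d"
    using line[of 1] refl_refl[OF i(1), of "x + d"] by simp
  show ?case
  proof (cases "\<exists>q\<in>V. lam i q > 0 \<and> f' q = 0")
    case True
    then obtain q where q: "q \<in> V" "lam i q > 0" "f' q = 0" by blast
    have "f' (P i) \<noteq> f' (P (Suc i))" using f'(5) by (auto simp: sep_def mult_less_0_iff)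
    then obtain T where T: "q = x' + T *\<^sub>R d'"
      using affine_fun_kernel_line[OF f'(1) _ f'(4,2,3) q(3)] by blast
    note fin = ray_final[OF less.prems(1) i(2,1) z q(1,2) T dir]
    have "lat (x + T *\<^sub>R d)" using lat_V[OF q(1)] wl(2) T by simp
    \<comment> \<open>The vertex cannot come before the end of the segment, which has no earlier
      lattice point, nor after it, because the end would be a lattice point inside the tile.\<close>
    then have "\<not> T < 1" using less.prems(12)[of T] fin(1) t(1) by auto
    moreover have "\<not> 1 < T" using fin(2)[of 1] \<open>t < 1\<close> less.prems(11) wl(2)[of 1] by auto
    ultimately have "T = 1" by simp
    then show ?thesis
      using q T i end' by (intro exI[of _ "[i]"] exI[of _ q]) (simp add: adm_Cons adm_def)
  next
    case False
    then obtain j where j: "j < k" "j \<noteq> i" "sep f' j" using sep_exit[OF f'(1,5) i(1)] by metis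
    have sub: "{r. t < r \<and> r < 1 \<and> wall (x' + r *\<^sub>R d')} \<subset> {r. s < r \<and> r < 1 \<and> wall (x + r *\<^sub>R d)}"
      using t(1,4) \<open>t < 1\<close> unfolding wl by auto
    have "\<exists>w q. hd w = j \<and> w \<noteq> [] \<and> adm w \<and> feas f' w \<and> q \<in> V \<and> lam (last w) q > 0 \<and> unf w q = x' + d'"
    proof (rule less.hyps[OF _ f'(1-4) j(1,3)])
      show "card {r. t < r \<and> r < 1 \<and> wall (x' + r *\<^sub>R d')} < card {r. s < r \<and> r < 1 \<and> wall (x + r *\<^sub>R d)}"
        by (rule psubset_card_mono[OF less.prems(13) sub])
      show "finite {r. t < r \<and> r < 1 \<and> wall (x' + r *\<^sub>R d')}"
        using sub less.prems(13) finite_subset by blast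
      show "lam l (x' + t *\<^sub>R d') \<ge> 0" if "l < k" for l
        using cross[OF less.prems(1) i(2,1)] that unfolding z by (cases "l = i") (auto intro: less_imp_le)
      show "lam j (x' + t *\<^sub>R d') > 0"
        using cross[OF less.prems(1) i(2,1)] j unfolding z by simp
      show "lam j (x' + d') < lam j x'"
        using ray_turn[OF less.prems(1) i(2,1) z f'(1) j(3) f'(2-4) j(1,2) dir] .
      show "lat (x' + d')" using wl(2)[of 1] less.prems(11) by simp
      show "\<not> lat (x' + r *\<^sub>R d')" if "t < r" "r < 1" for r
        using less.prems(12)[of r] that t(1) wl(2) by simp
    qed (rule \<open>t < 1\<close>)
    then obtain w q where w: "hd w = j" "w \<noteq> []" "adm w" "feas f' w" "q \<in> V" "lam (last w) q > 0" "unf w q = x' + d'"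
      by blast
    then show ?thesis using i j end'
      by (intro exI[of _ "i # w"] exI[of _ q]) (simp add: adm_Cons f'_def)
  qed
qed

end

section \<open>Generalised diagonals as visible lattice points\<close>

lemma affine_fun_through:
  obtains f where "affine_fun f" "f c = 0" "f v = 0" "c \<noteq> v \<Longrightarrow> \<exists>u. f u \<noteq> 0"
proof -
  let ?f = "\<lambda>p. (fst v - fst c) * (snd p - snd c) - (snd v - snd c) * (fst p - fst c)"
  have "affine_fun ?f"
    by (rule affine_funI[where a = "- (snd v - snd c)" and b = "fst v - fst c"
          and c = "(snd v - snd c) * fst c - (fst v - fst c) * snd c"]) (simp add: algebra_simps)
  \<comment> \<open>The test point is \<open>v\<close> turned about \<open>c\<close> by a right
    angle; the cross product there is the squared distance of \<open>c\<close> and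
    \<open>v\<close>.\<close>
  moreover have "?f (fst c - (snd v - snd c), snd c + (fst v - fst c)) = (fst v - fst c)\<^sup>2 + (snd v - snd c)\<^sup>2"
    by (simp add: power2_eq_square algebra_simps)
  then have "?f (fst c - (snd v - snd c), snd c + (fst v - fst c)) \<noteq> 0" if "c \<noteq> v"
    using that by (auto simp: prod_eq_iff sum_power2_eq_zero_iff)
  then have "c \<noteq> v \<Longrightarrow> \<exists>u. ?f u \<noteq> 0" by blast
  ultimately show ?thesis by (intro that[of ?f]) auto
qed

lemma affine_fun_cone:
  assumes "affine_fun g"
  shows "g (c + (a *\<^sub>R (p - c) + b *\<^sub>R (q - c))) = g c + a * (g p - g c) + b * (g q - g c)"
proof -
  obtain a' b' c' where g: "\<And>x y. g (x, y) = a' * x + b' * y + c'"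
    using assms unfolding affine_fun_def by blast
  show ?thesis by (cases c; cases p; cases q) (simp add: g algebra_simps)
qed

context lattice_polygon
begin

text \<open>The unfolded end points of the generalised diagonals that leave \<open>c\<close> through
  side \<open>i\<close>. They lie in the open corner spanned by the side, are visible from
  \<open>c\<close> in the lattice, and have \<open>n\<close> walls strictly before them.\<close>

definition targets :: "real \<times> real \<Rightarrow> nat \<Rightarrow> nat \<Rightarrow> (real \<times> real) set" where
  "targets c i n = {v. lat v \<and>
     (\<exists>a>0. \<exists>b>0. v = c + (a *\<^sub>R (P i - c) + b *\<^sub>R (P (Suc i) - c))) \<and>
     (\<forall>t. 0 < t \<and> t < 1 \<longrightarrow> \<not> lat (c + t *\<^sub>R (v - c))) \<and>
     card {t. 0 < t \<and> t < 1 \<and> wall (c + t *\<^sub>R (v - c))} = n}"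

lemma lat_unf: "set w \<subseteq> {..<k} \<Longrightarrow> lat (unf w p) \<longleftrightarrow> lat p"
  by (induction w) (auto simp: lat_refl)

text \<open>\<open>ray_crossings\<close> is used twice: with the direction towards the first
  crossing, to see that the end point is reached at a positive time and so differs from
  \<open>c\<close>; and then with the direction \<open>v - c\<close>, so that the end time is 1 as
  \<open>targets\<close> requires.\<close>

lemma diag_ray:
  assumes c: "c \<in> V" "lam (hd w) c > 0" and f: "affine_fun f" "f c = 0" "feas f w"
    and w: "adm w" "w \<noteq> []" and q: "q \<in> V" "lam (last w) q > 0" "f (unf w q) = 0"
  shows "unf w q \<noteq> c" "unf w q \<in> targets c (hd w) (length w)"
proof -
  define i where "i = hd w"
  define v where "v = unf w q"
  have i: "i < k" "sep f i" using w f by (cases w; auto simp: i_def adm_Cons)+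
  note cr = cross[OF f(1) i(2,1)]
  define d where "d = cross f i - c"
  have ci: "lam i c > 0" using c by (simp add: i_def)
  have cd: "lam i (c + d) < lam i c" using cr ci by (simp add: d_def)
  then have d: "d \<noteq> 0" "f (c + d) = 0" using cr by (auto simp: d_def)
  have nn: "lam l (c + 0 *\<^sub>R e) \<ge> 0" if "l < k" for l e using lam_nonneg[OF that c(1)] by simp
  obtain T where T: "T > 0" "v = c + T *\<^sub>R d"
    using ray_crossings[OF f(1,2) d(2,1) f(3) w nn _ _ q] ci cd by (auto simp: v_def i_def)
  have vd: "v - c = T *\<^sub>R d" using T by simp
  have vc: "v - c \<noteq> 0" unfolding vd using T d by simp
  then show "unf w q \<noteq> c" by (simp add: v_def)
  have "lam i v = lam i c + T * (lam i (c + d) - lam i c)"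
    using affine_fun_line[OF lam_affine, of i c T d] affine_fun_line[OF lam_affine, of i c 1 d] T by simp
  then have vi: "lam i (c + (v - c)) < lam i c" using cd T by (simp add: mult_pos_neg)
  have fv: "f (c + (v - c)) = 0" using q by (simp add: v_def)
  obtain T' where T': "T' > 0" "v = c + T' *\<^sub>R (v - c)"
    "card {t. 0 < t \<and> t < T' \<and> wall (c + t *\<^sub>R (v - c))} = length w"
    "\<forall>t. 0 < t \<and> t < T' \<longrightarrow> \<not> lat (c + t *\<^sub>R (v - c))"
    using ray_crossings[OF f(1,2) fv vc f(3) w nn _ _ q] ci vi unfolding v_def i_def by auto
  have "v - c = T' *\<^sub>R (v - c)" using T'(2) by (metis add_diff_cancel_left')
  then have "(T' - 1) *\<^sub>R (v - c) = 0" unfolding scaleR_left_diff_distrib by simp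
  then have "T' = 1" using vc by auto
  moreover have "lat v" using lat_unf[of w q] w lat_V[OF q(1)] by (simp add: v_def adm_def)
  moreover have "\<exists>a>0. \<exists>b>0. v = c + (a *\<^sub>R (P i - c) + b *\<^sub>R (P (Suc i) - c))"
  proof -
    obtain u where u: "0 < u" "u < 1" "cross f i = (1 - u) *\<^sub>R P i + u *\<^sub>R P (Suc i)"
      using cr(4) by (auto simp: in_segment)
    have "v = c + ((T * (1 - u)) *\<^sub>R (P i - c) + (T * u) *\<^sub>R (P (Suc i) - c))"
      unfolding T(2) d_def u(3) by (simp add: algebra_simps)
    then show ?thesis using u T by (metis diff_gt_0_iff_gt mult_pos_pos)
  qed
  ultimately have "v \<in> targets c i (length w)" using T' by (simp add: targets_def)
  then show "unf w q \<in> targets c (hd w) (length w)" by (simp add: v_def i_def)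
qed

text \<open>The perturbation now has to vanish at \<open>c\<close> and not at the vertex that is
  hit. Such a function exists because that vertex, unfolded, is not \<open>c\<close> itself.\<close>

lemma card_beam_Suc:
  assumes "c \<in> V" "n \<ge> 1"
  shows "card (beam c (Suc n)) = card (beam c n) + card (diag c n)"
  unfolding beam_def diag_def
proof (rule card_W_Suc[OF assms(2)])
  fix w q assume w: "w \<in> W {i. lam i c > 0} {f. f c = 0} n" and q: "q \<in> V" "lam (last w) q > 0"
  obtain f where f: "f c = 0" "affine_fun f" "feas f w" using w unfolding W_def by blast
  have w': "lam (hd w) c > 0" "adm w" "w \<noteq> []" using w assms(2) unfolding W_def by auto
  show "\<exists>e\<in>{f. f c = 0}. affine_fun e \<and> e (unf w q) \<noteq> 0"
  proof (cases "f (unf w q) = 0")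
    case True
    have "unf w q \<noteq> c"
      by (rule diag_ray(1)[OF assms(1) w'(1) f(2,1,3) w'(2,3) q True])
    then show ?thesis using affine_fun_separating[of c "unf w q" ?thesis] by blast
  qed (use f in blast)
qed auto

lemma feas_scale: "s \<noteq> 0 \<Longrightarrow> feas (\<lambda>p. s * f p) w \<longleftrightarrow> feas f w"
proof (induction w arbitrary: f)
  case (Cons i w)
  have "s * f (P i) * (s * f (P (Suc i))) = s\<^sup>2 * (f (P i) * f (P (Suc i)))"
    by (simp add: power2_eq_square)
  moreover have "s\<^sup>2 > 0" using Cons.prems by simp
  ultimately have "sep (\<lambda>p. s * f p) i \<longleftrightarrow> sep f i"
    by (metis mult_less_cancel_left_pos mult_zero_right sep_def)
  then show ?case using Cons.IH[of "\<lambda>p. f (refl i p)"] Cons.prems by simp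
qed simp

text \<open>By \<open>sep_unique\<close> each letter forces the next one. The first letter has to be
  given, since a line can be followed in two directions.\<close>

lemma feas_determined:
  assumes "affine_fun f" "feas f w" "feas f w'" "adm w" "adm w'" "length w = length w'" "hd w = hd w'"
  shows "w = w'"
  using assms
proof (induction w arbitrary: f w')
  case (Cons i u)
  then obtain u' where w': "w' = i # u'" by (cases w') auto
  have "u = u'"
  proof (rule Cons.IH[OF affine_fun_refl])
    show "hd u = hd u'"
    proof (cases "u = []")
      case False
      then obtain j v where u: "u = j # v" by (cases u) auto
      moreover obtain j' v' where u': "u' = j' # v'" using Cons.prems w' False by (cases u') auto
      moreover have "i < k" using Cons.prems by (simp add: adm_Cons)
      ultimately have "j = j'" using Cons.prems w'
        by (intro sep_unique[OF affine_fun_refl[of f i], of i]) (auto simp: adm_Cons sep_refl)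
      then show ?thesis using u u' by simp
    next
      case True
      then show ?thesis using Cons.prems w' by auto
    qed
  qed (use Cons.prems w' in \<open>auto simp: adm_Cons\<close>)
  then show ?case using w' by simp
qed simp

text \<open>A diagonal is determined by its first side and its unfolded end point: functions
  vanishing at \<open>c\<close> and at this point are proportional and hence realise the same words.
  \<open>diag_ray\<close> shows that the end point is a target, \<open>ray_reaches\<close> that
  every target occurs.\<close>

lemma card_diag:
  assumes c: "c \<in> V" and n: "n \<ge> 1"
  shows "card (diag c n) = (\<Sum>i | i < k \<and> lam i c > 0. card (targets c i n))"
    and "i < k \<Longrightarrow> lam i c > 0 \<Longrightarrow> finite (targets c i n)"
proof -
  let ?I = "{i. i < k \<and> lam i c > 0}"
  let ?F = "\<lambda>(w, q). (hd w, unf w q)"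
  have dg: "(w, q) \<in> diag c n \<longleftrightarrow> length w = n \<and> adm w \<and> lam (hd w) c > 0 \<and> q \<in> V \<and> lam (last w) q > 0 \<and>
     (\<exists>f. f c = 0 \<and> affine_fun f \<and> feas f w \<and> f (unf w q) = 0)" for w q
    by (auto simp: diag_def Z_def)
  have inj: "inj_on ?F (diag c n)"
  proof (rule inj_onI)
    fix y z assume yz: "y \<in> diag c n" "z \<in> diag c n" "?F y = ?F z"
    obtain w q where y: "y = (w, q)" by (cases y)
    obtain w' r where z: "z = (w', r)" by (cases z)
    have wq: "(w, q) \<in> diag c n" and wr: "(w', r) \<in> diag c n" and eq: "hd w = hd w'" "unf w q = unf w' r"
      using yz unfolding y z by simp_all
    obtain f where f: "f c = 0" "affine_fun f" "feas f w" "f (unf w q) = 0" using wq unfolding dg by blast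
    obtain g where g: "g c = 0" "affine_fun g" "feas g w'" "g (unf w' r) = 0" using wr unfolding dg by blast
    have "length w = n" "length w' = n" using wq wr unfolding dg by blast+
    then have ne: "w \<noteq> []" "w' \<noteq> []" using n by auto
    have vc: "unf w q \<noteq> c" using diag_ray(1)[OF c _ f(2,1,3) _ ne(1) _ _ f(4)] wq unfolding dg by blast
    have "sep f (hd w)" "sep g (hd w')" using f g ne by (cases w; cases w'; simp)+
    then have nz: "f (P (hd w)) \<noteq> 0" "g (P (hd w')) \<noteq> 0" by (auto simp: sep_def)
    obtain s where s: "\<And>p. g p = s * f p"
      using affine_fun_proportional[OF f(2) g(2) f(1,4) g(1) _ _ nz(1)] g(4) eq vc by metis
    have "s \<noteq> 0" using s[of "P (hd w')"] nz by auto
    have gf: "g = (\<lambda>p. s * f p)" by (rule ext) (rule s)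
    have fw: "feas f w'" using feas_scale[OF \<open>s \<noteq> 0\<close>, of f w'] g(3) unfolding gf by blast
    have aw: "adm w" "adm w'" using wq wr unfolding dg by blast+
    have lw: "length w = length w'" using \<open>length w = n\<close> \<open>length w' = n\<close> by simp
    have ww: "w = w'" by (rule feas_determined[OF f(2,3) fw aw lw eq(1)])
    have "q = r"
    proof -
      have "set (rev w) \<subseteq> {..<k}" using aw by (simp add: adm_def)
      then have *: "unf (rev w) (unf w p) = p" for p
        using unf_rev[of "rev w" p] by (simp only: rev_rev_ident simp_thms)
      have "unf w q = unf w r" using eq(2) by (simp only: ww)
      then have "unf (rev w) (unf w q) = unf (rev w) (unf w r)" by (rule arg_cong)
      then show ?thesis by (simp only: *)
    qed
    then show "y = z" using ww y z by simp
  qed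
  have img: "?F ` diag c n = Sigma ?I (\<lambda>i. targets c i n)"
  proof (intro equalityI subsetI)
    fix z assume "z \<in> ?F ` diag c n"
    then obtain w q where z: "z = (hd w, unf w q)" and wq: "(w, q) \<in> diag c n" by (auto elim!: imageE)
    obtain f where f: "f c = 0" "affine_fun f" "feas f w" "f (unf w q) = 0" using wq unfolding dg by blast
    have lw: "length w = n" "adm w" "lam (hd w) c > 0" using wq unfolding dg by blast+
    then have ne: "w \<noteq> []" using n by auto
    have "unf w q \<in> targets c (hd w) n"
      using diag_ray(2)[OF c _ f(2,1,3) _ ne _ _ f(4)] wq unfolding dg by blast
    moreover have "hd w < k" using lw ne by (cases w) (auto simp: adm_Cons)
    ultimately show "z \<in> Sigma ?I (\<lambda>i. targets c i n)" using lw z by simp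
  next
    fix z assume "z \<in> Sigma ?I (\<lambda>i. targets c i n)"
    then obtain i v where z: "z = (i, v)" and i: "i < k" "lam i c > 0" and v: "v \<in> targets c i n" by auto
    obtain a b where ab: "a > 0" "b > 0" "v = c + (a *\<^sub>R (P i - c) + b *\<^sub>R (P (Suc i) - c))"
      using v by (auto simp: targets_def)
    have val: "g v = g c + a * (g (P i) - g c) + b * (g (P (Suc i)) - g c)" if "affine_fun g" for g
      unfolding ab(3) by (rule affine_fun_cone[OF that])
    have "lam i v = lam i c - (a + b) * lam i c"
      unfolding val[OF lam_affine] using lam_edge[OF i(1)] by (simp add: algebra_simps)
    moreover have "(a + b) * lam i c > 0" using ab i by (intro mult_pos_pos) auto
    ultimately have vi: "lam i (c + (v - c)) < lam i c" by simp
    then have vc: "c \<noteq> v" by auto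
    obtain f where f: "affine_fun f" "f c = 0" "f v = 0" "\<exists>u. f u \<noteq> 0"
      by (rule affine_fun_through[of c v]) (use vc in blast)
    have fv: "a * f (P i) + b * f (P (Suc i)) = 0" using val[OF f(1)] f(2,3) by simp
    obtain u where "f u \<noteq> 0" using f(4) by blast
    then have s: "sep f i" by (rule sep_of_weighted_zero[OF f(1) _ i(1) ab(1,2) fv i(2) f(2)])
    have nn: "lam l (c + 0 *\<^sub>R e) \<ge> 0" if "l < k" for l e using lam_nonneg[OF that c(1)] by simp
    have pr: "\<not> lat (c + t *\<^sub>R (v - c))" if "0 < t" "t < 1" for t using v that by (auto simp: targets_def)
    have cd: "card {t. 0 < t \<and> t < 1 \<and> wall (c + t *\<^sub>R (v - c))} = n" using v by (simp add: targets_def)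
    \<comment> \<open>An infinite set has cardinality 0, so \<open>n \<ge> 1\<close> gives
      finiteness.\<close>
    have fin: "finite {t. 0 < t \<and> t < 1 \<and> wall (c + t *\<^sub>R (v - c))}"
      by (rule card_ge_0_finite) (use n cd in linarith)
    have fv: "f (c + (v - c)) = 0" and lv: "lat (c + (v - c))" and vc': "v - c \<noteq> 0"
      using f v vc by (auto simp: targets_def)
    obtain w q where w: "hd w = i" "w \<noteq> []" "adm w" "feas f w" "q \<in> V" "lam (last w) q > 0" "unf w q = v"
      using ray_reaches[OF f(1,2) fv vc' i(1) s nn _ vi _ lv pr fin] i by auto
    \<comment> \<open>\<open>ray_reaches\<close> says nothing about the length of \<open>w\<close>;
      counting the walls once more through \<open>diag_ray\<close> shows that it is
      \<open>n\<close>.\<close>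
    have "unf w q \<in> targets c i (length w)"
      using diag_ray(2)[OF c _ f(1,2) w(4,3,2,5,6)] w i f by simp
    then have "length w = n" using cd unfolding w(7) targets_def by simp
    moreover have "f (unf w q) = 0" using f(3) unfolding w(7) .
    ultimately have "(w, q) \<in> diag c n" unfolding dg
      by (intro conjI exI[of _ f]) (use w i f in simp_all)
    then show "z \<in> ?F ` diag c n" using z w(1,7) by (intro image_eqI[of _ _ "(w, q)"]) simp_all
  qed
  have card: "card (diag c n) = card (Sigma ?I (\<lambda>i. targets c i n))"
    using card_image[OF inj] unfolding img by (rule sym)
  have "finite (diag c n)"
  proof (rule finite_subset)
    show "diag c n \<subseteq> {w. set w \<subseteq> {..<k} \<and> length w = n} \<times> V" unfolding diag_def Z_def adm_def by blast
    show "finite ({w. set w \<subseteq> {..<k} \<and> length w = n} \<times> V)"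
      by (intro finite_cartesian_product finite_lists_length_eq finite_V) simp
  qed
  then have fs: "finite (Sigma ?I (\<lambda>i. targets c i n))" unfolding img[symmetric] by (rule finite_imageI)
  show fin: "finite (targets c i n)" if "i < k" "lam i c > 0" for i
  proof (rule finite_subset)
    show "targets c i n \<subseteq> snd ` Sigma ?I (\<lambda>i. targets c i n)"
    proof
      fix v assume "v \<in> targets c i n"
      then show "v \<in> snd ` Sigma ?I (\<lambda>i. targets c i n)"
        using that by (intro image_eqI[of _ _ "(i, v)"]) auto
    qed
    show "finite (snd ` Sigma ?I (\<lambda>i. targets c i n))" using fs by (rule finite_imageI)
  qed
  then show "card (diag c n) = (\<Sum>i | i < k \<and> lam i c > 0. card (targets c i n))"
    unfolding card by (intro card_SigmaI) auto
qed

end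

section \<open>Counting coprime pairs\<close>

text \<open>The form of \<open>o(n^r)\<close> that holds for every \<open>n\<close>. It is needed
  because the bound gets evaluated at all the numbers \<open>n div d\<close>, many of which are
  small.\<close>

lemma tendsto_zero_imp_bound:
  fixes h :: "nat \<Rightarrow> real"
  assumes "(\<lambda>n. h n / real n ^ r) \<longlonglongrightarrow> 0" "e > 0"
  obtains C where "C \<ge> 0" "\<And>n. \<bar>h n\<bar> \<le> e * real n ^ r + C"
proof -
  have "\<forall>\<^sub>F n in sequentially. \<bar>h n / real n ^ r\<bar> < e"
    using tendstoD[OF assms] by (simp only: dist_real_def diff_0_right)
  then obtain N where N: "\<And>n. n \<ge> N \<Longrightarrow> \<bar>h n / real n ^ r\<bar> < e"
    by (auto simp: eventually_sequentially)
  define C where "C = (\<Sum>n\<le>N. \<bar>h n\<bar>)"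
  have C: "C \<ge> 0" by (auto simp: C_def intro: sum_nonneg)
  have "\<bar>h n\<bar> \<le> e * real n ^ r + C" for n
  proof (cases "n \<le> N")
    case True
    then have "\<bar>h n\<bar> \<le> C" unfolding C_def by (intro member_le_sum) auto
    then show ?thesis using assms(2) by (simp add: add_increasing)
  next
    case False
    then have "\<bar>h n\<bar> / real n ^ r < e" using N[of n] by (simp add: abs_divide)
    then have "\<bar>h n\<bar> < e * real n ^ r" using False by (simp add: field_simps)
    then show ?thesis using C by simp
  qed
  then show ?thesis using that C by blast
qed

lemma bound_imp_tendsto_zero:
  fixes h :: "nat \<Rightarrow> real"
  assumes "\<And>e. e > 0 \<Longrightarrow> \<exists>C. \<forall>n. \<bar>h n\<bar> \<le> e * real n ^ r + C" "r > 0"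
  shows "(\<lambda>n. h n / real n ^ r) \<longlonglongrightarrow> 0"
proof (rule tendstoI)
  fix e :: real assume e: "e > 0"
  obtain C where C: "\<And>n. \<bar>h n\<bar> \<le> e / 2 * real n ^ r + C" using assms(1)[of "e / 2"] e by auto
  have "filterlim (\<lambda>n. real n ^ r) at_top sequentially"
    using assms(2) by (intro filterlim_pow_at_top filterlim_real_sequentially)
  then have "\<forall>\<^sub>F n in sequentially. real n ^ r > max 0 (2 * C / e)"
    using filterlim_at_top_dense[of "\<lambda>n. real n ^ r" sequentially] by blast
  then show "\<forall>\<^sub>F n in sequentially. dist (h n / real n ^ r) 0 < e"
  proof eventually_elim
    case (elim n)
    then have "C < e / 2 * real n ^ r" using e by (simp add: field_simps)
    then have "\<bar>h n\<bar> < e * real n ^ r" using C[of n] by (simp add: field_simps)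
    then show ?case using elim by (simp add: dist_real_def abs_divide field_simps)
  qed
qed

lemma div_real_bounds:
  assumes "(p::nat) > 0"
  shows "real (m div p) \<le> real m / real p" "real m / real p - 1 \<le> real (m div p)"
proof -
  show "real (m div p) \<le> real m / real p" by (rule of_nat_div_le_of_nat)
  have "m < p * (m div p + 1)" using assms by (simp add: dividend_less_times_div)
  then have "real m < real p * (real (m div p) + 1)"
    by (metis of_nat_1 of_nat_add of_nat_less_iff of_nat_mult)
  then show "real m / real p - 1 \<le> real (m div p)" using assms by (simp add: field_simps)
qed

lemma sum_inverse_squares_from_2: "(\<Sum>d=2..n. 1 / (real d)\<^sup>2) \<le> 3 / 4"
proof -
  \<comment> \<open>Telescoping with \<open>1 / (n (n + 1))\<close>. There is equality at
    \<open>n = 2\<close>, which is where 3/4 comes from.\<close>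
  have *: "(\<Sum>d=2..n. 1 / (real d)\<^sup>2) \<le> 3 / 4 - 1 / real n" if "n \<ge> 2" for n
    using that
  proof (induction n rule: dec_induct)
    case (step n)
    have "1 / (real (Suc n))\<^sup>2 \<le> 1 / (real n * real (Suc n))"
      using step by (intro divide_left_mono) (auto simp: power2_eq_square)
    also have "\<dots> = 1 / real n - 1 / real (Suc n)" using step by (simp add: field_simps)
    finally show ?case using step by simp
  qed simp
  then show ?thesis
  proof (cases "n \<ge> 2")
    case True
    have "3 / 4 - 1 / real n \<le> 3 / 4" by simp
    then show ?thesis using * [OF True] by linarith
  qed simp
qed

text \<open>
  The terms with \<open>d \<ge> 2\<close> weigh less than the term \<open>d = 1\<close>, because \<open>\<zeta>(2) - 1 < 1\<close>.  So the error bound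
  improves by a constant factor whenever it is fed back into the sum; this replaces Moebius inversion.
\<close>

lemma divisor_sum_tendsto_zero:
  fixes e :: "nat \<Rightarrow> real"
  assumes bound: "\<And>n. \<bar>e n\<bar> \<le> K * (real n)\<^sup>2" and "K \<ge> 0"
    and lim: "(\<lambda>n. (\<Sum>d=1..n. e (n div d)) / (real n)\<^sup>2) \<longlonglongrightarrow> 0"
  shows "(\<lambda>n. e n / (real n)\<^sup>2) \<longlonglongrightarrow> 0"
proof -
  \<comment> \<open>The bound after \<open>j\<close> rounds; \<open>\<epsilon>\<close> collects the
    losses of all rounds and can be prescribed in advance.\<close>
  have main: "\<exists>C\<ge>0. \<forall>n. \<bar>e n\<bar> \<le> (K * (3/4) ^ j + \<epsilon>) * (real n)\<^sup>2 + C" if "\<epsilon> > 0" for j \<epsilon>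
    using that
  proof (induction j arbitrary: \<epsilon>)
    case 0
    have "\<bar>e n\<bar> \<le> (K + \<epsilon>) * (real n)\<^sup>2" for n
      using bound[of n] 0 by (smt (verit, ccfv_SIG) mult_right_mono zero_le_power2)
    then show ?case by auto
  next
    case (Suc j)
    \<comment> \<open>The budget: the hypothesis with \<open>\<epsilon> / 2\<close> costs 3/8 of
      \<open>\<epsilon>\<close> after the factor 3/4, and the divisor sum and the linear term cost
      1/8 each.\<close>
    define L where "L = K * (3/4) ^ j + \<epsilon> / 2"
    have L: "L \<ge> 0" using Suc assms(2) by (simp add: L_def)
    obtain C where C: "C \<ge> 0" "\<And>n. \<bar>e n\<bar> \<le> L * (real n)\<^sup>2 + C"
      using Suc.IH[of "\<epsilon> / 2"] Suc.prems by (auto simp: L_def)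
    obtain D where D: "D \<ge> 0" "\<And>n. \<bar>\<Sum>d=1..n. e (n div d)\<bar> \<le> \<epsilon> / 8 * (real n)\<^sup>2 + D"
      using tendsto_zero_imp_bound[OF lim, of "\<epsilon> / 8"] Suc.prems by auto
    \<comment> \<open>\<open>\<bar>e 0\<bar>\<close> settles \<open>n = 0\<close>; the last summand
      is what remains of the linear term once it is absorbed into the square.\<close>
    have "\<bar>e n\<bar> \<le> (K * (3/4) ^ Suc j + \<epsilon>) * (real n)\<^sup>2 + (\<bar>e 0\<bar> + D + 2 * C\<^sup>2 / \<epsilon>)" for n
    proof (cases "n = 0")
      case True
      then show ?thesis using D Suc.prems by simp
    next
      case False
      have "(\<Sum>d=1..n. e (n div d)) = e n + (\<Sum>d=2..n. e (n div d))"
        using False by (simp add: sum.atLeast_Suc_atMost numeral_2_eq_2)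
      then have "\<bar>e n\<bar> \<le> \<bar>\<Sum>d=1..n. e (n div d)\<bar> + (\<Sum>d=2..n. \<bar>e (n div d)\<bar>)"
        using sum_abs[of "\<lambda>d. e (n div d)" "{2..n}"] by linarith
      also have "(\<Sum>d=2..n. \<bar>e (n div d)\<bar>) \<le> (\<Sum>d=2..n. L * (real n)\<^sup>2 * (1 / (real d)\<^sup>2) + C)"
      proof (rule sum_mono)
        fix d assume d: "d \<in> {2..n}"
        have "real (n div d) \<le> real n / real d" using d by (intro div_real_bounds) simp
        then have "(real (n div d))\<^sup>2 \<le> (real n / real d)\<^sup>2" by (intro power_mono) auto
        then have "L * (real (n div d))\<^sup>2 \<le> L * (real n)\<^sup>2 * (1 / (real d)\<^sup>2)"
          using L mult_left_mono by (fastforce simp: power_divide)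
        then show "\<bar>e (n div d)\<bar> \<le> L * (real n)\<^sup>2 * (1 / (real d)\<^sup>2) + C"
          using C(2)[of "n div d"] by linarith
      qed
      also have "\<dots> = L * (real n)\<^sup>2 * (\<Sum>d=2..n. 1 / (real d)\<^sup>2) + C * real (n - 1)"
        by (simp add: sum.distrib sum_distrib_left)
      also have "\<dots> \<le> L * (real n)\<^sup>2 * (3 / 4) + C * real n"
        using L C(1) sum_inverse_squares_from_2 by (intro add_mono mult_left_mono) auto
      \<comment> \<open>The terms \<open>C\<close> add up to a linear term, which is absorbed by
        completing the square.\<close>
      also have "C * real n \<le> \<epsilon> / 8 * (real n)\<^sup>2 + 2 * C\<^sup>2 / \<epsilon>"
      proof -
        have "0 \<le> (\<epsilon> * real n - 4 * C)\<^sup>2 / (8 * \<epsilon>)" using Suc.prems by simp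
        also have "\<dots> = \<epsilon> / 8 * (real n)\<^sup>2 + 2 * C\<^sup>2 / \<epsilon> - C * real n"
          using Suc.prems by (simp add: power2_eq_square field_simps)
        finally show ?thesis by simp
      qed
      finally have "\<bar>e n\<bar> \<le> (\<epsilon> / 8 * (real n)\<^sup>2 + D) + (L * (real n)\<^sup>2 * (3 / 4) + (\<epsilon> / 8 * (real n)\<^sup>2 + 2 * C\<^sup>2 / \<epsilon>))"
        using D(2)[of n] by linarith
      also have "\<dots> = (K * (3/4) ^ Suc j + 5 / 8 * \<epsilon>) * (real n)\<^sup>2 + (D + 2 * C\<^sup>2 / \<epsilon>)"
        by (simp add: L_def algebra_simps)
      also have "(K * (3/4) ^ Suc j + 5 / 8 * \<epsilon>) * (real n)\<^sup>2 \<le> (K * (3/4) ^ Suc j + \<epsilon>) * (real n)\<^sup>2"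
        using Suc.prems by (intro mult_right_mono) auto
      finally show ?thesis by simp
    qed
    moreover have "\<bar>e 0\<bar> + D + 2 * C\<^sup>2 / \<epsilon> \<ge> 0" using D Suc.prems by simp
    ultimately show ?case by blast
  qed
  show ?thesis
  proof (rule bound_imp_tendsto_zero)
    fix \<epsilon> :: real assume \<epsilon>: "\<epsilon> > 0"
    have "(\<lambda>j. K * (3/4) ^ j) \<longlonglongrightarrow> K * 0" by (intro tendsto_intros LIMSEQ_realpow_zero) auto
    then have "\<forall>\<^sub>F j in sequentially. K * (3/4) ^ j < \<epsilon> / 2" using \<epsilon> by (intro order_tendstoD(2)) auto
    then obtain j where j: "K * (3/4) ^ j < \<epsilon> / 2" by (auto simp: eventually_sequentially)
    obtain C where C: "\<And>n. \<bar>e n\<bar> \<le> (K * (3/4) ^ j + \<epsilon> / 2) * (real n)\<^sup>2 + C" using main[of "\<epsilon> / 2" j] \<epsilon> by auto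
    have "(K * (3/4) ^ j + \<epsilon> / 2) * (real n)\<^sup>2 \<le> \<epsilon> * (real n)\<^sup>2" for n
      using j by (intro mult_right_mono) auto
    then show "\<exists>C. \<forall>n. \<bar>e n\<bar> \<le> \<epsilon> * (real n)\<^sup>2 + C" using C by (metis add_right_mono order_trans)
  qed simp
qed

section \<open>Lattice points and coprime pairs in a triangle\<close>

definition tri :: "nat \<Rightarrow> nat \<Rightarrow> nat \<Rightarrow> (nat \<times> nat) set" where
  "tri p q n = {(a, b). 0 < a \<and> 0 < b \<and> p * a + q * b \<le> n}"

definition cop :: "nat \<Rightarrow> nat \<Rightarrow> nat \<Rightarrow> (nat \<times> nat) set" where
  "cop p q n = {(a, b). 0 < a \<and> 0 < b \<and> coprime a b \<and> p * a + q * b \<le> n}"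

lemma tri_alt:
  assumes "p > 0" "q > 0"
  shows "tri p q n = (\<lambda>(b, a). (a, b)) ` Sigma {1..n div q} (\<lambda>b. {1..(n - q * b) div p})"
proof (intro equalityI subsetI)
  fix z assume "z \<in> tri p q n"
  then obtain a b where z: "z = (a, b)" "0 < a" "0 < b" "p * a + q * b \<le> n" by (auto simp: tri_def)
  have "b * q \<le> n" "a * p \<le> n - q * b" using z by (auto simp: mult.commute)
  then have "b \<in> {1..n div q}" "a \<in> {1..(n - q * b) div p}"
    using z assms by (auto simp: less_eq_div_iff_mult_less_eq)
  then show "z \<in> (\<lambda>(b, a). (a, b)) ` Sigma {1..n div q} (\<lambda>b. {1..(n - q * b) div p})"
    unfolding z(1) by (intro image_eqI[of _ _ "(b, a)"]) auto
next
  fix z assume "z \<in> (\<lambda>(b, a). (a, b)) ` Sigma {1..n div q} (\<lambda>b. {1..(n - q * b) div p})"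
  then obtain a b where z: "z = (a, b)" "b \<in> {1..n div q}" "a \<in> {1..(n - q * b) div p}" by auto
  then have "0 < a" "0 < b" "b * q \<le> n" "a * p \<le> n - q * b"
    using assms by (auto simp: less_eq_div_iff_mult_less_eq)
  then show "z \<in> tri p q n" by (auto simp: tri_def z(1) mult.commute)
qed

lemma finite_tri: "p > 0 \<Longrightarrow> q > 0 \<Longrightarrow> finite (tri p q n)"
  by (simp add: tri_alt)

lemma cop_subset_tri: "cop p q n \<subseteq> tri p q n"
  by (auto simp: cop_def tri_def)

lemma card_tri_sum:
  assumes "p > 0" "q > 0"
  shows "card (tri p q n) = (\<Sum>b=1..n div q. (n - q * b) div p)"
proof -
  have "card (tri p q n) = card (Sigma {1..n div q} (\<lambda>b. {1..(n - q * b) div p}))"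
    unfolding tri_alt[OF assms] by (rule card_image) (auto simp: inj_on_def)
  also have "\<dots> = (\<Sum>b=1..n div q. card {1..(n - q * b) div p})" by (rule card_SigmaI) auto
  finally show ?thesis by simp
qed

text \<open>Dropping the floors costs at most 1 in each of the \<open>n div q\<close> rows. The
  remaining arithmetic progression is summed exactly, with \<open>\<theta>\<close> the fractional
  part of \<open>n / q\<close>.\<close>

lemma card_tri_bound:
  assumes "p > 0" "q > 0"
  shows "\<bar>real (card (tri p q n)) - (real n)\<^sup>2 / (2 * real p * real q)\<bar> \<le> 2 * real n + real q"
proof -
  define M where "M = n div q"
  define x where "x = real n / real q"
  define \<theta> where "\<theta> = x - real M"
  have \<theta>: "0 \<le> \<theta>" "\<theta> \<le> 1" using div_real_bounds[OF assms(2), of n] by (auto simp: \<theta>_def x_def M_def)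
  have Mn: "real M \<le> real n" by (simp add: M_def)
  have n: "real n = real q * x" using assms by (simp add: x_def)
  have le: "q * b \<le> n" if "b \<in> {1..M}" for b
    using that assms by (auto simp: M_def less_eq_div_iff_mult_less_eq mult.commute)
  define S where "S = (\<Sum>b=1..M. (real n - real q * real b) / real p)"
  have "real (card (tri p q n)) = (\<Sum>b=1..M. real ((n - q * b) div p))"
    by (simp add: card_tri_sum[OF assms] M_def)
  also have "\<dots> \<le> S \<and> S - real M \<le> \<dots>"
  proof
    show "(\<Sum>b=1..M. real ((n - q * b) div p)) \<le> S"
      unfolding S_def
    proof (rule sum_mono)
      fix b assume "b \<in> {1..M}"
      then show "real ((n - q * b) div p) \<le> (real n - real q * real b) / real p"
        using div_real_bounds(1)[OF assms(1), of "n - q * b"] le[of b] by (simp add: of_nat_diff)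
    qed
    have "S - real M = (\<Sum>b=1..M. (real n - real q * real b) / real p - 1)"
      by (simp add: S_def sum_subtractf)
    also have "\<dots> \<le> (\<Sum>b=1..M. real ((n - q * b) div p))"
    proof (rule sum_mono)
      fix b assume "b \<in> {1..M}"
      then show "(real n - real q * real b) / real p - 1 \<le> real ((n - q * b) div p)"
        using div_real_bounds(2)[OF assms(1), of "n - q * b"] le[of b] by (simp add: of_nat_diff)
    qed
    finally show "S - real M \<le> (\<Sum>b=1..M. real ((n - q * b) div p))" .
  qed
  finally have 1: "\<bar>real (card (tri p q n)) - S\<bar> \<le> real n" using Mn by linarith
  have gs: "(\<Sum>b=1..m. real b) = real m * (real m + 1) / 2" for m
    by (induction m) (auto simp: field_simps)
  have "S = (real M * real n - real q * (\<Sum>b=1..M. real b)) / real p"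
    by (simp add: S_def sum_subtractf sum_distrib_left flip: sum_divide_distrib)
  also have "\<dots> = (real M * real n - real q * (real M * (real M + 1) / 2)) / real p" by (simp only: gs)
  also have "\<dots> = (real n)\<^sup>2 / (2 * real p * real q) + real q * (\<theta> * (1 - \<theta>) - x) / (2 * real p)"
  proof -
    have M: "real M = x - \<theta>" by (simp add: \<theta>_def)
    show ?thesis unfolding M n using assms by (simp add: field_simps power2_eq_square)
  qed
  finally have S: "S - (real n)\<^sup>2 / (2 * real p * real q) = real q * (\<theta> * (1 - \<theta>) - x) / (2 * real p)" by simp
  have "\<theta> * (1 - \<theta>) \<le> 1 * 1" using \<theta> by (intro mult_mono) auto
  moreover have "\<theta> * (1 - \<theta>) \<ge> 0" "x \<ge> 0" using \<theta> by (auto simp: x_def)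
  ultimately have "\<bar>\<theta> * (1 - \<theta>) - x\<bar> \<le> x + 1" by linarith
  then have "real q * \<bar>\<theta> * (1 - \<theta>) - x\<bar> \<le> real q * (x + 1)" by (intro mult_left_mono) auto
  also have "\<dots> = real n + real q" by (simp add: n algebra_simps)
  finally have "real q * \<bar>\<theta> * (1 - \<theta>) - x\<bar> / (2 * real p) \<le> (real n + real q) / (2 * real p)"
    by (intro divide_right_mono) auto
  also have "\<dots> \<le> (real n + real q) / 1" using assms by (intro divide_left_mono) auto
  finally have "\<bar>S - (real n)\<^sup>2 / (2 * real p * real q)\<bar> \<le> real n + real q"
    unfolding S by (simp add: abs_mult abs_divide)
  then show ?thesis using 1 by linarith
qed

text \<open>The pairs are sorted by their gcd \<open>d\<close>: a multiple by \<open>d\<close> stays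
  within the bound \<open>n\<close> iff the reduced pair stays within
  \<open>n div d\<close>.\<close>

lemma card_tri_eq_sum_cop:
  assumes "p > 0" "q > 0"
  shows "card (tri p q n) = (\<Sum>d=1..n. card (cop p q (n div d)))"
proof -
  have fin: "finite (cop p q m)" for m
    using finite_subset[OF cop_subset_tri finite_tri[OF assms]] .
  let ?F = "\<lambda>(d, a, b). (d * a, d * b)"
  have "inj_on ?F (Sigma {1..n} (\<lambda>d. cop p q (n div d)))"
  proof (rule inj_onI)
    fix y z assume y: "y \<in> Sigma {1..n} (\<lambda>d. cop p q (n div d))" and z: "z \<in> Sigma {1..n} (\<lambda>d. cop p q (n div d))"
      and eq: "?F y = ?F z"
    obtain d a b where yd: "y = (d, a, b)" by (cases y)
    obtain d' a' b' where zd: "z = (d', a', b')" by (cases z)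
    have c: "coprime a b" "coprime a' b'" "d > 0" and e: "d * a = d' * a'" "d * b = d' * b'"
      using y z eq by (auto simp: yd zd cop_def)
    have "gcd (d * a) (d * b) = d" "gcd (d' * a') (d' * b') = d'"
      using c by (simp_all flip: gcd_mult_distrib_nat add: coprime_iff_gcd_eq_1)
    then have "d = d'" using e by simp
    then show "y = z" using e c by (simp add: yd zd)
  qed
  moreover have "?F ` Sigma {1..n} (\<lambda>d. cop p q (n div d)) = tri p q n"
  proof (intro equalityI subsetI)
    fix z assume "z \<in> ?F ` Sigma {1..n} (\<lambda>d. cop p q (n div d))"
    then obtain d a b where z: "z = (d * a, d * b)" "d \<in> {1..n}" "(a, b) \<in> cop p q (n div d)" by auto
    then have "(p * a + q * b) * d \<le> n" by (simp add: cop_def less_eq_div_iff_mult_less_eq)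
    then show "z \<in> tri p q n" using z by (simp add: tri_def cop_def algebra_simps)
  next
    fix z assume "z \<in> tri p q n"
    then obtain a b where z: "z = (a, b)" "0 < a" "0 < b" "p * a + q * b \<le> n" by (auto simp: tri_def)
    define d where "d = gcd a b"
    have d: "d > 0" using z by (simp add: d_def)
    have ab: "a = d * (a div d)" "b = d * (b div d)" by (simp_all add: d_def)
    have "coprime (a div d) (b div d)" unfolding d_def by (rule div_gcd_coprime) (use z in auto)
    moreover have "a div d > 0" "b div d > 0" using ab z by (metis gr0I mult_zero_right)+
    moreover have "(p * (a div d) + q * (b div d)) * d \<le> n"
      using z(4) ab by (metis add_mult_distrib mult.commute mult.left_commute)
    then have "p * (a div d) + q * (b div d) \<le> n div d" using d by (simp add: less_eq_div_iff_mult_less_eq)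
    ultimately have c: "(a div d, b div d) \<in> cop p q (n div d)" by (simp add: cop_def)
    have "a \<le> p * a" using assms by simp
    then have "d \<le> n" using gcd_le1_nat[of a b] z unfolding d_def by linarith
    then show "z \<in> ?F ` Sigma {1..n} (\<lambda>d. cop p q (n div d))"
      using c d ab z(1) by (intro image_eqI[of _ _ "(d, a div d, b div d)"]) auto
  qed
  ultimately have "card (tri p q n) = card (Sigma {1..n} (\<lambda>d. cop p q (n div d)))"
    using card_image by fastforce
  also have "\<dots> = (\<Sum>d=1..n. card (cop p q (n div d)))" by (rule card_SigmaI) (auto simp: fin)
  finally show ?thesis .
qed

text \<open>Each term tends to \<open>1 / d\<^sup>2\<close> and never exceeds it, so Tannery's
  theorem yields \<open>\<zeta>(2)\<close>.\<close>

lemma sum_div_squares: "(\<lambda>n. (\<Sum>d=1..n. (real (n div d))\<^sup>2) / (real n)\<^sup>2) \<longlonglongrightarrow> pi\<^sup>2 / 6"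
proof -
  \<comment> \<open>Indexed from 0, so \<open>d\<close> stands for the divisor \<open>Suc d\<close>;
    terms with a divisor above \<open>n\<close> are zero, and the series is the finite sum.\<close>
  define g where "g d n = (real (n div Suc d))\<^sup>2 / (real n)\<^sup>2" for d n :: nat
  have gb: "norm (g d n) \<le> 1 / (real d + 1)\<^sup>2" for d n
  proof (cases "n = 0")
    case False
    have "real (n div Suc d) \<le> real n / real (Suc d)" by (rule div_real_bounds) simp
    then have "(real (n div Suc d))\<^sup>2 \<le> (real n / real (Suc d))\<^sup>2" by (intro power_mono) auto
    then show ?thesis using False by (simp add: g_def power_divide divide_le_eq field_simps)
  qed (simp add: g_def)
  have gl: "(\<lambda>n. g d n) \<longlonglongrightarrow> 1 / (real d + 1)\<^sup>2" for d
  proof -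
    have "(\<lambda>n. real (n div Suc d) / real n) \<longlonglongrightarrow> 1 / (real d + 1)"
    proof (rule tendsto_sandwich)
      show "\<forall>\<^sub>F n in sequentially. 1 / (real d + 1) - 1 / real n \<le> real (n div Suc d) / real n"
        using eventually_gt_at_top[of 0]
      proof eventually_elim
        case (elim n)
        have "real n / real (Suc d) - 1 \<le> real (n div Suc d)" by (rule div_real_bounds) simp
        then have "(real n / real (Suc d) - 1) / real n \<le> real (n div Suc d) / real n" by (rule divide_right_mono) simp
        then show ?case using elim by (simp add: diff_divide_distrib add.commute)
      qed
      show "\<forall>\<^sub>F n in sequentially. real (n div Suc d) / real n \<le> 1 / (real d + 1)"
        using eventually_gt_at_top[of 0]
      proof eventually_elim
        case (elim n)
        have "real (n div Suc d) \<le> real n / real (Suc d)" by (rule div_real_bounds) simp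
        then show ?case using elim by (simp add: field_simps)
      qed
      have "(\<lambda>n. 1 / (real d + 1) - 1 / real n) \<longlonglongrightarrow> 1 / (real d + 1) - 0"
        by (intro tendsto_intros lim_1_over_n)
      then show "(\<lambda>n. 1 / (real d + 1) - 1 / real n) \<longlonglongrightarrow> 1 / (real d + 1)" by simp
    qed simp
    then have "(\<lambda>n. (real (n div Suc d) / real n)\<^sup>2) \<longlonglongrightarrow> (1 / (real d + 1))\<^sup>2" by (rule tendsto_power)
    then show ?thesis by (simp add: g_def power_divide)
  qed
  have sq: "(\<lambda>d. 1 / (real d + 1)\<^sup>2) sums (pi\<^sup>2 / 6)"
    using inverse_squares_sums by (simp add: add.commute)
  have "eventually (\<lambda>n. summable (\<lambda>d. norm (g d n))) sequentially \<and> summable (\<lambda>d. norm (1 / (real d + 1)\<^sup>2)) \<and>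
      (\<lambda>n. \<Sum>d. g d n) \<longlonglongrightarrow> (\<Sum>d. 1 / (real d + 1)\<^sup>2)"
    by (rule tannerys_theorem[OF gl _ sums_summable[OF sq]]) (use gb in \<open>auto intro!: always_eventually\<close>)
  then have "(\<lambda>n. \<Sum>d. g d n) \<longlonglongrightarrow> (\<Sum>d. 1 / (real d + 1)\<^sup>2)" by blast
  moreover have "(\<Sum>d. g d n) = (\<Sum>d=1..n. (real (n div d))\<^sup>2) / (real n)\<^sup>2" for n
  proof -
    have "(\<Sum>d. g d n) = (\<Sum>d<n. g d n)" by (rule suminf_finite) (auto simp: g_def)
    also have "\<dots> = (\<Sum>d=1..n. (real (n div d))\<^sup>2 / (real n)\<^sup>2)"
      by (rule sum.reindex_bij_witness[of _ "\<lambda>d. d - 1" Suc]) (auto simp: g_def)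
    finally show ?thesis by (simp add: sum_divide_distrib)
  qed
  ultimately show ?thesis using sums_unique[OF sq] by simp
qed

text \<open>\<open>B\<close> is the density \<open>1 / (2 p q)\<close> of all pairs divided by
  \<open>\<zeta>(2)\<close>. With this choice the divisor sum of the error \<open>e\<close> has no
  quadratic term, and \<open>divisor_sum_tendsto_zero\<close> passes this on to \<open>e\<close>
  itself.\<close>

lemma card_cop_asymptotics:
  assumes "p > 0" "q > 0"
  shows "(\<lambda>n. real (card (cop p q n)) / (real n)\<^sup>2) \<longlonglongrightarrow> 3 / (pi\<^sup>2 * real p * real q)"
proof -
  define B where "B = 3 / (pi\<^sup>2 * real p * real q)"
  have B: "B \<ge> 0" by (simp add: B_def)
  define e where "e n = real (card (cop p q n)) - B * (real n)\<^sup>2" for n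
  have "\<bar>e n\<bar> \<le> (1 + B) * (real n)\<^sup>2" for n
  proof -
    have "cop p q n \<subseteq> {1..n} \<times> {1..n}"
    proof
      fix z assume "z \<in> cop p q n"
      then obtain a b where z: "z = (a, b)" "0 < a" "0 < b" "p * a + q * b \<le> n" by (auto simp: cop_def)
      have "a \<le> p * a" "b \<le> q * b" using assms by auto
      then have "a \<le> n" "b \<le> n" using z(4) by linarith+
      then show "z \<in> {1..n} \<times> {1..n}" using z by auto
    qed
    then have "card (cop p q n) \<le> card ({1..n} \<times> {1..n})" by (intro card_mono) auto
    then have "real (card (cop p q n)) \<le> (real n)\<^sup>2" by (simp add: power2_eq_square flip: of_nat_mult)
    then show ?thesis using B unfolding e_def
      by (simp add: algebra_simps abs_le_iff add_increasing2 add_increasing)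
  qed
  moreover have "(\<lambda>n. (\<Sum>d=1..n. e (n div d)) / (real n)\<^sup>2) \<longlonglongrightarrow> 0"
  proof -
    have t: "(\<lambda>n. real (card (tri p q n)) / (real n)\<^sup>2) \<longlonglongrightarrow> 1 / (2 * real p * real q)"
    proof -
      have "(\<lambda>n. (2 * real n + real q) / (real n)\<^sup>2) \<longlonglongrightarrow> 0" by real_asymp
      moreover have "\<forall>\<^sub>F n in sequentially. norm (real (card (tri p q n)) / (real n)\<^sup>2 - 1 / (2 * real p * real q)) \<le> (2 * real n + real q) / (real n)\<^sup>2"
        using eventually_gt_at_top[of 0]
      proof eventually_elim
        case (elim n)
        have "real (card (tri p q n)) / (real n)\<^sup>2 - 1 / (2 * real p * real q)
           = (real (card (tri p q n)) - (real n)\<^sup>2 / (2 * real p * real q)) / (real n)\<^sup>2"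
          using elim by (simp add: diff_divide_distrib)
        then show ?case using card_tri_bound[OF assms, of n] by (simp add: abs_divide divide_right_mono)
      qed
      ultimately have "(\<lambda>n. real (card (tri p q n)) / (real n)\<^sup>2 - 1 / (2 * real p * real q)) \<longlonglongrightarrow> 0"
        by (rule Lim_null_comparison[rotated])
      then show ?thesis by (simp add: LIM_zero_iff)
    qed
    have "(\<lambda>n. real (card (tri p q n)) / (real n)\<^sup>2 - B * ((\<Sum>d=1..n. (real (n div d))\<^sup>2) / (real n)\<^sup>2))
        \<longlonglongrightarrow> 1 / (2 * real p * real q) - B * (pi\<^sup>2 / 6)"
      by (intro tendsto_intros t sum_div_squares)
    moreover have "1 / (2 * real p * real q) - B * (pi\<^sup>2 / 6) = 0" using assms by (simp add: B_def)
    moreover have "(\<Sum>d=1..n. e (n div d)) = real (card (tri p q n)) - B * (\<Sum>d=1..n. (real (n div d))\<^sup>2)" for n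
      by (simp add: e_def card_tri_eq_sum_cop[OF assms] sum_subtractf sum_distrib_left)
    ultimately show ?thesis by (simp only: diff_divide_distrib times_divide_eq_right)
  qed
  ultimately have "(\<lambda>n. e n / (real n)\<^sup>2) \<longlonglongrightarrow> 0" using B by (intro divisor_sum_tendsto_zero[of e "1 + B"]) auto
  then have "(\<lambda>n. e n / (real n)\<^sup>2 + B) \<longlonglongrightarrow> 0 + B" by (intro tendsto_intros)
  moreover have "\<forall>\<^sub>F n in sequentially. e n / (real n)\<^sup>2 + B = real (card (cop p q n)) / (real n)\<^sup>2"
    using eventually_gt_at_top[of 0] by eventually_elim (simp add: e_def field_simps)
  ultimately show ?thesis using Lim_transform_eventually by (fastforce simp: B_def)
qed

text \<open>The squares sum to \<open>n^3 / 3\<close> in leading order, and an error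
  \<open>o(m^2)\<close> sums to \<open>o(n^3)\<close>.\<close>

lemma sum_tendsto_cubic:
  fixes W :: "nat \<Rightarrow> real"
  assumes "(\<lambda>m. W m / (real m)\<^sup>2) \<longlonglongrightarrow> K"
  shows "(\<lambda>n. (\<Sum>m=1..<n. W m) / real n ^ 3) \<longlonglongrightarrow> K / 3"
proof -
  have "(\<lambda>m. W m / (real m)\<^sup>2 - K) \<longlonglongrightarrow> 0" using assms by (simp add: LIM_zero_iff)
  moreover have "\<forall>\<^sub>F m in sequentially. W m / (real m)\<^sup>2 - K = (W m - K * (real m)\<^sup>2) / (real m)\<^sup>2"
    using eventually_gt_at_top[of 0] by eventually_elim (simp add: field_simps)
  ultimately have lim: "(\<lambda>m. (W m - K * (real m)\<^sup>2) / (real m)\<^sup>2) \<longlonglongrightarrow> 0"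
    by (rule Lim_transform_eventually)
  have sq: "(\<Sum>m=1..<n. (real m)\<^sup>2) = real n ^ 3 / 3 - (real n)\<^sup>2 / 2 + real n / 6" if "n > 0" for n
    using that by (induction n rule: nat_induct_non_zero) (simp_all add: field_simps power2_eq_square power3_eq_cube)
  have "(\<lambda>n. (\<Sum>m=1..<n. W m - K * (real m)\<^sup>2) / real n ^ 3) \<longlonglongrightarrow> 0"
  proof (rule bound_imp_tendsto_zero)
    fix e :: real assume e: "e > 0"
    obtain C where C: "C \<ge> 0" "\<And>m. \<bar>W m - K * (real m)\<^sup>2\<bar> \<le> e / 2 * (real m)\<^sup>2 + C"
      using tendsto_zero_imp_bound[OF lim, of "e / 2"] e by auto
    have "(\<lambda>n. (C * real n) / real n ^ 3) \<longlonglongrightarrow> 0" by real_asymp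
    then obtain D where D: "\<And>n. \<bar>C * real n\<bar> \<le> e / 2 * real n ^ 3 + D"
      using tendsto_zero_imp_bound[of "\<lambda>n. C * real n" 3 "e / 2"] e by auto
    have "\<bar>\<Sum>m=1..<n. W m - K * (real m)\<^sup>2\<bar> \<le> e * real n ^ 3 + D" for n
    proof -
      have "\<bar>\<Sum>m=1..<n. W m - K * (real m)\<^sup>2\<bar> \<le> (\<Sum>m=1..<n. \<bar>W m - K * (real m)\<^sup>2\<bar>)" by (rule sum_abs)
      also have "\<dots> \<le> (\<Sum>m=1..<n. e / 2 * (real n)\<^sup>2 + C)"
      proof (rule sum_mono)
        fix m assume "m \<in> {1..<n}"
        then have "(real m)\<^sup>2 \<le> (real n)\<^sup>2" by (intro power_mono) auto
        then have "e / 2 * (real m)\<^sup>2 \<le> e / 2 * (real n)\<^sup>2" using e by (intro mult_left_mono) auto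
        then show "\<bar>W m - K * (real m)\<^sup>2\<bar> \<le> e / 2 * (real n)\<^sup>2 + C" using C(2)[of m] by linarith
      qed
      also have "\<dots> = real (n - 1) * (e / 2 * (real n)\<^sup>2 + C)" by simp
      also have "\<dots> \<le> real n * (e / 2 * (real n)\<^sup>2 + C)" using e C by (intro mult_right_mono) auto
      also have "\<dots> = e / 2 * real n ^ 3 + C * real n" by (simp add: algebra_simps power2_eq_square power3_eq_cube)
      also have "\<dots> \<le> e * real n ^ 3 + D" using D[of n] by (simp add: abs_le_iff)
      finally show ?thesis .
    qed
    then show "\<exists>C. \<forall>n. \<bar>\<Sum>m=1..<n. W m - K * (real m)\<^sup>2\<bar> \<le> e * real n ^ 3 + C" by blast
  qed simp
  moreover have "(\<lambda>n. K * (real n ^ 3 / 3 - (real n)\<^sup>2 / 2 + real n / 6) / real n ^ 3) \<longlonglongrightarrow> K / 3" by real_asymp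
  ultimately have "(\<lambda>n. (\<Sum>m=1..<n. W m - K * (real m)\<^sup>2) / real n ^ 3 + K * (real n ^ 3 / 3 - (real n)\<^sup>2 / 2 + real n / 6) / real n ^ 3) \<longlonglongrightarrow> 0 + K / 3"
    by (rule tendsto_add)
  moreover have "\<forall>\<^sub>F n in sequentially. (\<Sum>m=1..<n. W m - K * (real m)\<^sup>2) / real n ^ 3 + K * (real n ^ 3 / 3 - (real n)\<^sup>2 / 2 + real n / 6) / real n ^ 3 = (\<Sum>m=1..<n. W m) / real n ^ 3"
    using eventually_gt_at_top[of 0]
  proof eventually_elim
    case (elim n)
    have "(\<Sum>m=1..<n. W m - K * (real m)\<^sup>2) = (\<Sum>m=1..<n. W m) - K * (real n ^ 3 / 3 - (real n)\<^sup>2 / 2 + real n / 6)"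
      by (simp only: sum_subtractf flip: sum_distrib_left sq[OF elim])
    then show ?case by (simp add: diff_divide_distrib)
  qed
  ultimately show ?thesis using Lim_transform_eventually by fastforce
qed

section \<open>Asymptotics of the number of feasible words\<close>

text \<open>For positive \<open>\<delta>\<close> these times correspond to the integers strictly
  between \<open>\<alpha>\<close> and \<open>\<alpha> + \<delta>\<close>; the other sign follows by
  negating both.\<close>

lemma card_integer_times:
  fixes \<alpha> \<delta> :: real
  assumes "\<delta> \<noteq> 0"
  shows "finite {t. 0 < t \<and> t < 1 \<and> \<alpha> + t * \<delta> \<in> \<int>}"
    "\<bar>real (card {t. 0 < t \<and> t < 1 \<and> \<alpha> + t * \<delta> \<in> \<int>}) - \<bar>\<delta>\<bar>\<bar> \<le> 1"
proof -
  have pos: "finite {t. 0 < t \<and> t < 1 \<and> \<alpha> + t * \<delta> \<in> \<int>} \<and>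
    \<bar>real (card {t. 0 < t \<and> t < 1 \<and> \<alpha> + t * \<delta> \<in> \<int>}) - \<delta>\<bar> \<le> 1" if \<delta>: "\<delta> > 0" for \<alpha> \<delta> :: real
  proof -
    let ?S = "{t. 0 < t \<and> t < 1 \<and> \<alpha> + t * \<delta> \<in> \<int>}"
    let ?I = "{\<lfloor>\<alpha>\<rfloor> + 1..\<lceil>\<alpha> + \<delta>\<rceil> - 1}"
    have bij: "bij_betw (\<lambda>m. (real_of_int m - \<alpha>) / \<delta>) ?I ?S"
    proof (rule bij_betw_imageI)
      show "inj_on (\<lambda>m. (real_of_int m - \<alpha>) / \<delta>) ?I" using \<delta> by (auto simp: inj_on_def)
      show "(\<lambda>m. (real_of_int m - \<alpha>) / \<delta>) ` ?I = ?S"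
      proof (intro equalityI subsetI)
        fix t assume "t \<in> (\<lambda>m. (real_of_int m - \<alpha>) / \<delta>) ` ?I"
        then obtain m where m: "t = (real_of_int m - \<alpha>) / \<delta>" "m \<in> ?I" by blast
        have "\<alpha> < real_of_int m" "real_of_int m < \<alpha> + \<delta>" using m(2) unfolding atLeastAtMost_iff by linarith+
        then show "t \<in> ?S" using \<delta> by (simp add: m(1) field_simps)
      next
        fix t assume "t \<in> ?S"
        then obtain m where m: "0 < t" "t < 1" "\<alpha> + t * \<delta> = real_of_int m" by (auto elim: Ints_cases)
        have "t * \<delta> > 0" "t * \<delta> < \<delta>" using m \<delta> by auto
        then have "\<lfloor>\<alpha>\<rfloor> < m" "m < \<lceil>\<alpha> + \<delta>\<rceil>" using m(3) by linarith+
        then have "m \<in> ?I" by simp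
        moreover have "t = (real_of_int m - \<alpha>) / \<delta>" using m(3) \<delta> by (simp add: field_simps)
        ultimately show "t \<in> (\<lambda>m. (real_of_int m - \<alpha>) / \<delta>) ` ?I" by blast
      qed
    qed
    have "finite ?S" using bij_betw_finite[OF bij] by blast
    moreover have "card ?S = card ?I" using bij_betw_same_card[OF bij] by (rule sym)
    moreover have "\<bar>real (card ?I) - \<delta>\<bar> \<le> 1"
      using \<delta> by (simp, linarith)
    ultimately show ?thesis by simp
  qed
  have "finite {t. 0 < t \<and> t < 1 \<and> \<alpha> + t * \<delta> \<in> \<int>} \<and>
    \<bar>real (card {t. 0 < t \<and> t < 1 \<and> \<alpha> + t * \<delta> \<in> \<int>}) - \<bar>\<delta>\<bar>\<bar> \<le> 1"
  proof (cases "\<delta> > 0")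
    case True
    then show ?thesis using pos[of \<delta> \<alpha>] by simp
  next
    case False
    have "- \<alpha> + t * (- \<delta>) \<in> \<int> \<longleftrightarrow> \<alpha> + t * \<delta> \<in> \<int>" for t
      using minus_in_Ints_iff[of "\<alpha> + t * \<delta>"] by simp
    then show ?thesis using pos[of "- \<delta>" "- \<alpha>"] False assms by (simp only:) simp
  qed
  then show "finite {t. 0 < t \<and> t < 1 \<and> \<alpha> + t * \<delta> \<in> \<int>}"
    "\<bar>real (card {t. 0 < t \<and> t < 1 \<and> \<alpha> + t * \<delta> \<in> \<int>}) - \<bar>\<delta>\<bar>\<bar> \<le> 1" by blast+
qed

text \<open>If \<open>t * a = x\<close> and \<open>t * b = y\<close> are integers, then
  \<open>x * b = y * a\<close>, so a coprime \<open>a\<close> divides \<open>x\<close>, although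
  \<open>0 < x < a\<close>. A common divisor \<open>g > 1\<close> gives the lattice point at time
  \<open>1 / g\<close>.\<close>

lemma coprime_iff_no_lattice_between:
  assumes "(a::nat) > 0" "b > 0"
  shows "coprime a b \<longleftrightarrow> (\<forall>t::real. 0 < t \<and> t < 1 \<longrightarrow> \<not> (t * real a \<in> \<int> \<and> t * real b \<in> \<int>))"
proof
  assume c: "coprime a b"
  show "\<forall>t::real. 0 < t \<and> t < 1 \<longrightarrow> \<not> (t * real a \<in> \<int> \<and> t * real b \<in> \<int>)"
  proof (intro allI impI notI)
    fix t :: real assume t: "0 < t \<and> t < 1" and "t * real a \<in> \<int> \<and> t * real b \<in> \<int>"
    then obtain x y where xy: "t * real a = of_int x" "t * real b = of_int y" by (auto elim!: Ints_cases)
    have x: "0 < x" "x < int a"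
    proof -
      have "0 < t * real a" "t * real a < real a" using t assms by auto
      then show "0 < x" "x < int a" unfolding xy by linarith+
    qed
    have "real_of_int (x * int b) = real_of_int (y * int a)"
      using xy by (simp flip: xy)
    then have "x * int b = y * int a" by (simp only: of_int_eq_iff)
    then have "int a dvd x * int b" by simp
    moreover have "coprime (int a) (int b)" using c by simp
    ultimately have "int a dvd x" by (simp add: coprime_dvd_mult_left_iff)
    then show False using x zdvd_not_zless by blast
  qed
next
  assume *: "\<forall>t::real. 0 < t \<and> t < 1 \<longrightarrow> \<not> (t * real a \<in> \<int> \<and> t * real b \<in> \<int>)"
  show "coprime a b"
  proof (rule ccontr)
    assume nc: "\<not> coprime a b"
    define g where "g = gcd a b"
    have "g > 0" "g \<noteq> 1" using assms nc by (auto simp: g_def coprime_iff_gcd_eq_1)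
    then have "g > 1" by linarith
    then have t: "0 < 1 / real g" "1 / real g < 1" by auto
    have "g dvd a" "g dvd b" by (simp_all add: g_def)
    then have "1 / real g * real a = real (a div g)" "1 / real g * real b = real (b div g)"
      by (simp_all add: real_of_nat_div)
    then have "1 / real g * real a \<in> \<int>" "1 / real g * real b \<in> \<int>" by simp_all
    then show False using * t by blast
  qed
qed

lemma tendsto_shift_quadratic:
  fixes G :: "nat \<Rightarrow> real"
  assumes "(\<lambda>n. G n / (real n)\<^sup>2) \<longlonglongrightarrow> L"
  shows "(\<lambda>n. G (n + r) / (real n)\<^sup>2) \<longlonglongrightarrow> L" and "(\<lambda>n. G (n - r) / (real n)\<^sup>2) \<longlonglongrightarrow> L"
proof -
  have "(\<lambda>n. G (n + r) / (real (n + r))\<^sup>2 * ((real (n + r))\<^sup>2 / (real n)\<^sup>2)) \<longlonglongrightarrow> L * 1"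
  proof (intro tendsto_mult)
    show "(\<lambda>n. G (n + r) / (real (n + r))\<^sup>2) \<longlonglongrightarrow> L" using assms by (rule LIMSEQ_ignore_initial_segment)
    show "(\<lambda>n. (real (n + r))\<^sup>2 / (real n)\<^sup>2) \<longlonglongrightarrow> 1" unfolding of_nat_add by real_asymp
  qed
  moreover have "\<forall>\<^sub>F n in sequentially. G (n + r) / (real (n + r))\<^sup>2 * ((real (n + r))\<^sup>2 / (real n)\<^sup>2) = G (n + r) / (real n)\<^sup>2"
    using eventually_gt_at_top[of 0] by eventually_elim simp
  ultimately show "(\<lambda>n. G (n + r) / (real n)\<^sup>2) \<longlonglongrightarrow> L"
    using Lim_transform_eventually by fastforce
  have "(\<lambda>n. G n / (real n)\<^sup>2 * ((real n)\<^sup>2 / (real n + real r)\<^sup>2)) \<longlonglongrightarrow> L * 1"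
  proof (intro tendsto_mult assms)
    show "(\<lambda>n. (real n)\<^sup>2 / (real n + real r)\<^sup>2) \<longlonglongrightarrow> 1" by real_asymp
  qed
  \<comment> \<open>The limit is first taken along \<open>n + r\<close>, where the subtraction of
    \<open>r\<close> is not truncated.\<close>
  moreover have "\<forall>\<^sub>F n in sequentially. G n / (real n)\<^sup>2 * ((real n)\<^sup>2 / (real n + real r)\<^sup>2) = G (n + r - r) / (real (n + r))\<^sup>2"
    using eventually_gt_at_top[of 0] by eventually_elim simp
  ultimately have "(\<lambda>n. G (n + r - r) / (real (n + r))\<^sup>2) \<longlonglongrightarrow> L * 1"
    by (rule Lim_transform_eventually)
  then show "(\<lambda>n. G (n - r) / (real n)\<^sup>2) \<longlonglongrightarrow> L"
    using LIMSEQ_offset[of "\<lambda>n. G (n - r) / (real n)\<^sup>2" r] by simp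
qed

text \<open>A basis of \<open>\<int>\<^sup>2\<close> of either orientation.\<close>

definition unimod :: "real \<times> real \<Rightarrow> real \<times> real \<Rightarrow> bool" where
  "unimod u w \<longleftrightarrow> lat u \<and> lat w \<and> \<bar>fst u * snd w - snd u * fst w\<bar> = 1"

text \<open>Cramer's rule, with a determinant whose square is 1.\<close>

lemma unimod_lat:
  assumes "unimod u w" "lat c"
  shows "lat (c + (a *\<^sub>R u + b *\<^sub>R w)) \<longleftrightarrow> a \<in> \<int> \<and> b \<in> \<int>"
proof
  assume l: "lat (c + (a *\<^sub>R u + b *\<^sub>R w))"
  have "fst (a *\<^sub>R u + b *\<^sub>R w) = fst (c + (a *\<^sub>R u + b *\<^sub>R w)) - fst c"
    "snd (a *\<^sub>R u + b *\<^sub>R w) = snd (c + (a *\<^sub>R u + b *\<^sub>R w)) - snd c" by simp_all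
  then have xy: "fst (a *\<^sub>R u + b *\<^sub>R w) \<in> \<int>" "snd (a *\<^sub>R u + b *\<^sub>R w) \<in> \<int>"
    using l assms(2) unfolding lat_def by (metis Ints_diff)+
  define D where "D = fst u * snd w - snd u * fst w"
  have "D \<in> \<int>" "\<bar>D\<bar> = 1" using assms(1) by (auto simp: unimod_def D_def lat_def)
  then have "D * D = 1" by (simp add: abs_mult_self_eq flip: abs_mult_self_eq[of D])
  have "a * D = fst (a *\<^sub>R u + b *\<^sub>R w) * snd w - snd (a *\<^sub>R u + b *\<^sub>R w) * fst w"
    "b * D = snd (a *\<^sub>R u + b *\<^sub>R w) * fst u - fst (a *\<^sub>R u + b *\<^sub>R w) * snd u"
    by (simp_all add: D_def algebra_simps)
  then have "a * D \<in> \<int>" "b * D \<in> \<int>" using xy assms(1) by (auto simp: unimod_def lat_def)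
  then have "a * D * D \<in> \<int>" "b * D * D \<in> \<int>" using \<open>D \<in> \<int>\<close> by (auto intro: Ints_mult)
  then show "a \<in> \<int> \<and> b \<in> \<int>" using \<open>D * D = 1\<close> by (simp add: mult.assoc)
next
  assume "a \<in> \<int> \<and> b \<in> \<int>"
  then show "lat (c + (a *\<^sub>R u + b *\<^sub>R w))" using assms by (auto simp: unimod_def lat_def)
qed

lemma unimod_inj:
  assumes "unimod u w" "a *\<^sub>R u + b *\<^sub>R w = a' *\<^sub>R u + b' *\<^sub>R w"
  shows "a = a'" "b = b'"
proof -
  define D where "D = fst u * snd w - snd u * fst w"
  have D: "D \<noteq> 0" using assms(1) by (auto simp: unimod_def D_def)
  have e: "a * fst u + b * fst w = a' * fst u + b' * fst w" "a * snd u + b * snd w = a' * snd u + b' * snd w"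
    using arg_cong[OF assms(2), of fst] arg_cong[OF assms(2), of snd] by simp_all
  have "(a - a') * D = (a * fst u + b * fst w - (a' * fst u + b' * fst w)) * snd w
      - (a * snd u + b * snd w - (a' * snd u + b' * snd w)) * fst w"
    "(b - b') * D = (a * snd u + b * snd w - (a' * snd u + b' * snd w)) * fst u
      - (a * fst u + b * fst w - (a' * fst u + b' * fst w)) * snd u"
    by (simp_all add: D_def algebra_simps)
  then show "a = a'" "b = b'" using D e by auto
qed

context lattice_polygon
begin

text \<open>Each wall function contributes its increment along the segment, up to an error of 1. No
  crossing is counted twice, since walls of different functions meet only in lattice points and the
  segment has none inside. A function that is constant along the segment contributes nothing,
  because the segment starts through the interior of the polygon.\<close>

lemma wall_count:
  assumes c: "c \<in> V" and i: "i < k" "lam i c > 0" and ab: "a > 0" "b > 0"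
    and pr: "\<And>t. 0 < t \<Longrightarrow> t < 1 \<Longrightarrow> \<not> lat (c + t *\<^sub>R (a *\<^sub>R (P i - c) + b *\<^sub>R (P (Suc i) - c)))"
  defines "S \<equiv> {t. 0 < t \<and> t < 1 \<and> wall (c + t *\<^sub>R (a *\<^sub>R (P i - c) + b *\<^sub>R (P (Suc i) - c)))}"
  shows "finite S"
    and "\<bar>real (card S) - (\<Sum>\<phi>\<in>Phi. \<bar>a * (\<phi> (P i) - \<phi> c) + b * (\<phi> (P (Suc i)) - \<phi> c)\<bar>)\<bar> \<le> real (card Phi)"
proof -
  define \<delta> where "\<delta> \<phi> = a * (\<phi> (P i) - \<phi> c) + b * (\<phi> (P (Suc i)) - \<phi> c)" for \<phi> :: "real \<times> real \<Rightarrow> real"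
  define y where "y t = c + t *\<^sub>R (a *\<^sub>R (P i - c) + b *\<^sub>R (P (Suc i) - c))" for t
  have val: "g (y t) = g c + t * \<delta> g" if "affine_fun g" for g t
  proof -
    have "y t = c + ((t * a) *\<^sub>R (P i - c) + (t * b) *\<^sub>R (P (Suc i) - c))"
      by (simp add: y_def scaleR_add_right)
    then have "g (y t) = g c + (t * a) * (g (P i) - g c) + (t * b) * (g (P (Suc i)) - g c)"
      by (simp only: affine_fun_cone[OF that])
    then show ?thesis by (simp add: \<delta>_def algebra_simps)
  qed
  define T where "T \<phi> = {t. 0 < t \<and> t < 1 \<and> \<phi> c + t * \<delta> \<phi> \<in> \<int>}" for \<phi>
  have T: "finite (T \<phi>) \<and> \<bar>real (card (T \<phi>)) - \<bar>\<delta> \<phi>\<bar>\<bar> \<le> 1" if \<phi>: "\<phi> \<in> Phi" for \<phi>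
  proof (cases "\<delta> \<phi> = 0")
    case False
    then show ?thesis using card_integer_times[OF False, of "\<phi> c"] by (simp add: T_def)
  next
    case True
    \<comment> \<open>Half the time that the segment needs from \<open>c\<close> to side
      \<open>i\<close>, hence an interior point of the polygon.\<close>
    define t where "t = 1 / (2 * (a + b))"
    have t: "t > 0" "t * (a + b) = 1 / 2" using ab by (simp_all add: t_def)
    have "lam l (y t) > 0" if l: "l < k" for l
    proof -
      have "lam l (y t) = lam l c * (1 - t * (a + b)) + t * (a * lam l (P i) + b * lam l (P (Suc i)))"
        by (simp add: val[OF lam_affine] \<delta>_def algebra_simps)
      then have v: "lam l (y t) = lam l c / 2 + t * (a * lam l (P i) + b * lam l (P (Suc i)))"
        by (simp add: t(2))
      show ?thesis
      proof (cases "l = i")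
        case True
        then show ?thesis using v i lam_edge[OF i(1)] by simp
      next
        case False
        note e = lam_edge_other[OF l i(1) False]
        have "a * lam l (P i) + b * lam l (P (Suc i)) > 0"
          using e ab by (auto intro: add_pos_nonneg add_nonneg_pos)
        then show ?thesis using v t(1) lam_nonneg[OF l c] by (simp add: add_nonneg_pos)
      qed
    qed
    then have "\<phi> (y t) \<notin> \<int>" using Phi_interior \<phi> by blast
    then have "\<phi> c \<notin> \<int>" using val[OF Phi_affine[OF \<phi>], of t] True by simp
    then have "T \<phi> = {}" using True by (simp add: T_def)
    then show ?thesis using True by simp
  qed
  have S: "S = (\<Union>\<phi>\<in>Phi. T \<phi>)"
    using val Phi_affine unfolding S_def T_def wall_def y_def[symmetric] by auto
  then show "finite S" using T finite_Phi by auto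
  have "card S = (\<Sum>\<phi>\<in>Phi. card (T \<phi>))"
    unfolding S
  proof (rule card_UN_disjoint[OF finite_Phi])
    show "\<forall>\<phi>\<in>Phi. finite (T \<phi>)" using T by blast
    show "\<forall>\<phi>\<in>Phi. \<forall>\<psi>\<in>Phi. \<phi> \<noteq> \<psi> \<longrightarrow> T \<phi> \<inter> T \<psi> = {}"
    proof (intro ballI impI equals0I)
      fix \<phi> \<psi> t assume *: "\<phi> \<in> Phi" "\<psi> \<in> Phi" "\<phi> \<noteq> \<psi>" "t \<in> T \<phi> \<inter> T \<psi>"
      then have "\<phi> (y t) \<in> \<int>" "\<psi> (y t) \<in> \<int>" "0 < t" "t < 1"
        using val Phi_affine by (auto simp: T_def)
      then show False using Phi_meet[OF *(1-3)] pr[of t] by (simp add: y_def)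
    qed
  qed
  then have "real (card S) - (\<Sum>\<phi>\<in>Phi. \<bar>\<delta> \<phi>\<bar>) = (\<Sum>\<phi>\<in>Phi. real (card (T \<phi>)) - \<bar>\<delta> \<phi>\<bar>)"
    by (simp add: sum_subtractf)
  also have "\<bar>\<dots>\<bar> \<le> (\<Sum>\<phi>\<in>Phi. 1)"
    by (rule order_trans[OF sum_abs sum_mono]) (use T in blast)
  finally show "\<bar>real (card S) - (\<Sum>\<phi>\<in>Phi. \<bar>a * (\<phi> (P i) - \<phi> c) + b * (\<phi> (P (Suc i)) - \<phi> c)\<bar>)\<bar> \<le> real (card Phi)"
    by (simp add: \<delta>_def)
qed

text \<open>In the basis given by the corner, the targets are the coprime pairs. Their wall counts
  differ from the sum in \<open>G\<close> by at most \<open>r = card Phi\<close>, so the cumulated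
  number lies between values of \<open>G\<close> at shifted arguments, and a bounded shift does not
  affect the quadratic limit.\<close>

lemma targets_asymptotics:
  assumes c: "c \<in> V" and i: "i < k" "lam i c > 0"
    and uni: "unimod (P i - c) (P (Suc i) - c)"
  defines "G \<equiv> \<lambda>n. {(a, b). 0 < a \<and> 0 < b \<and> coprime a b \<and>
      (\<Sum>\<phi>\<in>Phi. \<bar>real a * (\<phi> (P i) - \<phi> c) + real b * (\<phi> (P (Suc i)) - \<phi> c)\<bar>) \<le> real n}"
  assumes fin: "\<And>n. finite (G n)" and lim: "(\<lambda>n. real (card (G n)) / (real n)\<^sup>2) \<longlonglongrightarrow> \<kappa>"
  shows "(\<lambda>m. real (\<Sum>n=1..<m. card (targets c i n)) / (real m)\<^sup>2) \<longlonglongrightarrow> \<kappa>"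
proof -
  define f where "f = (\<lambda>(a, b). c + (real a *\<^sub>R (P i - c) + real b *\<^sub>R (P (Suc i) - c)))"
  define cnt where "cnt = (\<lambda>(a, b). card {t. 0 < t \<and> t < 1 \<and> wall (c + t *\<^sub>R (real a *\<^sub>R (P i - c) + real b *\<^sub>R (P (Suc i) - c)))})"
  define Q where "Q = {(a, b). 0 < a \<and> 0 < b \<and> coprime a (b::nat)}"
  define r where "r = card Phi"
  have cl: "lat c" using c by (rule lat_V)
  have scale: "t *\<^sub>R (a *\<^sub>R u + b *\<^sub>R w) = (t * a) *\<^sub>R u + (t * b) *\<^sub>R (w :: real \<times> real)" for t a b u w
    by (simp add: scaleR_add_right)
  have prim: "(\<forall>t. 0 < t \<and> t < 1 \<longrightarrow> \<not> lat (c + t *\<^sub>R (real a *\<^sub>R (P i - c) + real b *\<^sub>R (P (Suc i) - c)))) \<longleftrightarrow> coprime a b"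
    if "a > 0" "b > 0" for a b
    unfolding scale unimod_lat[OF uni cl] by (rule coprime_iff_no_lattice_between[OF that, symmetric])
  have tg: "targets c i n = f ` {z \<in> Q. cnt z = n}" for n
  proof (intro equalityI subsetI)
    fix v assume v: "v \<in> targets c i n"
    then obtain a b where ab: "a > 0" "b > 0" "v = c + (a *\<^sub>R (P i - c) + b *\<^sub>R (P (Suc i) - c))"
      by (auto simp: targets_def)
    have "lat v" using v by (simp add: targets_def)
    then have "a \<in> \<int>" "b \<in> \<int>" using unimod_lat[OF uni cl] ab(3) by blast+
    then obtain a' b' :: nat where n: "a = real a'" "b = real b'"
      using ab(1,2) by (metis Ints_cases of_int_of_nat_eq of_int_0_less_iff zero_less_imp_eq_int)
    have "v - c = real a' *\<^sub>R (P i - c) + real b' *\<^sub>R (P (Suc i) - c)" using ab(3) n by simp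
    then have "coprime a' b'" "cnt (a', b') = n"
      using v prim[of a' b'] ab n by (auto simp: targets_def cnt_def)
    then show "v \<in> f ` {z \<in> Q. cnt z = n}"
      using ab n by (intro image_eqI[of _ _ "(a', b')"]) (auto simp: f_def Q_def)
  next
    fix v assume "v \<in> f ` {z \<in> Q. cnt z = n}"
    then obtain a b where z: "v = f (a, b)" "(a, b) \<in> Q" "cnt (a, b) = n" by auto
    have ab: "a > 0" "b > 0" "coprime a b" using z by (auto simp: Q_def)
    have vc: "v - c = real a *\<^sub>R (P i - c) + real b *\<^sub>R (P (Suc i) - c)" using z by (simp add: f_def)
    have "lat v" using unimod_lat[OF uni cl, of "real a" "real b"] z by (simp add: f_def)
    moreover have "\<exists>a>0. \<exists>b>0. v = c + (a *\<^sub>R (P i - c) + b *\<^sub>R (P (Suc i) - c))"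
      using z ab by (intro exI[of _ "real a"] conjI exI[of _ "real b"]) (auto simp: f_def)
    ultimately show "v \<in> targets c i n"
      unfolding targets_def vc mem_Collect_eq using prim[OF ab(1,2)] ab(3) z(3) by (simp add: cnt_def)
  qed
  have f_inj: "inj_on f Q"
  proof (rule inj_onI)
    fix y z assume "f y = f z"
    then show "y = z" using unimod_inj[OF uni, of "real (fst y)" "real (snd y)" "real (fst z)" "real (snd z)"]
      by (cases y; cases z) (simp add: f_def)
  qed
  have cnt: "\<bar>real (cnt (a, b)) - (\<Sum>\<phi>\<in>Phi. \<bar>real a * (\<phi> (P i) - \<phi> c) + real b * (\<phi> (P (Suc i)) - \<phi> c)\<bar>)\<bar> \<le> real r \<and> cnt (a, b) \<ge> 1"
    if "(a, b) \<in> Q" for a b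
  proof -
    have ab: "a > 0" "b > 0" "coprime a b" using that by (auto simp: Q_def)
    have pr: "\<not> lat (c + t *\<^sub>R (real a *\<^sub>R (P i - c) + real b *\<^sub>R (P (Suc i) - c)))" if "0 < t" "t < 1" for t
      using prim[OF ab(1,2)] ab(3) that by blast
    let ?S = "{t. 0 < t \<and> t < 1 \<and> wall (c + t *\<^sub>R (real a *\<^sub>R (P i - c) + real b *\<^sub>R (P (Suc i) - c)))}"
    have wc: "finite ?S" "\<bar>real (card ?S) - (\<Sum>\<phi>\<in>Phi. \<bar>real a * (\<phi> (P i) - \<phi> c) + real b * (\<phi> (P (Suc i)) - \<phi> c)\<bar>)\<bar> \<le> real (card Phi)"
      using wall_count[OF c i, of "real a" "real b"] ab pr by simp_all
    \<comment> \<open>The time at which the segment crosses side \<open>i\<close>. So the wall count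
      is at least 1, and the sums over \<open>n \<ge> 1\<close> miss no target.\<close>
    define t where "t = 1 / (real a + real b)"
    have t: "0 < t" "t < 1" "t * (real a + real b) = 1" using ab by (simp_all add: t_def)
    have "lam i (c + ((t * real a) *\<^sub>R (P i - c) + (t * real b) *\<^sub>R (P (Suc i) - c))) = lam i c * (1 - t * (real a + real b))"
      unfolding affine_fun_cone[OF lam_affine] using lam_edge[OF i(1)] by (simp add: algebra_simps)
    then have "lam i (c + t *\<^sub>R (real a *\<^sub>R (P i - c) + real b *\<^sub>R (P (Suc i) - c))) = 0" by (simp add: scale t(3))
    then have "t \<in> ?S" using t Phi_edge[OF i(1)] by (simp add: wall_def)
    then have "?S \<noteq> {}" by blast
    then have "card ?S \<ge> 1" using wc(1) by (simp add: card_gt_0_iff Suc_le_eq)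
    then show ?thesis using wc by (simp add: cnt_def r_def)
  qed
  define A where "A m = {z \<in> Q. cnt z < m}" for m
  have up: "A m \<subseteq> G (m + r)" for m
  proof
    fix z assume "z \<in> A m"
    then obtain a b where "z = (a, b)" "(a, b) \<in> Q" "cnt (a, b) < m" by (cases z) (auto simp: A_def)
    then show "z \<in> G (m + r)" using cnt[of a b] by (auto simp: G_def Q_def)
  qed
  \<comment> \<open>\<open>Suc r\<close> rather than \<open>r\<close>, because \<open>A m\<close>
    asks for fewer than \<open>m\<close> walls.\<close>
  have low: "G (m - Suc r) \<subseteq> A m" if "m > r" for m
  proof
    fix z assume z: "z \<in> G (m - Suc r)"
    then obtain a b where ab: "z = (a, b)" "(a, b) \<in> Q"
      "(\<Sum>\<phi>\<in>Phi. \<bar>real a * (\<phi> (P i) - \<phi> c) + real b * (\<phi> (P (Suc i)) - \<phi> c)\<bar>) \<le> real (m - Suc r)"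
      by (auto simp: G_def Q_def)
    have "real (m - Suc r) = real m - 1 - real r" using that by (simp add: of_nat_diff)
    then have "real (cnt (a, b)) < real m" using cnt[OF ab(2)] ab(3) by linarith
    then show "z \<in> A m" using ab by (simp add: A_def)
  qed
  have finA: "finite (A m)" for m using finite_subset[OF up fin] .
  have cardA: "(\<Sum>n=1..<m. card (targets c i n)) = card (A m)" for m
  proof -
    have "A m = (\<Union>n\<in>{1..<m}. {z \<in> Q. cnt z = n})"
    proof (intro equalityI subsetI)
      fix z assume "z \<in> A m"
      then show "z \<in> (\<Union>n\<in>{1..<m}. {z \<in> Q. cnt z = n})"
        using cnt[of "fst z" "snd z"] unfolding A_def by simp
    qed (auto simp: A_def)
    then have "card (A m) = (\<Sum>n\<in>{1..<m}. card {z \<in> Q. cnt z = n})"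
      by (simp only:) (intro card_UN_disjoint, auto intro: finite_subset[OF _ finA])
    moreover have "card (targets c i n) = card {z \<in> Q. cnt z = n}" for n
      unfolding tg by (intro card_image inj_on_subset[OF f_inj]) auto
    ultimately show ?thesis by simp
  qed
  have cm: "real (card (G (m - Suc r))) \<le> real (card (A m))" if "m > r" for m
    using card_mono[OF finA low[OF that]] by (rule of_nat_mono)
  have cm': "real (card (A m)) \<le> real (card (G (m + r)))" for m
    using card_mono[OF fin up] by (rule of_nat_mono)
  show ?thesis
    unfolding cardA
  proof (rule tendsto_sandwich)
    show "\<forall>\<^sub>F m in sequentially. real (card (G (m - Suc r))) / (real m)\<^sup>2 \<le> real (card (A m)) / (real m)\<^sup>2"
      using eventually_gt_at_top[of r]
      by eventually_elim (intro divide_right_mono cm, auto)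
    show "\<forall>\<^sub>F m in sequentially. real (card (A m)) / (real m)\<^sup>2 \<le> real (card (G (m + r))) / (real m)\<^sup>2"
      by (intro always_eventually allI divide_right_mono cm') auto
  qed (rule tendsto_shift_quadratic[OF lim])+
qed

text \<open>The partial sums of the targets are already quadratic, so the ray words have the sum of
  the \<open>\<kappa> c i\<close> as quadratic rate, and summing these once more gives a third of it
  in the cube. The counts for length 1 vanish in the limit.\<close>

lemma card_lang_asymptotics:
  assumes "\<And>c i. c \<in> V \<Longrightarrow> i < k \<Longrightarrow> lam i c > 0 \<Longrightarrow>
    (\<lambda>m. real (\<Sum>n=1..<m. card (targets c i n)) / (real m)\<^sup>2) \<longlonglongrightarrow> \<kappa> c i"
  shows "(\<lambda>n. real (card (lang n)) / real n ^ 3) \<longlonglongrightarrow> (\<Sum>c\<in>V. \<Sum>i | i < k \<and> lam i c > 0. \<kappa> c i) / 3"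
proof -
  define B where "B n = (\<Sum>c\<in>V. real (card (beam c n)))" for n
  have Bs: "B (Suc n) = B n + (\<Sum>c\<in>V. \<Sum>i | i < k \<and> lam i c > 0. real (card (targets c i n)))" if "n \<ge> 1" for n
    using card_beam_Suc card_diag(1) that by (simp add: B_def sum.distrib)
  have B: "B m = B 1 + (\<Sum>c\<in>V. \<Sum>i | i < k \<and> lam i c > 0. real (\<Sum>n=1..<m. card (targets c i n)))" if "m \<ge> 1" for m
    using that
  proof (induction m rule: dec_induct)
    case (step m)
    have "real (\<Sum>n=1..<Suc m. card (targets c i n)) = real (\<Sum>n=1..<m. card (targets c i n)) + real (card (targets c i m))" for c i
      using step by simp
    then show ?case using Bs[OF step(1)] step(3) by (simp only: sum.distrib)
  qed simp
  have "(\<lambda>m. B 1 / (real m)\<^sup>2 + (\<Sum>c\<in>V. \<Sum>i | i < k \<and> lam i c > 0. real (\<Sum>n=1..<m. card (targets c i n)) / (real m)\<^sup>2))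
      \<longlonglongrightarrow> 0 + (\<Sum>c\<in>V. \<Sum>i | i < k \<and> lam i c > 0. \<kappa> c i)"
  proof (intro tendsto_add tendsto_sum)
    have "(\<lambda>m. x / (real m)\<^sup>2) \<longlonglongrightarrow> 0" for x :: real by real_asymp
    then show "(\<lambda>m. B 1 / (real m)\<^sup>2) \<longlonglongrightarrow> 0" .
  qed (use assms in auto)
  moreover have "\<forall>\<^sub>F m in sequentially. B 1 / (real m)\<^sup>2 + (\<Sum>c\<in>V. \<Sum>i | i < k \<and> lam i c > 0. real (\<Sum>n=1..<m. card (targets c i n)) / (real m)\<^sup>2) = B m / (real m)\<^sup>2"
    using eventually_ge_at_top[of 1]
  proof eventually_elim
    case (elim m)
    show ?case unfolding B[OF elim] by (simp only: add_divide_distrib sum_divide_distrib)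
  qed
  ultimately have "(\<lambda>m. B m / (real m)\<^sup>2) \<longlonglongrightarrow> 0 + (\<Sum>c\<in>V. \<Sum>i | i < k \<and> lam i c > 0. \<kappa> c i)"
    by (rule Lim_transform_eventually)
  then have lim: "(\<lambda>n. (\<Sum>m=1..<n. B m) / real n ^ 3) \<longlonglongrightarrow> (\<Sum>c\<in>V. \<Sum>i | i < k \<and> lam i c > 0. \<kappa> c i) / 3"
    by (intro sum_tendsto_cubic) simp
  have L: "real (card (lang n)) = real (card (lang 1)) + (\<Sum>m=1..<n. B m)" if "n \<ge> 1" for n
    using that
  proof (induction n rule: dec_induct)
    case (step n)
    then show ?case using card_lang_Suc[OF step(1)] by (simp add: B_def)
  qed simp
  have "(\<lambda>n. real (card (lang 1)) / real n ^ 3 + (\<Sum>m=1..<n. B m) / real n ^ 3)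
      \<longlonglongrightarrow> 0 + (\<Sum>c\<in>V. \<Sum>i | i < k \<and> lam i c > 0. \<kappa> c i) / 3"
  proof (intro tendsto_add lim)
    have "(\<lambda>n. x / real n ^ 3) \<longlonglongrightarrow> 0" for x :: real by real_asymp
    then show "(\<lambda>n. real (card (lang 1)) / real n ^ 3) \<longlonglongrightarrow> 0" .
  qed
  moreover have "\<forall>\<^sub>F n in sequentially. real (card (lang 1)) / real n ^ 3 + (\<Sum>m=1..<n. B m) / real n ^ 3 = real (card (lang n)) / real n ^ 3"
    using eventually_ge_at_top[of 1]
  proof eventually_elim
    case (elim n)
    show ?case unfolding L[OF elim] by (simp only: add_divide_distrib)
  qed
  ultimately have "(\<lambda>n. real (card (lang n)) / real n ^ 3) \<longlonglongrightarrow> 0 + (\<Sum>c\<in>V. \<Sum>i | i < k \<and> lam i c > 0. \<kappa> c i) / 3"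
    by (rule Lim_transform_eventually)
  then show ?thesis by simp
qed

end

section \<open>Billiard orbits\<close>

text \<open>Two countability arguments. The coefficient \<open>r\<close> avoids the countably many
  values for which \<open>g\<close> vanishes at a lattice point off the first axis, and on the axis
  the summand 1/2 excludes zeros. Then each lattice point forbids a single \<open>t\<close>.\<close>

lemma exists_lattice_avoiding:
  fixes f :: "real \<times> real \<Rightarrow> real"
  assumes "affine_fun f"
  obtains g where "affine_fun g" "\<And>e. e > 0 \<Longrightarrow> \<exists>t. \<bar>t\<bar> < e \<and> (\<forall>p. lat p \<longrightarrow> f p + t * g p \<noteq> 0)"
proof -
  have cZ: "countable (\<int> :: real set)" unfolding Ints_def by simp
  have cL: "countable {p. lat p}"
  proof -
    have "{p. lat p} = \<int> \<times> \<int>" by (auto simp: lat_def)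
    then show ?thesis using countable_SIGMA[OF cZ cZ] by simp
  qed
  have "countable ((\<lambda>p. - (fst p + 1 / 2) / snd p) ` {p. lat p})" using cL by (rule countable_image)
  then obtain r where r: "r \<notin> (\<lambda>p. - (fst p + 1 / 2) / snd p) ` {p. lat p}"
    using uncountable_UNIV_real by (metis UNIV_eq_I)
  define g where "g p = fst p + r * snd p + 1 / 2" for p :: "real \<times> real"
  have g: "affine_fun g"
    by (rule affine_funI[where a = 1 and b = r and c = "1 / 2"]) (simp add: g_def)
  have nz: "g p \<noteq> 0" if "lat p" for p
  proof (cases "snd p = 0")
    case True
    obtain m where m: "fst p = of_int m" using \<open>lat p\<close> unfolding lat_def by (blast elim: Ints_cases)
    show ?thesis
    proof
      assume "g p = 0"
      then have "real_of_int (2 * m + 1) = 0" using True m by (simp add: g_def)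
      then have "2 * m + 1 = 0" by (simp only: of_int_eq_0_iff)
      then show False by presburger
    qed
  next
    case False
    show ?thesis
    proof
      assume "g p = 0"
      then have "r = - (fst p + 1 / 2) / snd p" using False by (simp add: g_def field_simps)
      then show False using r that by blast
    qed
  qed
  have "\<exists>t. \<bar>t\<bar> < e \<and> (\<forall>p. lat p \<longrightarrow> f p + t * g p \<noteq> 0)" if "e > 0" for e
  proof -
    have "countable ((\<lambda>p. - f p / g p) ` {p. lat p})" using cL by (rule countable_image)
    moreover have "uncountable {-e<..<e}" using that by (simp add: uncountable_open_interval)
    ultimately obtain t where t: "t \<in> {-e<..<e}" "t \<notin> (\<lambda>p. - f p / g p) ` {p. lat p}"
      by (meson countable_subset subsetI)
    have "f p + t * g p \<noteq> 0" if "lat p" for p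
    proof
      assume "f p + t * g p = 0"
      then have "t = - f p / g p" using nz[OF that] by (simp add: field_simps)
      then show False using t(2) that by blast
    qed
    then show ?thesis using t(1) by (intro exI[of _ t]) auto
  qed
  then show ?thesis using that g by blast
qed

context lattice_polygon
begin

definition lrefl :: "nat \<Rightarrow> real \<times> real \<Rightarrow> real \<times> real" where
  "lrefl i d = d - (lam i d - lam i 0) *\<^sub>R nu i"

lemma refl_add: "refl i (x + d) = refl i x + lrefl i d"
  unfolding refl_def lrefl_def affine_fun_add[OF lam_affine, of i x d] by (simp add: algebra_simps)

text \<open>The billiard in affine coordinates. Lengths have no meaning there, so instead of unit
  speed the direction is only required to be nonzero.\<close>

definition corbit :: "(nat \<Rightarrow> real \<times> real) \<Rightarrow> (nat \<Rightarrow> real \<times> real) \<Rightarrow> (nat \<Rightarrow> nat) \<Rightarrow> bool" where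
  "corbit \<xi> \<delta> s \<longleftrightarrow> (\<forall>l<k. lam l (\<xi> 0) > 0) \<and> \<delta> 0 \<noteq> 0 \<and>
     (\<forall>n. (\<exists>t>0. \<xi> (Suc n) = \<xi> n + t *\<^sub>R \<delta> n) \<and>
          (\<forall>p\<in>open_segment (\<xi> n) (\<xi> (Suc n)). \<forall>l<k. lam l p > 0) \<and>
          s n < k \<and> lam (s n) (\<xi> (Suc n)) = 0 \<and> (\<forall>l<k. lam l (\<xi> (Suc n)) \<ge> 0) \<and> \<xi> (Suc n) \<notin> V \<and>
          \<delta> (Suc n) = lrefl (s n) (\<delta> n))"

lemma corbit_dir_nonzero:
  assumes "corbit \<xi> \<delta> s"
  shows "\<delta> n \<noteq> 0"
proof (induction n)
  case 0
  then show ?case using assms by (simp add: corbit_def)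
next
  case (Suc n)
  have s: "s n < k" "\<delta> (Suc n) = lrefl (s n) (\<delta> n)" using assms by (auto simp: corbit_def)
  show ?case using refl_dir(1)[OF s(1) Suc, of 0] refl_add[of "s n" 0 "\<delta> n"] s by simp
qed

lemma corbit_midpoint:
  assumes "corbit \<xi> \<delta> s"
  obtains y where "y \<in> open_segment (\<xi> n) (\<xi> (Suc n))" "\<And>l. l < k \<Longrightarrow> lam l y > 0"
    "y = (1 - 1 / 2) *\<^sub>R \<xi> n + (1 / 2) *\<^sub>R \<xi> (Suc n)"
proof -
  obtain t where t: "t > 0" "\<xi> (Suc n) = \<xi> n + t *\<^sub>R \<delta> n" using assms unfolding corbit_def by blast
  then have "\<xi> n \<noteq> \<xi> (Suc n)" using corbit_dir_nonzero[OF assms, of n] by simp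
  then have "(1 - 1 / 2) *\<^sub>R \<xi> n + (1 / 2) *\<^sub>R \<xi> (Suc n) \<in> open_segment (\<xi> n) (\<xi> (Suc n))"
    unfolding in_segment by (intro conjI exI[of _ "1 / 2 :: real"]) auto
  moreover have "\<forall>p\<in>open_segment (\<xi> n) (\<xi> (Suc n)). \<forall>l<k. lam l p > 0"
    using assms unfolding corbit_def by (elim conjE allE[of _ n])
  ultimately show ?thesis using that by blast
qed

text \<open>A hit strictly inside its side makes 0 a positive combination of the values of
  \<open>f\<close> at the ends, and the midpoint of the chord before it shows that the line is not
  that of the side. Reflecting \<open>f\<close> at the hit matches reflecting the direction.\<close>

lemma corbit_feas:
  assumes orb: "corbit \<xi> \<delta> s"
    and seg: "\<And>n. \<exists>r>0. r < 1 \<and> \<xi> (Suc n) = (1 - r) *\<^sub>R P (s n) + r *\<^sub>R P (Suc (s n))"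
  shows "affine_fun f \<Longrightarrow> f u \<noteq> 0 \<Longrightarrow> f (\<xi> m) = 0 \<Longrightarrow> f (\<xi> m + \<delta> m) = 0 \<Longrightarrow> feas f (map s [m..<m + n])"
proof (induction n arbitrary: m f u)
  case (Suc n)
  note o = orb[unfolded corbit_def, THEN conjunct2, THEN conjunct2, rule_format, of m]
  obtain t where t: "\<xi> (Suc m) = \<xi> m + t *\<^sub>R \<delta> m" using o by blast
  have i: "s m < k" and z: "lam (s m) (\<xi> (Suc m)) = 0" and d: "\<delta> (Suc m) = lrefl (s m) (\<delta> m)" using o by blast+
  have line: "f (\<xi> m + r *\<^sub>R \<delta> m) = 0" for r
    using affine_fun_line[OF Suc.prems(1), of "\<xi> m" r "\<delta> m"] affine_fun_line[OF Suc.prems(1), of "\<xi> m" 1 "\<delta> m"] Suc.prems by simp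
  have fz: "f (\<xi> (Suc m)) = 0" using line t by simp
  obtain y where y: "\<And>l. l < k \<Longrightarrow> lam l y > 0" "y = (1 - 1 / 2) *\<^sub>R \<xi> m + (1 / 2) *\<^sub>R \<xi> (Suc m)"
    using corbit_midpoint[OF orb] by metis
  have "f y = 0" unfolding y(2) affine_fun_segment[OF Suc.prems(1)] using Suc.prems fz by simp
  moreover obtain r where r: "0 < r" "r < 1" "\<xi> (Suc m) = (1 - r) *\<^sub>R P (s m) + r *\<^sub>R P (Suc (s m))"
    using seg by blast
  moreover have "(1 - r) * f (P (s m)) + r * f (P (Suc (s m))) = 0"
    using fz unfolding r(3) affine_fun_segment[OF Suc.prems(1)] .
  ultimately have sp: "sep f (s m)"
    using sep_of_weighted_zero[OF Suc.prems(1,2) i _ _ _ y(1)[OF i], of "1 - r" r] by simp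
  have "feas (\<lambda>p. f (refl (s m) p)) (map s [Suc m..<Suc m + n])"
  proof (rule Suc.IH)
    show "affine_fun (\<lambda>p. f (refl (s m) p))" using Suc.prems(1) by (rule affine_fun_refl)
    show "f (refl (s m) (refl (s m) u)) \<noteq> 0" using Suc.prems(2) i by (simp add: refl_refl)
    show "f (refl (s m) (\<xi> (Suc m))) = 0" using fz z by (simp add: refl_fix)
    have "refl (s m) (\<xi> (Suc m) + \<delta> m) = \<xi> (Suc m) + \<delta> (Suc m)" using refl_add d refl_fix[OF z] by simp
    then have "refl (s m) (\<xi> (Suc m) + \<delta> (Suc m)) = \<xi> (Suc m) + \<delta> m" using refl_refl[OF i] by metis
    moreover have "\<xi> (Suc m) + \<delta> m = \<xi> m + (t + 1) *\<^sub>R \<delta> m" using t by (simp add: scaleR_add_left)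
    ultimately show "f (refl (s m) (\<xi> (Suc m) + \<delta> (Suc m))) = 0" using line by simp
  qed
  moreover have "[m..<m + Suc n] = m # [Suc m..<Suc m + n]" by (simp add: upt_conv_Cons)
  ultimately show ?case using sp by simp
qed simp

lemma corbit_in_lang:
  assumes orb: "corbit \<xi> \<delta> s"
    and seg: "\<And>n. \<exists>r>0. r < 1 \<and> \<xi> (Suc n) = (1 - r) *\<^sub>R P (s n) + r *\<^sub>R P (Suc (s n))"
  shows "map s [m..<m + n] \<in> lang n"
proof -
  \<comment> \<open>Two successive hits on one side would place the chord between them on that side,
    although its midpoint is interior.\<close>
  have ne: "s (Suc j) \<noteq> s j" for j
  proof
    assume eq: "s (Suc j) = s j"
    obtain y where y: "\<And>l. l < k \<Longrightarrow> lam l y > 0" "y = (1 - 1 / 2) *\<^sub>R \<xi> (Suc j) + (1 / 2) *\<^sub>R \<xi> (Suc (Suc j))"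
      using corbit_midpoint[OF orb] by metis
    have z: "lam (s j) (\<xi> (Suc j)) = 0" "lam (s j) (\<xi> (Suc (Suc j))) = 0" and "s j < k"
      using orb eq unfolding corbit_def by metis+
    have "lam (s j) y = 0" unfolding y(2) affine_fun_segment[OF lam_affine] by (simp add: z)
    then show False using y(1)[OF \<open>s j < k\<close>] by simp
  qed
  have adm: "adm (map s [m..<m + n])"
    unfolding adm_def
  proof
    show "distinct_adj (map s [m..<m + n])" unfolding distinct_adj_conv_nth
    proof (intro allI impI)
      fix i assume "Suc i < length (map s [m..<m + n])"
      then show "map s [m..<m + n] ! i \<noteq> map s [m..<m + n] ! Suc i" using ne[of "m + i"] by simp
    qed
    show "set (map s [m..<m + n]) \<subseteq> {..<k}" using orb by (auto simp: corbit_def)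
  qed
  obtain f where f: "affine_fun f" "f (\<xi> m) = 0" "f (\<xi> m + \<delta> m) = 0" "\<xi> m \<noteq> \<xi> m + \<delta> m \<Longrightarrow> \<exists>u. f u \<noteq> 0"
    using affine_fun_through[of "\<xi> m" "\<xi> m + \<delta> m"] by blast
  then obtain u where "f u \<noteq> 0" using corbit_dir_nonzero[OF orb, of m] by auto
  then have "feas f (map s [m..<m + n])" using corbit_feas[OF orb seg f(1) _ f(2,3)] by blast
  then show ?thesis using adm f(1) by (auto simp: lang_def W_def)
qed

text \<open>The functions realising \<open>w\<close> form an open set, so one of them has a line
  that avoids the countably many lattice points.\<close>

lemma lang_generic:
  assumes w: "w \<in> lang n"
  obtains f where "affine_fun f" "feas f w" "\<And>p. lat p \<Longrightarrow> f p \<noteq> 0"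
proof -
  obtain f where f: "affine_fun f" "feas f w" using w by (auto simp: lang_def W_def)
  obtain g where g: "affine_fun g" "\<And>e. e > 0 \<Longrightarrow> \<exists>t. \<bar>t\<bar> < e \<and> (\<forall>p. lat p \<longrightarrow> f p + t * g p \<noteq> 0)"
    using exists_lattice_avoiding[OF f(1)] by blast
  have "\<forall>\<^sub>F e in nhds 0. feas (\<lambda>p. f p + e * g p) w" using f(2) by (rule feas_perturb)
  then obtain e where e: "e > 0" "\<And>t. \<bar>t\<bar> < e \<Longrightarrow> feas (\<lambda>p. f p + t * g p) w"
    by (auto simp: eventually_nhds_metric dist_real_def)
  obtain t where "\<bar>t\<bar> < e" "\<And>p. lat p \<Longrightarrow> f p + t * g p \<noteq> 0" using g(2)[OF e(1)] by blast
  then show ?thesis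
    using that[of "\<lambda>p. f p + t * g p"] affine_fun_lincomb[OF f(1) g(1), of 1 t] e(2) by simp
qed

text \<open>A line that avoids the lattice never hits a vertex, so it leaves every tile by a side,
  and dependent choice gives an infinite itinerary. This starts with \<open>w\<close>, because the
  function and the first side determine the word. The last conclusion is there to normalise the
  speed later.\<close>

lemma lang_corbit:
  assumes w: "w \<in> lang n" "n \<ge> 1"
  obtains \<xi> \<delta> s where "corbit \<xi> \<delta> s" "map s [0..<n] = w"
    "\<And>n. \<xi> (Suc n) \<in> open_segment (P (s n)) (P (Suc (s n)))"
    "\<And>c. c > 0 \<Longrightarrow> corbit \<xi> (\<lambda>n. c *\<^sub>R \<delta> n) s"
proof -
  have wl: "length w = n" "adm w" "w \<noteq> []" using w by (auto simp: lang_def W_def)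
  obtain f where f: "affine_fun f" "feas f w" "\<And>p. lat p \<Longrightarrow> f p \<noteq> 0" using lang_generic[OF w(1)] by blast
  have i0: "hd w < k" "sep f (hd w)" using wl f(2) by (cases w; auto simp: adm_Cons)+
  define I where "I x \<longleftrightarrow> affine_fun (fst x) \<and> (\<forall>p. lat p \<longrightarrow> fst x p \<noteq> 0) \<and> snd x < k \<and> sep (fst x) (snd x)" for x
  have ex: "\<exists>j. j < k \<and> j \<noteq> i \<and> sep g j" if "affine_fun g" "\<And>p. lat p \<Longrightarrow> g p \<noteq> 0" "i < k" "sep g i" for g i
    using sep_exit[OF that(1,4,3)] that(2) lat_V by metis
  have "\<exists>F. \<forall>n. (I (F n) \<and> (n = 0 \<longrightarrow> F n = (f, hd w))) \<and>
      (fst (F (Suc n)) = (\<lambda>p. fst (F n) (refl (snd (F n)) p)) \<and> snd (F (Suc n)) \<noteq> snd (F n))"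
  proof (rule dependent_nat_choice)
    show "\<exists>x. I x \<and> (0 = 0 \<longrightarrow> x = (f, hd w))" using f i0 by (auto simp: I_def)
    fix x and n :: nat assume "I x \<and> (n = 0 \<longrightarrow> x = (f, hd w))"
    then obtain g i where x: "x = (g, i)" "affine_fun g" "\<And>p. lat p \<Longrightarrow> g p \<noteq> 0" "i < k" "sep g i"
      by (cases x) (auto simp: I_def)
    let ?g = "\<lambda>p. g (refl i p)"
    have g': "affine_fun ?g" "\<And>p. lat p \<Longrightarrow> ?g p \<noteq> 0" "sep ?g i"
      using x affine_fun_refl lat_refl sep_refl by auto
    obtain j where "j < k" "j \<noteq> i" "sep ?g j" using ex[OF g'(1,2) x(4) g'(3)] by blast
    then show "\<exists>y. (I y \<and> (Suc n = 0 \<longrightarrow> y = (f, hd w))) \<and> fst y = (\<lambda>p. fst x (refl (snd x) p)) \<and> snd y \<noteq> snd x"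
      using g' x(1) by (intro exI[of _ "(?g, j)"]) (auto simp: I_def)
  qed
  then obtain F where F: "\<And>n. I (F n)" "F 0 = (f, hd w)"
    "\<And>n. fst (F (Suc n)) = (\<lambda>p. fst (F n) (refl (snd (F n)) p))" "\<And>n. snd (F (Suc n)) \<noteq> snd (F n)" by blast
  define h where "h n = fst (F n)" for n
  define s where "s n = snd (F n)" for n
  have h: "affine_fun (h n)" "lat p \<Longrightarrow> h n p \<noteq> 0" "s n < k" "sep (h n) (s n)" for n p
    using F(1)[of n] unfolding I_def h_def s_def by blast+
  have h0: "h 0 = f" "s 0 = hd w" using F(2) by (simp_all add: h_def s_def)
  have hS: "h (Suc n) = (\<lambda>p. h n (refl (s n) p))" "s (Suc n) \<noteq> s n" for n
    using F(3,4) by (simp_all add: h_def s_def)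
  have fe: "feas (h m) (map s [m..<m + n])" for m n
  proof (induction n arbitrary: m)
    case (Suc n)
    have "[m..<m + Suc n] = m # [Suc m..<Suc m + n]" by (simp add: upt_conv_Cons)
    then show ?case using Suc[of "Suc m"] h(4)[of m] unfolding hS(1) by simp
  qed simp
  have "map s [0..<n] = w"
  proof (rule feas_determined[OF f(1) _ f(2) _ wl(2)])
    show "feas f (map s [0..<n])" using fe[of 0 n] h0 by simp
    show "adm (map s [0..<n])" using hS(2) h(3) by (auto simp: adm_def distinct_adj_conv_nth) metis
    show "hd (map s [0..<n]) = hd w" using h0 w(2) by (simp add: hd_map upt_conv_Cons)
  qed (use wl in auto)
  \<comment> \<open>Backwards from side \<open>s 0\<close> the line meets the polygon in another
    side \<open>j0\<close>; the midpoint of this chord is the starting point.\<close>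
  obtain j0 where j0: "j0 < k" "j0 \<noteq> s 0" "sep f j0" using ex[OF f(1,3) i0] h0 by metis
  define x0 where "x0 = (1 - 1 / 2) *\<^sub>R cross f j0 + (1 / 2) *\<^sub>R cross f (s 0)"
  define \<xi> where "\<xi> n = (case n of 0 \<Rightarrow> x0 | Suc m \<Rightarrow> cross (h m) (s m))" for n
  define \<delta> where "\<delta> = rec_nat (cross (h 0) (s 0) - x0) (\<lambda>n d. lrefl (s n) d)"
  have \<xi>S: "\<xi> (Suc n) = cross (h n) (s n)" for n by (simp add: \<xi>_def)
  have \<delta>S: "\<delta> (Suc n) = lrefl (s n) (\<delta> n)" for n by (simp add: \<delta>_def)
  note cr = cross[OF h(1) h(4) h(3)]
  have cj: "f (cross f j0) = 0" "lam j0 (cross f j0) = 0" "\<And>l. l < k \<Longrightarrow> l \<noteq> j0 \<Longrightarrow> lam l (cross f j0) > 0"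
    using cross[OF f(1) j0(3,1)] by blast+
  have x0_pos: "lam l x0 > 0" if l: "l < k" for l
  proof -
    have "lam l (cross f j0) \<ge> 0" "lam l (cross f (s 0)) \<ge> 0" "lam l (cross f j0) > 0 \<or> lam l (cross f (s 0)) > 0"
      using cj(2) cj(3)[OF l] cr(2)[of 0] cr(3)[of l 0] l j0(2) h0(1)
      by (cases "l = j0"; cases "l = s 0"; force intro: less_imp_le)+
    then show ?thesis unfolding x0_def affine_fun_segment[OF lam_affine] by auto
  qed
  \<comment> \<open>\<open>h n\<close> vanishes along the current flight, and
    \<open>lam (s n)\<close> decreases along it, which makes the time to the next hit
    positive.\<close>
  have inv: "h n (\<xi> n) = 0 \<and> h n (\<xi> n + \<delta> n) = 0 \<and> \<delta> n \<noteq> 0 \<and> lam (s n) (\<xi> n) > 0 \<and>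
      lam (s n) (\<xi> n + \<delta> n) < lam (s n) (\<xi> n) \<and> (\<exists>t>0. \<xi> (Suc n) = \<xi> n + t *\<^sub>R \<delta> n)" for n
  proof (induction n)
    case 0
    have d: "x0 + \<delta> 0 = cross f (s 0)" by (simp add: \<delta>_def h0)
    have z: "lam (s 0) (cross f (s 0)) = 0" "f (cross f (s 0)) = 0" using cr(1,2)[of 0] h0 by simp_all
    have "f x0 = 0" unfolding x0_def affine_fun_segment[OF f(1)] using cj(1) z(2) by simp
    moreover have "lam (s 0) x0 > 0" using x0_pos h(3) by blast
    moreover have "\<delta> 0 \<noteq> 0"
    proof
      assume "\<delta> 0 = 0"
      then have "x0 = cross f (s 0)" using d by simp
      then show False using \<open>lam (s 0) x0 > 0\<close> z(1) by simp
    qed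
    moreover have "\<xi> (Suc 0) = \<xi> 0 + 1 *\<^sub>R \<delta> 0" using d \<xi>S[of 0] h0 by (simp add: \<xi>_def)
    ultimately show ?case using d z h0 by (auto simp: \<xi>_def intro!: exI[of _ "1::real"])
  next
    case (Suc n)
    let ?z = "\<xi> (Suc n)"
    have z: "lam (s n) ?z = 0" "h n ?z = 0" and zp: "\<And>l. l < k \<Longrightarrow> l \<noteq> s n \<Longrightarrow> lam l ?z > 0"
      unfolding \<xi>S using cr by blast+
    obtain t where t: "\<xi> (Suc n) = \<xi> n + t *\<^sub>R \<delta> n" using Suc by blast
    have line: "h n (\<xi> n + r *\<^sub>R \<delta> n) = 0" for r
      using affine_fun_line[OF h(1), of n "\<xi> n" r "\<delta> n"] affine_fun_line[OF h(1), of n "\<xi> n" 1 "\<delta> n"] Suc by simp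
    have rz: "refl (s n) (?z + \<delta> n) = ?z + \<delta> (Suc n)" using refl_add \<delta>S refl_fix[OF z(1)] by simp
    then have "refl (s n) (?z + \<delta> (Suc n)) = ?z + \<delta> n" using refl_refl[OF h(3)] by metis
    moreover have "?z + \<delta> n = \<xi> n + (t + 1) *\<^sub>R \<delta> n" using t by (simp add: scaleR_add_left)
    ultimately have 2: "h (Suc n) (?z + \<delta> (Suc n)) = 0" using line by (simp add: hS)
    have 1: "h (Suc n) ?z = 0" using z by (simp add: hS refl_fix)
    have dz: "refl (s n) (?z + \<delta> n) - refl (s n) ?z = \<delta> (Suc n)" using rz refl_fix[OF z(1)] by simp
    have 3: "\<delta> (Suc n) \<noteq> 0" using refl_dir(1)[OF h(3), of "\<delta> n" n ?z] Suc dz by simp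
    have "lam (s n) (\<xi> n + \<delta> n) - lam (s n) (\<xi> n) = lam (s n) (?z + \<delta> n) - lam (s n) ?z"
      using affine_fun_add[OF lam_affine, of "s n" _ "\<delta> n"] by simp
    then have up: "lam (s n) (?z + \<delta> (Suc n)) > lam (s n) ?z"
      using refl_dir(2)[OF h(3), of n ?z "\<delta> n"] Suc refl_fix[OF z(1)] unfolding dz by simp
    have 4: "lam (s (Suc n)) ?z > 0" using zp h(3) hS(2) by blast
    \<comment> \<open>Time is restarted at the hit, so the crossing required by
      \<open>ray_turn\<close> is at \<open>t = 0\<close>.\<close>
    have 5: "lam (s (Suc n)) (?z + \<delta> (Suc n)) < lam (s (Suc n)) ?z"
      by (rule ray_turn[where t = 0, OF h(1,4,3) _ h(1,4) 1 2 3 h(3) hS(2) up]) (simp add: \<xi>S)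
    let ?z' = "\<xi> (Suc (Suc n))"
    have z': "lam (s (Suc n)) ?z' = 0" "h (Suc n) ?z' = 0" unfolding \<xi>S using cr by blast+
    have "h (Suc n) (P (s (Suc n))) \<noteq> h (Suc n) (P (Suc (s (Suc n))))"
      using h(4)[of "Suc n"] by (auto simp: sep_def mult_less_0_iff)
    then obtain r where r: "?z' = ?z + r *\<^sub>R \<delta> (Suc n)"
      using affine_fun_kernel_line[OF h(1) _ 3 1 2 z'(2)] by blast
    have "lam (s (Suc n)) ?z' = lam (s (Suc n)) ?z + r * (lam (s (Suc n)) (?z + \<delta> (Suc n)) - lam (s (Suc n)) ?z)"
      unfolding r using affine_fun_line[OF lam_affine, of "s (Suc n)" ?z r "\<delta> (Suc n)"]
        affine_fun_line[OF lam_affine, of "s (Suc n)" ?z 1 "\<delta> (Suc n)"] by simp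
    then have "r * (lam (s (Suc n)) (?z + \<delta> (Suc n)) - lam (s (Suc n)) ?z) < 0" using z'(1) 4 by simp
    then have "r > 0" using 5 by (simp add: mult_less_0_iff)
    then show ?case using 1 2 3 4 5 r by blast
  qed
  have nn: "lam l (\<xi> n) \<ge> 0" if "l < k" for l n
  proof (cases n)
    case 0
    then show ?thesis using x0_pos[OF that] by (simp add: \<xi>_def)
  next
    case (Suc m)
    then show ?thesis using cr(2)[of m] cr(3)[OF that, of m] by (cases "l = s m") (auto simp: \<xi>S)
  qed
  have seg: "lam l p > 0" if p: "p \<in> open_segment (\<xi> n) (\<xi> (Suc n))" and l: "l < k" for l p n
  proof -
    obtain r where r: "0 < r" "r < 1" "p = (1 - r) *\<^sub>R \<xi> n + r *\<^sub>R \<xi> (Suc n)"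
      using p by (auto simp: in_segment)
    have "lam l (\<xi> n) > 0 \<or> lam l (\<xi> (Suc n)) > 0"
      using inv[of n] cr(3)[OF l, of n] by (cases "l = s n") (auto simp: \<xi>S)
    then show ?thesis unfolding r(3) affine_fun_segment[OF lam_affine]
      using r(1,2) nn[OF l, of n] nn[OF l, of "Suc n"] by (auto intro: add_pos_nonneg add_nonneg_pos)
  qed
  have nV: "\<xi> (Suc n) \<notin> V" for n
  proof -
    have "\<not> lat (\<xi> (Suc n))" unfolding \<xi>S
      by (rule not_lat[of "s n"]) (use cr(2)[of n] cr(3)[of _ n] in auto)
    then show ?thesis using lat_V by blast
  qed
  have orb: "corbit \<xi> (\<lambda>n. c *\<^sub>R \<delta> n) s" if c: "c > 0" for c
  proof -
    have lr: "lrefl i (c *\<^sub>R d) = c *\<^sub>R lrefl i d" for i d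
    proof -
      have e: "lam i (c *\<^sub>R d) - lam i 0 = c * (lam i d - lam i 0)"
        using affine_fun_line[OF lam_affine, of i 0 c d] by simp
      show ?thesis unfolding lrefl_def e by (simp add: scaleR_diff_right)
    qed
    have "\<exists>t>0. \<xi> (Suc n) = \<xi> n + t *\<^sub>R (c *\<^sub>R \<delta> n)" for n
    proof -
      obtain t where "t > 0" "\<xi> (Suc n) = \<xi> n + t *\<^sub>R \<delta> n" using inv by blast
      then show ?thesis using c by (intro exI[of _ "t / c"]) simp
    qed
    moreover have "c *\<^sub>R \<delta> 0 \<noteq> 0" using inv[of 0] c by simp
    moreover have "\<forall>l<k. lam l (\<xi> 0) > 0" using x0_pos by (simp add: \<xi>_def)
    ultimately show ?thesis
      unfolding corbit_def using seg h(3) cr(2)[folded \<xi>S] nn nV \<delta>S lr by simp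
  qed
  show ?thesis
  proof (rule that)
    show "corbit \<xi> \<delta> s" using orb[of 1] by simp
    show "map s [0..<n] = w" by fact
    show "\<xi> (Suc n) \<in> open_segment (P (s n)) (P (Suc (s n)))" for n unfolding \<xi>S by (rule cr(4))
  qed (rule orb)
qed

end

text \<open>
  The point with coordinates \<open>(a, b)\<close> is \<open>orig + a u + b v\<close>.  All of the Euclidean structure that matters
  is \<open>orth\<close>: it makes \<open>refl i\<close> the orthogonal reflection in side \<open>i\<close>.
\<close>

locale billiard_coordinates = lattice_polygon +
  fixes orig u v :: "real^2"
  assumes det: "u $ 1 * v $ 2 - u $ 2 * v $ 1 \<noteq> 0"
    and orth: "i < k \<Longrightarrow> (fst (nu i) *\<^sub>R u + snd (nu i) *\<^sub>R v) \<bullet>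
      (fst (P (Suc i) - P i) *\<^sub>R u + snd (P (Suc i) - P i) *\<^sub>R v) = 0"
    and hull: "(\<And>i. i < k \<Longrightarrow> lam i p \<ge> 0) \<Longrightarrow> p \<in> convex hull V"
begin

section \<open>The Euclidean polygon, its sides and its reflections in coordinates\<close>

definition L :: "real \<times> real \<Rightarrow> real^2" where
  "L p = fst p *\<^sub>R u + snd p *\<^sub>R v"

text \<open>The inverse of \<open>L\<close>, by Cramer's rule.\<close>

definition G :: "real^2 \<Rightarrow> real \<times> real" where
  "G d = ((d $ 1 * v $ 2 - d $ 2 * v $ 1) / (u $ 1 * v $ 2 - u $ 2 * v $ 1),
          (u $ 1 * d $ 2 - u $ 2 * d $ 1) / (u $ 1 * v $ 2 - u $ 2 * v $ 1))"

definition emb :: "real \<times> real \<Rightarrow> real^2" where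
  "emb p = orig + L p"

definition crd :: "real^2 \<Rightarrow> real \<times> real" where
  "crd x = G (x - orig)"

definition Q :: "(real^2) set" where
  "Q = convex hull (emb ` V)"

definition S :: "nat \<Rightarrow> (real^2) set" where
  "S i = closed_segment (emb (P i)) (emb (P (Suc i)))"

lemma linear_L: "linear L"
  by (rule linearI) (simp_all add: L_def algebra_simps)

lemma linear_G: "linear G"
  by (rule linearI) (simp_all add: G_def algebra_simps diff_divide_distrib add_divide_distrib)

lemma G_L: "G (L p) = p"
proof (cases p)
  case (Pair a b)
  let ?D = "u $ 1 * v $ 2 - u $ 2 * v $ 1"
  have "(a * u $ 1 + b * v $ 1) * v $ 2 - (a * u $ 2 + b * v $ 2) * v $ 1 = a * ?D"
    "u $ 1 * (a * u $ 2 + b * v $ 2) - u $ 2 * (a * u $ 1 + b * v $ 1) = b * ?D"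
    by (simp_all add: algebra_simps)
  then show ?thesis using det Pair by (simp add: G_def L_def)
qed

lemma L_G: "L (G d) = d"
proof -
  let ?D = "u $ 1 * v $ 2 - u $ 2 * v $ 1"
  have "(d $ 1 * v $ 2 - d $ 2 * v $ 1) * u $ j + (u $ 1 * d $ 2 - u $ 2 * d $ 1) * v $ j = d $ j * ?D" if "j = 1 \<or> j = 2" for j
    using that by (auto simp: algebra_simps)
  then have "((d $ 1 * v $ 2 - d $ 2 * v $ 1) / ?D) * u $ j + ((u $ 1 * d $ 2 - u $ 2 * d $ 1) / ?D) * v $ j = d $ j"
    if "j = 1 \<or> j = 2" for j
    using that det by (simp add: add_divide_distrib[symmetric])
  then show ?thesis by (simp add: L_def G_def vec_eq_iff forall_2)
qed

lemma crd_emb: "crd (emb p) = p"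
  by (simp add: crd_def emb_def G_L)

lemma emb_crd: "emb (crd x) = x"
  by (simp add: crd_def emb_def L_G)

lemma crd_add: "crd (x + d) = crd x + G d"
proof -
  have "x + d - orig = (x - orig) + d" by simp
  then show ?thesis unfolding crd_def by (simp only: linear_add[OF linear_G])
qed

lemma emb_segment: "emb ((1 - t) *\<^sub>R p + t *\<^sub>R q) = (1 - t) *\<^sub>R emb p + t *\<^sub>R emb q"
  unfolding emb_def linear_add[OF linear_L] linear_scale[OF linear_L] by (simp add: algebra_simps)

lemma crd_segment: "crd ((1 - t) *\<^sub>R x + t *\<^sub>R y) = (1 - t) *\<^sub>R crd x + t *\<^sub>R crd y"
  by (metis crd_emb emb_crd emb_segment)

lemma emb_eq_iff: "emb p = emb q \<longleftrightarrow> p = q"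
  by (metis crd_emb)

lemma crd_eq_iff: "crd x = crd y \<longleftrightarrow> x = y"
  by (metis emb_crd)

lemma mem_open_segment: "x \<in> open_segment a b \<longleftrightarrow> crd x \<in> open_segment (crd a) (crd b)"
  unfolding in_segment by (metis crd_emb emb_crd crd_segment)

lemma mem_closed_segment: "x \<in> closed_segment a b \<longleftrightarrow> crd x \<in> closed_segment (crd a) (crd b)"
  unfolding in_segment by (metis crd_emb emb_crd crd_segment)

lemma continuous_lam_crd: "continuous_on UNIV (\<lambda>x. lam i (crd x))"
proof -
  obtain a b c where l: "\<And>x y. lam i (x, y) = a * x + b * y + c"
    using lam_affine[of i] unfolding affine_fun_def by blast
  have *: "(\<lambda>x. lam i (crd x)) = (\<lambda>x. a * fst (crd x) + b * snd (crd x) + c)"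
  proof
    fix x show "lam i (crd x) = a * fst (crd x) + b * snd (crd x) + c" using l[of "fst (crd x)" "snd (crd x)"] by simp
  qed
  have "continuous_on UNIV (\<lambda>x. a * fst (crd x) + b * snd (crd x) + c)"
    unfolding crd_def G_def fst_conv snd_conv using det by (intro continuous_intros) auto
  then show ?thesis unfolding * .
qed

lemma mem_Q: "x \<in> Q \<longleftrightarrow> (\<forall>i<k. lam i (crd x) \<ge> 0)"
proof
  assume "x \<in> Q"
  moreover have "Q \<subseteq> {x. \<forall>i<k. lam i (crd x) \<ge> 0}"
    unfolding Q_def
  proof (rule hull_minimal)
    show "emb ` V \<subseteq> {x. \<forall>i<k. lam i (crd x) \<ge> 0}" by (auto simp: crd_emb lam_nonneg)
    show "convex {x. \<forall>i<k. lam i (crd x) \<ge> 0}"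
      unfolding convex_alt by (auto simp: crd_segment affine_fun_segment[OF lam_affine])
  qed
  ultimately show "\<forall>i<k. lam i (crd x) \<ge> 0" by blast
next
  assume "\<forall>i<k. lam i (crd x) \<ge> 0"
  then have "crd x \<in> convex hull V" using hull by blast
  then have "x \<in> emb ` (convex hull V)" using emb_crd by (metis image_eqI)
  also have "emb ` (convex hull V) = (\<lambda>y. orig + y) ` (L ` (convex hull V))"
    by (simp add: image_image emb_def)
  also have "\<dots> = convex hull ((\<lambda>y. orig + y) ` (L ` V))"
    by (simp only: convex_hull_linear_image[OF linear_L] convex_hull_translation)
  also have "\<dots> = Q" by (simp add: Q_def image_image emb_def)
  finally show "x \<in> Q" .
qed

lemma convex_Q: "convex Q"
  by (simp add: Q_def)

lemma interior_Q: "interior Q = {x. \<forall>i<k. lam i (crd x) > 0}"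
proof
  have "open {x. \<forall>i<k. lam i (crd x) > 0}"
  proof -
    have "{x. \<forall>i<k. lam i (crd x) > 0} = (\<Inter>i\<in>{..<k}. {x. lam i (crd x) > 0})" by auto
    moreover have "open {x. lam i (crd x) > 0}" for i
      using open_Collect_less[of "\<lambda>x. 0" "\<lambda>x. lam i (crd x)"] continuous_lam_crd by simp
    ultimately show ?thesis by (simp add: open_INT)
  qed
  then show "{x. \<forall>i<k. lam i (crd x) > 0} \<subseteq> interior Q"
    by (intro interior_maximal) (use mem_Q less_imp_le in blast)+
  show "interior Q \<subseteq> {x. \<forall>i<k. lam i (crd x) > 0}"
  proof (intro subsetI CollectI allI impI)
    fix x i assume x: "x \<in> interior Q" and i: "i < k"
    then obtain e where e: "e > 0" "ball x e \<subseteq> Q" by (auto simp: mem_interior)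
    \<comment> \<open>Short enough to stay in the ball while \<open>lam i\<close> drops by
      \<open>2 * t\<close>; the summand 1 keeps the denominator positive.\<close>
    define t where "t = e / (2 * (norm (L (nu i)) + 1))"
    have t: "t > 0" using e by (auto simp: t_def add_nonneg_pos)
    have "norm (L (nu i)) < norm (L (nu i)) + 1" by simp
    then have "t * norm (L (nu i)) \<le> t * (norm (L (nu i)) + 1)" using t by simp
    also have "\<dots> = e / 2"
    proof -
      have "norm (L (nu i)) + 1 > 0" by (simp add: add_nonneg_pos)
      then show ?thesis unfolding t_def by (simp add: field_simps)
    qed
    finally have "x + (- t) *\<^sub>R L (nu i) \<in> ball x e" using t e(1) by (simp add: dist_norm)
    then have "x + (- t) *\<^sub>R L (nu i) \<in> Q" using e by blast
    moreover have "crd (x + (- t) *\<^sub>R L (nu i)) = crd x + (- t) *\<^sub>R nu i"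
      by (simp only: crd_add linear_scale[OF linear_G] G_L)
    ultimately have "lam i (crd x + (- t) *\<^sub>R nu i) \<ge> 0"
      using i unfolding mem_Q by metis
    then have "lam i (crd x) - 2 * t \<ge> 0"
      unfolding affine_fun_line[OF lam_affine] using lam_nu[OF i] by (simp add: mult.commute)
    then show "lam i (crd x) > 0" using t by linarith
  qed
qed

lemma side_face:
  assumes i: "i < k"
  shows "{y \<in> Q. lam i (crd y) = 0} face_of Q"
  unfolding face_of_def
proof (intro conjI ballI impI)
  have "convex {y. lam i (crd y) = 0}"
    unfolding convex_alt by (auto simp: crd_segment affine_fun_segment[OF lam_affine])
  then have "convex (Q \<inter> {y. lam i (crd y) = 0})" by (rule convex_Int[OF convex_Q])
  moreover have "Q \<inter> {y. lam i (crd y) = 0} = {y \<in> Q. lam i (crd y) = 0}" by blast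
  ultimately show "convex {y \<in> Q. lam i (crd y) = 0}" by simp
  fix a b y assume a: "a \<in> Q" and b: "b \<in> Q" and y: "y \<in> {y \<in> Q. lam i (crd y) = 0}" "y \<in> open_segment a b"
  obtain t where t: "0 < t" "t < 1" "y = (1 - t) *\<^sub>R a + t *\<^sub>R b" using y by (auto simp: in_segment)
  have nn: "lam i (crd a) \<ge> 0" "lam i (crd b) \<ge> 0" using a b i mem_Q by blast+
  have "lam i (crd y) = 0" using y by blast
  then have "(1 - t) * lam i (crd a) + t * lam i (crd b) = 0"
    unfolding t(3) by (simp only: crd_segment affine_fun_segment[OF lam_affine])
  then have "(1 - t) * lam i (crd a) = 0" "t * lam i (crd b) = 0"
    using nn t by (simp_all add: add_nonneg_eq_0_iff)
  then show "a \<in> {y \<in> Q. lam i (crd y) = 0}" "b \<in> {y \<in> Q. lam i (crd y) = 0}" using t a b by auto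
qed blast

text \<open>The points of \<open>Q\<close> on the line form a face, and a face of the hull of
  finitely many points is the hull of some of them. By \<open>lam_V_zero\<close> only the ends of
  side \<open>i\<close> can occur.\<close>

lemma mem_S_iff:
  assumes "i < k"
  shows "x \<in> S i \<longleftrightarrow> x \<in> Q \<and> lam i (crd x) = 0"
proof
  assume x: "x \<in> S i"
  have "S i \<subseteq> Q" unfolding S_def using P_in_V
    by (intro closed_segment_subset convex_Q) (auto simp: Q_def intro: hull_inc)
  moreover obtain t where "crd x = (1 - t) *\<^sub>R P i + t *\<^sub>R P (Suc i)"
    using x unfolding S_def mem_closed_segment crd_emb by (auto simp: in_segment)
  then have "lam i (crd x) = 0" by (simp only: affine_fun_segment[OF lam_affine] lam_edge[OF assms])
  ultimately show "x \<in> Q \<and> lam i (crd x) = 0" using x by blast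
next
  assume x: "x \<in> Q \<and> lam i (crd x) = 0"
  note face = side_face[OF assms, unfolded Q_def]
  obtain T where T: "T \<subseteq> emb ` V" "{y \<in> Q. lam i (crd y) = 0} = convex hull T"
    using face_of_convex_hull_subset[OF finite_imp_compact face] finite_V unfolding Q_def by blast
  have "T \<subseteq> {emb (P i), emb (P (Suc i))}"
  proof
    fix y assume y: "y \<in> T"
    then obtain q where q: "q \<in> V" "y = emb q" using T by blast
    have "y \<in> {y \<in> Q. lam i (crd y) = 0}" unfolding T(2) using y by (rule hull_inc)
    then have "lam i q = 0" using q by (simp add: crd_emb)
    then show "y \<in> {emb (P i), emb (P (Suc i))}" using lam_V_zero[OF assms q(1)] q(2) by blast
  qed
  then have "convex hull T \<subseteq> S i" unfolding S_def segment_convex_hull by (rule hull_mono)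
  then show "x \<in> S i" using x T(2) by blast
qed

lemma S_face:
  assumes "i < k"
  shows "S i face_of Q"
proof -
  have "S i = {y \<in> Q. lam i (crd y) = 0}" using mem_S_iff[OF assms] by blast
  then show ?thesis using side_face[OF assms] by simp
qed

lemma S_aff_dim: "aff_dim (S i) = 1"
  unfolding S_def segment_convex_hull aff_dim_convex_hull using P_Suc_neq[of i] by (simp add: emb_eq_iff)

lemma S_inj: "inj_on S {..<k}"
proof (rule inj_onI)
  fix i j assume ij: "i \<in> {..<k}" "j \<in> {..<k}" "S i = S j"
  show "i = j"
  proof (rule ccontr)
    assume "i \<noteq> j"
    have "emb (P j) \<in> S j" "emb (P (Suc j)) \<in> S j" by (simp_all add: S_def)
    then have "lam i (P j) = 0" "lam i (P (Suc j)) = 0" using mem_S_iff[of i] ij by (auto simp: crd_emb)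
    then show False using lam_edge_other(3)[of i j] ij \<open>i \<noteq> j\<close> by auto
  qed
qed

text \<open>An edge contains two vertices, and their midpoint cannot be interior, since the edge
  would then be all of \<open>Q\<close>, of dimension 2. So some \<open>lam l\<close> vanishes at
  the midpoint, hence at both vertices, and the edge contains \<open>S l\<close>; equal dimension
  forces equality.\<close>

lemma sides_Q: "sides Q = S ` {..<k}"
proof (intro equalityI subsetI)
  fix e assume "e \<in> S ` {..<k}"
  then show "e \<in> sides Q" using S_face S_aff_dim by (auto simp: sides_def edge_of_def)
next
  fix e assume "e \<in> sides Q"
  then have e: "e face_of Q" "aff_dim e = 1" by (auto simp: sides_def edge_of_def)
  obtain T where T: "T \<subseteq> emb ` V" "e = convex hull T"
    using face_of_convex_hull_subset[OF finite_imp_compact e(1)[unfolded Q_def]] finite_V by blast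
  have aT: "aff_dim T = 1" using e(2) T(2) by (simp add: aff_dim_convex_hull)
  then have "T \<noteq> {}" by auto
  then obtain a where a: "a \<in> T" by blast
  have "T \<noteq> {a}" using aT by auto
  then obtain b where b: "b \<in> T" "b \<noteq> a" using a by blast
  have ab: "a \<in> e" "b \<in> e" using a b hull_subset[of T convex] T(2) by blast+
  define y where "y = (1 - 1 / 2) *\<^sub>R a + (1 / 2) *\<^sub>R b"
  have "y \<in> closed_segment a b" unfolding in_segment y_def by (intro exI[of _ "1 / 2 :: real"]) auto
  then have ye: "y \<in> e" using ab closed_segment_subset[of a e b] T(2) convex_convex_hull by blast
  have eQ: "e \<subseteq> Q" using e(1) by (rule face_of_imp_subset)
  have "\<exists>l<k. lam l (crd y) = 0"
  proof (rule ccontr)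
    assume "\<not> ?thesis"
    moreover have "lam l (crd y) \<ge> 0" if "l < k" for l using ye eQ mem_Q that by blast
    ultimately have yi: "y \<in> interior Q" unfolding interior_Q by (auto simp: order_less_le)
    then have "e = Q" using face_of_disjoint_interior[OF e(1)] ye by blast
    moreover have "aff_dim Q = DIM(real^2)" by (rule aff_dim_nonempty_interior) (use yi in blast)
    ultimately show False using e(2) by simp
  qed
  then obtain l where l: "l < k" "lam l (crd y) = 0" by blast
  have nn: "lam l (crd a) \<ge> 0" "lam l (crd b) \<ge> 0" using ab eQ l mem_Q by blast+
  have "lam l (crd y) = (1 - 1 / 2) * lam l (crd a) + 1 / 2 * lam l (crd b)"
    unfolding y_def crd_segment affine_fun_segment[OF lam_affine] ..
  then have z: "lam l (crd a) = 0" "lam l (crd b) = 0" using nn l(2) by auto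
  have vtx: "c = emb (P l) \<or> c = emb (P (Suc l))" if "c \<in> T" "lam l (crd c) = 0" for c
  proof -
    obtain q where "q \<in> V" "c = emb q" using \<open>c \<in> T\<close> T by blast
    then show ?thesis using lam_V_zero[OF l(1), of q] \<open>lam l (crd c) = 0\<close> by (auto simp: crd_emb)
  qed
  have "closed_segment a b = S l"
    using vtx[OF a z(1)] vtx[OF b(1) z(2)] b(2) by (auto simp: S_def closed_segment_commute)
  then have sub: "S l \<subseteq> e" using ab T(2) closed_segment_subset convex_convex_hull by metis
  have "S l face_of e" using face_of_subset[OF S_face[OF l(1)] sub eQ] .
  then have "S l = e"
    using face_of_aff_dim_lt[of e "S l"] e(2) S_aff_dim[of l] T(2) convex_convex_hull by fastforce
  then show "e \<in> S ` {..<k}" using l by blast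
qed

text \<open>A vertex lies on two sides, both of them faces. A segment of \<open>Q\<close> through it
  has its ends on both sides, which have only this point in common.\<close>

lemma extreme_point_Q: "x extreme_point_of Q \<longleftrightarrow> crd x \<in> V"
proof
  assume "x extreme_point_of Q"
  then have "x \<in> emb ` V" unfolding Q_def by (rule extreme_point_of_convex_hull)
  then show "crd x \<in> V" by (auto simp: crd_emb)
next
  assume q: "crd x \<in> V"
  obtain i j where ij: "i < k" "j < k" "i \<noteq> j" "lam i (crd x) = 0" "lam j (crd x) = 0"
    using V_two_edges[OF q] by blast
  have uniq: "y = x" if y: "y \<in> S i" "y \<in> S j" for y
  proof -
    have x: "x \<in> S i" using mem_S_iff[OF ij(1)] ij q by (simp add: mem_Q lam_nonneg)
    obtain s where s: "0 \<le> s" "s \<le> 1" "crd x = (1 - s) *\<^sub>R P i + s *\<^sub>R P (Suc i)"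
      using x unfolding S_def mem_closed_segment crd_emb by (auto simp: in_segment)
    obtain t where t: "0 \<le> t" "t \<le> 1" "crd y = (1 - t) *\<^sub>R P i + t *\<^sub>R P (Suc i)"
      using y unfolding S_def mem_closed_segment crd_emb by (auto simp: in_segment)
    have "lam j (crd y) = 0" using y mem_S_iff ij by blast
    then have e: "(1 - s) * lam j (P i) + s * lam j (P (Suc i)) = 0" "(1 - t) * lam j (P i) + t * lam j (P (Suc i)) = 0"
      using ij(5) by (simp_all only: s(3) t(3) affine_fun_segment[OF lam_affine])
    have o: "lam j (P i) \<ge> 0" "lam j (P (Suc i)) \<ge> 0" "lam j (P i) > 0 \<or> lam j (P (Suc i)) > 0"
      using lam_edge_other[of j i] ij by auto
    have "(s - t) * (lam j (P (Suc i)) - lam j (P i)) = 0" using e by (simp add: algebra_simps)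
    moreover have "lam j (P (Suc i)) \<noteq> lam j (P i)" using e(1) o by (auto simp: algebra_simps)
    ultimately have "crd y = crd x" unfolding s(3) t(3) by simp
    then show ?thesis using emb_crd by metis
  qed
  show "x extreme_point_of Q"
    unfolding extreme_point_of_def
  proof (intro conjI ballI notI)
    show xQ: "x \<in> Q" using q by (simp add: mem_Q lam_nonneg)
    fix a b assume ab: "a \<in> Q" "b \<in> Q" "x \<in> open_segment a b"
    have x: "x \<in> S i" "x \<in> S j" using xQ ij mem_S_iff by blast+
    have "a \<in> S i" "b \<in> S i" using S_face[OF ij(1)] ab x unfolding face_of_def by blast+
    moreover have "a \<in> S j" "b \<in> S j" using S_face[OF ij(2)] ab x unfolding face_of_def by blast+
    ultimately have "a = x" "b = x" using uniq by blast+
    then show False using ab(3) by (simp add: open_segment_def)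
  qed
qed

text \<open>By \<open>orth\<close>, \<open>L (nu i)\<close> is a normal of the side, and in the
  plane every other normal is a multiple of it. The Euclidean formula therefore subtracts the
  increment of \<open>lam i\<close> times this normal, as \<open>lrefl\<close> does.\<close>

lemma reflects_S:
  assumes i: "i < k"
  shows "reflects (S i) d d' \<longleftrightarrow> G d' = lrefl i (G d)"
proof -
  define e where "e = P (Suc i) - P i"
  define m where "m = L (nu i)"
  have e0: "e \<noteq> 0" using P_Suc_neq[of i] by (simp add: e_def)
  have orth': "m \<bullet> L e = 0" using orth[OF i] by (simp add: m_def e_def L_def)
  have "nu i \<noteq> 0" using lam_nu[OF i] by auto
  then have m0: "m \<noteq> 0" using G_L[of "nu i"] linear_0[OF linear_G] by (auto simp: m_def)
  \<comment> \<open>Since \<open>lam i\<close> grows by 2 along \<open>nu i\<close>, half of its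
    increment is the coefficient of \<open>nu i\<close>; the remainder is parallel to the
    side.\<close>
  have dec: "\<exists>t. y = ((lam i y - lam i 0) / 2) *\<^sub>R nu i + t *\<^sub>R e" for y
  proof -
    let ?b = "(lam i y - lam i 0) / 2"
    have "lam i (P i + (y + (- ?b) *\<^sub>R nu i)) = lam i (P i) + ((lam i y - lam i 0) + (- ?b) * (lam i (nu i) - lam i 0))"
      using affine_fun_add[OF lam_affine, of i "P i" "y + (- ?b) *\<^sub>R nu i"] affine_fun_line[OF lam_affine, of i y "- ?b" "nu i"] by simp
    then have z: "lam i (P i + (y + (- ?b) *\<^sub>R nu i)) = 0" using lam_edge[OF i] lam_nu[OF i] by simp
    have "lam i (nu i) \<noteq> lam i 0" using lam_nu[OF i] by auto
    moreover have "lam i (P i + e) = 0" using lam_edge[OF i] by (simp add: e_def)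
    ultimately obtain t where "P i + (y + (- ?b) *\<^sub>R nu i) = P i + t *\<^sub>R e"
      using affine_fun_kernel_line[OF lam_affine _ e0 lam_edge(1)[OF i] _ z] by blast
    then show ?thesis by (intro exI[of _ t]) (simp add: algebra_simps)
  qed
  have formula: "d - (2 * (d \<bullet> m) / (m \<bullet> m)) *\<^sub>R m = L (lrefl i (G d))"
  proof -
    obtain t where t: "G d = ((lam i (G d) - lam i 0) / 2) *\<^sub>R nu i + t *\<^sub>R e" using dec by blast
    have "d = L (G d)" by (simp add: L_G)
    also have "\<dots> = ((lam i (G d) - lam i 0) / 2) *\<^sub>R m + t *\<^sub>R L e"
      by (subst t) (simp only: linear_add[OF linear_L] linear_scale[OF linear_L] m_def)
    finally have "d \<bullet> m = (((lam i (G d) - lam i 0) / 2) *\<^sub>R m + t *\<^sub>R L e) \<bullet> m"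
      by (rule arg_cong[of _ _ "\<lambda>y. y \<bullet> m"])
    then have "d \<bullet> m = ((lam i (G d) - lam i 0) / 2) * (m \<bullet> m)"
      using orth' inner_commute[of m "L e"] by (simp add: inner_add_left)
    moreover have "m \<bullet> m \<noteq> 0" using m0 by simp
    ultimately have "2 * (d \<bullet> m) / (m \<bullet> m) = lam i (G d) - lam i 0" by (simp only: nonzero_divide_eq_eq) simp
    moreover have "L (lrefl i (G d)) = d - (lam i (G d) - lam i 0) *\<^sub>R m"
      unfolding lrefl_def linear_diff[OF linear_L] linear_scale[OF linear_L] L_G m_def ..
    ultimately show ?thesis by simp
  qed
  have S_diff: "\<exists>t. x - y = t *\<^sub>R L e" if "x \<in> S i" "y \<in> S i" for x y
  proof -
    obtain s where s: "x = (1 - s) *\<^sub>R emb (P i) + s *\<^sub>R emb (P (Suc i))" using \<open>x \<in> S i\<close> by (auto simp: S_def in_segment)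
    obtain t where t: "y = (1 - t) *\<^sub>R emb (P i) + t *\<^sub>R emb (P (Suc i))" using \<open>y \<in> S i\<close> by (auto simp: S_def in_segment)
    have e1: "emb (P (Suc i)) = emb (P i) + L e" by (simp add: e_def emb_def linear_diff[OF linear_L])
    have "x - y = (s - t) *\<^sub>R L e" unfolding s t e1 by (simp add: algebra_simps)
    then show ?thesis by blast
  qed
  show ?thesis
  proof
    assume "reflects (S i) d d'"
    then obtain n where n: "n \<noteq> 0" "\<forall>x\<in>S i. \<forall>y\<in>S i. orthogonal n (x - y)" "d' = d - (2 * (d \<bullet> n) / (n \<bullet> n)) *\<^sub>R n"
      unfolding reflects_def by blast
    have "n \<bullet> L e = 0"
    proof -
      have "emb (P (Suc i)) \<in> S i" "emb (P i) \<in> S i" by (simp_all add: S_def)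
      then have "orthogonal n (emb (P (Suc i)) - emb (P i))" using n by blast
      then show ?thesis by (simp add: orthogonal_def e_def emb_def linear_diff[OF linear_L])
    qed
    obtain t where t: "G n = ((lam i (G n) - lam i 0) / 2) *\<^sub>R nu i + t *\<^sub>R e" using dec by blast
    define b where "b = (lam i (G n) - lam i 0) / 2"
    have "L (G n) = b *\<^sub>R m + t *\<^sub>R L e"
      by (subst t) (simp only: linear_add[OF linear_L] linear_scale[OF linear_L] m_def b_def)
    then have nb: "n = b *\<^sub>R m + t *\<^sub>R L e" by (simp add: L_G)
    have "t * (L e \<bullet> L e) = 0" using \<open>n \<bullet> L e = 0\<close> orth' by (simp add: nb inner_add_left)
    moreover have "L e \<noteq> 0" using e0 G_L[of e] linear_0[OF linear_G] by auto
    ultimately have "t = 0" by simp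
    then have nb: "n = b *\<^sub>R m" using nb by simp
    then have "b \<noteq> 0" using n by auto
    then have "(2 * (d \<bullet> n) / (n \<bullet> n)) *\<^sub>R n = (2 * (d \<bullet> m) / (m \<bullet> m)) *\<^sub>R m"
    proof -
      have "m \<bullet> m \<noteq> 0" using m0 by simp
      have r: "2 * (b * x) / (b * (b * y)) * b = 2 * x / y" if "y \<noteq> 0" for x y :: real
        using that \<open>b \<noteq> 0\<close> by (simp add: field_simps)
      have "d \<bullet> n = b * (d \<bullet> m)" "n \<bullet> n = b * (b * (m \<bullet> m))" by (simp_all add: nb)
      then have "2 * (d \<bullet> n) / (n \<bullet> n) * b = 2 * (d \<bullet> m) / (m \<bullet> m)"
        using r[OF \<open>m \<bullet> m \<noteq> 0\<close>, of "d \<bullet> m"] by simp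
      moreover have "(2 * (d \<bullet> n) / (n \<bullet> n)) *\<^sub>R n = (2 * (d \<bullet> n) / (n \<bullet> n) * b) *\<^sub>R m"
        by (subst (4) nb) (simp only: scaleR_scaleR)
      ultimately show ?thesis by (simp only:)
    qed
    then have "d' = L (lrefl i (G d))" using n(3) formula by simp
    then show "G d' = lrefl i (G d)" by (simp add: G_L)
  next
    assume "G d' = lrefl i (G d)"
    then have "d' = d - (2 * (d \<bullet> m) / (m \<bullet> m)) *\<^sub>R m" using formula L_G by metis
    moreover have "\<forall>x\<in>S i. \<forall>y\<in>S i. orthogonal m (x - y)"
      using S_diff orth' by (fastforce simp: orthogonal_def)
    ultimately show "reflects (S i) d d'" unfolding reflects_def using m0 by blast
  qed
qed

lemma G_eq_0_iff: "G d = 0 \<longleftrightarrow> d = 0"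
  using L_G[of d] linear_0[OF linear_G] linear_0[OF linear_L] by metis

lemma billiard_orbit_corbit:
  assumes s: "\<And>n. s' n < k" "\<And>n. s n = S (s' n)"
  shows "billiard_orbit Q x d s \<longleftrightarrow> norm (d 0) = 1 \<and> corbit (\<lambda>n. crd (x n)) (\<lambda>n. G (d n)) s'"
proof -
  have 1: "(\<exists>t>0. x (Suc n) = x n + t *\<^sub>R d n) \<longleftrightarrow> (\<exists>t>0. crd (x (Suc n)) = crd (x n) + t *\<^sub>R G (d n))" for n
  proof -
    have "x (Suc n) = x n + t *\<^sub>R d n \<longleftrightarrow> crd (x (Suc n)) = crd (x n) + t *\<^sub>R G (d n)" for t
      using crd_eq_iff[of "x (Suc n)" "x n + t *\<^sub>R d n"] by (simp only: crd_add linear_scale[OF linear_G])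
    then show ?thesis by (simp only:)
  qed
  have 2: "open_segment (x n) (x (Suc n)) \<subseteq> interior Q \<longleftrightarrow>
      (\<forall>p\<in>open_segment (crd (x n)) (crd (x (Suc n))). \<forall>l<k. lam l p > 0)" for n
  proof
    assume *: "open_segment (x n) (x (Suc n)) \<subseteq> interior Q"
    show "\<forall>p\<in>open_segment (crd (x n)) (crd (x (Suc n))). \<forall>l<k. lam l p > 0"
    proof
      fix p assume "p \<in> open_segment (crd (x n)) (crd (x (Suc n)))"
      then have "emb p \<in> open_segment (x n) (x (Suc n))" by (simp only: mem_open_segment crd_emb)
      then have "emb p \<in> interior Q" using * by blast
      then show "\<forall>l<k. lam l p > 0" by (simp only: interior_Q mem_Collect_eq crd_emb)
    qed
  next
    assume *: "\<forall>p\<in>open_segment (crd (x n)) (crd (x (Suc n))). \<forall>l<k. lam l p > 0"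
    show "open_segment (x n) (x (Suc n)) \<subseteq> interior Q"
    proof
      fix y assume "y \<in> open_segment (x n) (x (Suc n))"
      then have "crd y \<in> open_segment (crd (x n)) (crd (x (Suc n)))" by (simp only: mem_open_segment)
      then show "y \<in> interior Q" using * unfolding interior_Q by blast
    qed
  qed
  have 3: "x (Suc n) \<in> S (s' n) \<longleftrightarrow> lam (s' n) (crd (x (Suc n))) = 0 \<and> (\<forall>l<k. lam l (crd (x (Suc n))) \<ge> 0)" for n
    unfolding mem_S_iff[OF s(1)] mem_Q by blast
  have 4: "S (s' n) \<in> sides Q" for n using s(1) sides_Q by blast
  have 5: "x 0 \<in> interior Q \<longleftrightarrow> (\<forall>l<k. lam l (crd (x 0)) > 0)" by (simp add: interior_Q)
  have 6: "G (d 0) \<noteq> 0" if "norm (d 0) = 1"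
  proof -
    have "d 0 \<noteq> 0" using that by (metis norm_zero zero_neq_one)
    then show ?thesis by (simp only: G_eq_0_iff not_False_eq_True)
  qed
  show ?thesis
    unfolding billiard_orbit_def corbit_def s(2) 1 2 3 5 extreme_point_Q reflects_S[OF s(1)]
    by (simp only: 4 s(1) simp_thms conj_assoc, rule iffI; elim conjE; intro conjI; (assumption | erule 6))
qed

text \<open>A hit is not an extreme point, so it lies strictly inside its side, as
  \<open>corbit_in_lang\<close> demands. Words may begin at any time \<open>m\<close>; for the
  converse \<open>m = 0\<close> suffices, because \<open>lang_corbit\<close> gives an orbit
  beginning with the word.\<close>

lemma billiard_language_eq:
  assumes n: "n \<ge> 1"
  shows "billiard_language Q lab n = map (\<lambda>i. lab (S i)) ` lang n"
proof (intro equalityI subsetI)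
  fix w assume "w \<in> billiard_language Q lab n"
  then obtain x d s m where w: "w = map (\<lambda>i. lab (s i)) [m..<m + n]" and orb: "billiard_orbit Q x d s"
    by (auto simp: billiard_language_def)
  have "\<exists>i. i < k \<and> s j = S i" for j
    using orb sides_Q unfolding billiard_orbit_def by blast
  then obtain s' where s': "\<And>j. s' j < k" "\<And>j. s j = S (s' j)" by metis
  have c: "corbit (\<lambda>n. crd (x n)) (\<lambda>n. G (d n)) s'" using orb billiard_orbit_corbit[of s' s x d, OF s'] by (simp only: simp_thms)
  have "\<exists>r>0. r < 1 \<and> crd (x (Suc j)) = (1 - r) *\<^sub>R P (s' j) + r *\<^sub>R P (Suc (s' j))" for j
  proof -
    have "x (Suc j) \<in> S (s' j)" "crd (x (Suc j)) \<notin> V"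
      using orb s'(2) unfolding billiard_orbit_def extreme_point_Q by metis+
    then obtain r where r: "0 \<le> r" "r \<le> 1" "crd (x (Suc j)) = (1 - r) *\<^sub>R P (s' j) + r *\<^sub>R P (Suc (s' j))"
      unfolding S_def mem_closed_segment crd_emb by (auto simp: in_segment)
    have "r \<noteq> 0" "r \<noteq> 1" using r(3) \<open>crd (x (Suc j)) \<notin> V\<close> P_in_V by auto
    then show ?thesis using r by (intro exI[of _ r]) auto
  qed
  then have "map s' [m..<m + n] \<in> lang n" by (rule corbit_in_lang[OF c])
  moreover have "w = map (\<lambda>i. lab (S i)) (map s' [m..<m + n])" unfolding w s'(2) by simp
  ultimately show "w \<in> map (\<lambda>i. lab (S i)) ` lang n" by blast
next
  fix w assume "w \<in> map (\<lambda>i. lab (S i)) ` lang n"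
  then obtain w' where w': "w' \<in> lang n" "w = map (\<lambda>i. lab (S i)) w'" by blast
  obtain \<xi> \<delta> s where c: "corbit \<xi> \<delta> s" "map s [0..<n] = w'" "\<And>c. c > 0 \<Longrightarrow> corbit \<xi> (\<lambda>n. c *\<^sub>R \<delta> n) s"
    using lang_corbit[OF w'(1) n] by metis
  have sk: "s j < k" for j using c(1) by (simp add: corbit_def)
  have "\<delta> 0 \<noteq> 0" using c(1) by (simp add: corbit_def)
  then have "L (\<delta> 0) \<noteq> 0" using G_L linear_0[OF linear_G] by metis
  define a where "a = 1 / norm (L (\<delta> 0))"
  have a: "a > 0" "norm (L (a *\<^sub>R \<delta> 0)) = 1"
    using \<open>L (\<delta> 0) \<noteq> 0\<close> by (simp_all add: a_def linear_scale[OF linear_L])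
  have "billiard_orbit Q (\<lambda>n. emb (\<xi> n)) (\<lambda>n. L (a *\<^sub>R \<delta> n)) (\<lambda>n. S (s n))"
    unfolding billiard_orbit_corbit[OF sk refl] crd_emb G_L using a(2) c(3)[OF a(1)] by blast
  then have "map (\<lambda>i. lab (S (s i))) [0..<0 + n] \<in> billiard_language Q lab n"
    unfolding billiard_language_def mem_Collect_eq
    by (intro exI[of _ "\<lambda>n. emb (\<xi> n)"] exI[of _ "\<lambda>n. L (a *\<^sub>R \<delta> n)"] exI[of _ "\<lambda>n. S (s n)"] exI[of _ 0])
      (simp only: simp_thms)
  moreover have "map (\<lambda>i. lab (S (s i))) [0..<0 + n] = w" unfolding w'(2) c(2)[symmetric] by simp
  ultimately show "w \<in> billiard_language Q lab n" by simp
qed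

lemma billiard_complexity_eq:
  assumes n: "n \<ge> 1" and lab: "inj_on lab (sides Q)"
  shows "billiard_complexity Q lab n = card (lang n)"
proof -
  have inj: "inj_on (\<lambda>i. lab (S i)) {..<k}"
    using comp_inj_on[OF S_inj lab[unfolded sides_Q]] by (simp add: o_def)
  have "inj_on (map (\<lambda>i. lab (S i))) (lang n)"
  proof (rule inj_onI)
    fix x y assume "x \<in> lang n" "y \<in> lang n" "map (\<lambda>i. lab (S i)) x = map (\<lambda>i. lab (S i)) y"
    moreover have "set x \<union> set y \<subseteq> {..<k}"
      using calculation(1,2) unfolding lang_def W_def adm_def by blast
    ultimately show "x = y" using inj_on_subset[OF inj] by (metis map_inj_on)
  qed
  then show ?thesis unfolding billiard_complexity_def billiard_language_eq[OF n] by (rule card_image)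
qed

end

section \<open>The square and the two triangles\<close>

lemma less_3_cases: "(i::nat) < 3 \<Longrightarrow> i = 0 \<or> i = 1 \<or> i = 2"
  by auto

lemma less_4_cases: "(i::nat) < 4 \<Longrightarrow> i = 0 \<or> i = 1 \<or> i = 2 \<or> i = 3"
  by auto

context lattice_polygon
begin

text \<open>For corners in which all the absolute values open with a constant sign; the pairs to be
  counted are then those of \<open>cop p q n\<close>.\<close>

lemma targets_linear:
  assumes c: "c \<in> V" and i: "i < k" "lam i c > 0"
    and uni: "unimod (P i - c) (P (Suc i) - c)"
    and pq: "p > 0" "q > 0"
    and lin: "\<And>a b. a > 0 \<Longrightarrow> b > 0 \<Longrightarrow>
      (\<Sum>\<phi>\<in>Phi. \<bar>a * (\<phi> (P i) - \<phi> c) + b * (\<phi> (P (Suc i)) - \<phi> c)\<bar>) = real p * a + real q * b"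
  shows "(\<lambda>m. real (\<Sum>n=1..<m. card (targets c i n)) / (real m)\<^sup>2) \<longlonglongrightarrow> 3 / (pi\<^sup>2 * real p * real q)"
proof (rule targets_asymptotics[OF c i uni])
  have G: "{(a, b). 0 < a \<and> 0 < b \<and> coprime a b \<and>
      (\<Sum>\<phi>\<in>Phi. \<bar>real a * (\<phi> (P i) - \<phi> c) + real b * (\<phi> (P (Suc i)) - \<phi> c)\<bar>) \<le> real n} = cop p q n" for n
  proof -
    have "(\<Sum>\<phi>\<in>Phi. \<bar>real a * (\<phi> (P i) - \<phi> c) + real b * (\<phi> (P (Suc i)) - \<phi> c)\<bar>) \<le> real n \<longleftrightarrow> p * a + q * b \<le> n"
      if "0 < a" "0 < b" for a b :: nat
    proof -
      have "(\<Sum>\<phi>\<in>Phi. \<bar>real a * (\<phi> (P i) - \<phi> c) + real b * (\<phi> (P (Suc i)) - \<phi> c)\<bar>) = real (p * a + q * b)"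
        using lin[of "real a" "real b"] that by simp
      then show ?thesis by (simp only: of_nat_le_iff)
    qed
    then show ?thesis unfolding cop_def by blast
  qed
  show "finite {(a, b). 0 < a \<and> 0 < b \<and> coprime a b \<and>
      (\<Sum>\<phi>\<in>Phi. \<bar>real a * (\<phi> (P i) - \<phi> c) + real b * (\<phi> (P (Suc i)) - \<phi> c)\<bar>) \<le> real n}" for n
    unfolding G using finite_subset[OF cop_subset_tri finite_tri[OF pq]] .
  show "(\<lambda>n. real (card {(a, b). 0 < a \<and> 0 < b \<and> coprime a b \<and>
      (\<Sum>\<phi>\<in>Phi. \<bar>real a * (\<phi> (P i) - \<phi> c) + real b * (\<phi> (P (Suc i)) - \<phi> c)\<bar>) \<le> real n}) / (real n)\<^sup>2)
      \<longlonglongrightarrow> 3 / (pi\<^sup>2 * real p * real q)"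
    unfolding G by (rule card_cop_asymptotics[OF pq])
qed

end

text \<open>Lagrange's identity: the squared determinant is the defect in the Cauchy-Schwarz
  inequality.\<close>

lemma det_nonzero:
  fixes u v :: "real^2"
  assumes "(u \<bullet> v)\<^sup>2 < (u \<bullet> u) * (v \<bullet> v)"
  shows "u $ 1 * v $ 2 - u $ 2 * v $ 1 \<noteq> 0"
proof
  assume "u $ 1 * v $ 2 - u $ 2 * v $ 1 = 0"
  moreover have "(u \<bullet> u) * (v \<bullet> v) - (u \<bullet> v)\<^sup>2 = (u $ 1 * v $ 2 - u $ 2 * v $ 1)\<^sup>2"
    by (simp add: inner_vec_def sum_2 power2_eq_square algebra_simps)
  ultimately show False using assms by simp
qed

section \<open>Coordinates and walls of the three polygons\<close>

definition sqP :: "nat \<Rightarrow> real \<times> real" where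
  "sqP n = [(0, 0), (1, 0), (1, 1), (0, 1)] ! (n mod 4)"

definition sqlam :: "nat \<Rightarrow> real \<times> real \<Rightarrow> real" where
  "sqlam i p = (if i = 0 then snd p else if i = 1 then 1 - fst p else if i = 2 then 1 - snd p else fst p)"

definition sqnu :: "nat \<Rightarrow> real \<times> real" where
  "sqnu i = (if i = 0 then (0, 2) else if i = 1 then (-2, 0) else if i = 2 then (0, -2) else (2, 0))"

definition sqPhi :: "(real \<times> real \<Rightarrow> real) set" where
  "sqPhi = {\<lambda>p. fst p, \<lambda>p. snd p}"

text \<open>
  Both triangles have these vertices in affine coordinates, with the right angle, if any, at the
  origin; they differ in the reflections.
\<close>

definition trP :: "nat \<Rightarrow> real \<times> real" where
  "trP n = [(0, 0), (1, 0), (0, 1)] ! (n mod 3)"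

definition trlam :: "nat \<Rightarrow> real \<times> real \<Rightarrow> real" where
  "trlam i p = (if i = 0 then snd p else if i = 1 then 1 - fst p - snd p else fst p)"

text \<open>Normals of the three sides when \<open>u\<close> and \<open>v\<close> are orthogonal and
  of equal length, scaled as \<open>lam_nu\<close> requires.\<close>

definition rightnu :: "nat \<Rightarrow> real \<times> real" where
  "rightnu i = (if i = 0 then (0, 2) else if i = 1 then (-1, -1) else (2, 0))"

text \<open>Normals of the three sides when \<open>u\<close> and \<open>v\<close> have equal length
  and \<open>2 * (u \<bullet> v) = u \<bullet> u\<close>, the relation in an equilateral
  triangle.\<close>

definition equinu :: "nat \<Rightarrow> real \<times> real" where
  "equinu i = (if i = 0 then (-1, 2) else if i = 1 then (-1, -1) else (2, -1))"

text \<open>Besides the grid lines, the walls are the diagonals on which the sum or the difference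
  of the coordinates is odd. Adding 1 and halving turns odd into integral; the hypotenuse has the
  value 1.\<close>

definition rightPhi :: "(real \<times> real \<Rightarrow> real) set" where
  "rightPhi = {\<lambda>p. fst p, \<lambda>p. snd p, \<lambda>p. (fst p + snd p + 1) / 2, \<lambda>p. (fst p - snd p + 1) / 2}"

definition equiPhi :: "(real \<times> real \<Rightarrow> real) set" where
  "equiPhi = {\<lambda>p. fst p, \<lambda>p. snd p, \<lambda>p. fst p + snd p}"

lemma lessThan_4: "{..<4::nat} = {0, 1, 2, 3}"
  by auto

lemma lessThan_3: "{..<3::nat} = {0, 1, 2}"
  by auto

lemma sqP_simps: "sqP 0 = (0, 0)" "sqP 1 = (1, 0)" "sqP (Suc 0) = (1, 0)" "sqP 2 = (1, 1)" "sqP (Suc (Suc 0)) = (1, 1)"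
  "sqP 3 = (0, 1)" "sqP 4 = (0, 0)" "sqP 5 = (1, 0)" "sqP 6 = (1, 1)"
  by (simp_all add: sqP_def)

lemma trP_simps: "trP 0 = (0, 0)" "trP 1 = (1, 0)" "trP (Suc 0) = (1, 0)" "trP 2 = (0, 1)" "trP (Suc (Suc 0)) = (0, 1)"
  "trP 3 = (0, 0)" "trP 4 = (1, 0)"
  by (simp_all add: trP_def)

text \<open>The two diagonals have the same midpoint. This gives the sign at the fourth vertex in
  the convexity axiom.\<close>

lemma sqP_parallelogram:
  assumes "affine_fun f"
  shows "f (sqP i) + f (sqP (i + 2)) = f (sqP (Suc i)) + f (sqP (i + 3))"
proof -
  obtain a b c where f: "\<And>x y. f (x, y) = a * x + b * y + c"
    using assms unfolding affine_fun_def by blast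
  define r where "r = i mod 4"
  have r: "r = 0 \<or> r = 1 \<or> r = 2 \<or> r = 3" unfolding r_def by (rule less_4_cases) simp
  have m: "Suc i mod 4 = (r + 1) mod 4" "(i + 2) mod 4 = (r + 2) mod 4" "(i + 3) mod 4 = (r + 3) mod 4"
    unfolding r_def by presburger+
  show ?thesis unfolding sqP_def m r_def[symmetric] using r by (elim disjE) (simp_all add: f)
qed

lemma affine_coords: "affine_fun (\<lambda>p. a * fst p + b * snd p + c)"
  by (rule affine_funI[where a = a and b = b and c = c]) simp

interpretation sq: convex_polygon 4 sqP sqlam sqnu
proof
  show "sqP (n + 4) = sqP n" for n by (simp add: sqP_def)
  show "inj_on sqP {..<4}" by (simp add: lessThan_4 sqP_simps inj_on_def)
  show "affine_fun (sqlam i)" for i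
    unfolding sqlam_def
    by (rule affine_funI[where a = "if i = 0 then 0 else if i = 1 then -1 else if i = 2 then 0 else 1"
          and b = "if i = 0 then 1 else if i = 1 then 0 else if i = 2 then -1 else 0"
          and c = "if i = 0 then 0 else if i = 1 then 1 else if i = 2 then 1 else 0"]) simp
  show "sqlam i (sqP i) = 0" "sqlam i (sqP (Suc i)) = 0" "sqlam i (sqnu i) - sqlam i 0 = 2" if "i < 4" for i
    using less_4_cases[OF that] by (elim disjE; simp add: sqlam_def sqP_simps sqnu_def)+
  show "0 < sqlam i (sqP (i + l))" if "i < 4" "2 \<le> l" "l < 4" for i l
  proof -
    have "l = 2 \<or> l = 3" using that by linarith
    moreover have "sqP (Suc (Suc (Suc 0))) = (0, 1)"
      using sqP_simps by (simp only: numeral_3_eq_3)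
    ultimately show ?thesis using less_4_cases[OF \<open>i < 4\<close>]
      by (elim disjE) (simp_all add: sqlam_def sqP_simps)
  qed
  fix f :: "real \<times> real \<Rightarrow> real" and i l m
  assume f: "affine_fun f" "f (sqP i) < 0" "0 < f (sqP (Suc i))" and lm: "1 \<le> l" "l < m" "m \<le> 4" "f (sqP (i + l)) \<le> 0"
  have "l \<noteq> 1" using f lm by auto
  \<comment> \<open>The value at offset 1 is positive, so besides offset 4, which is the start
    again, only one pair of offsets remains.\<close>
  then have "m = 4 \<or> (l = 2 \<and> m = 3)" using lm by linarith
  then show "f (sqP (i + m)) < 0"
  proof
    assume "m = 4"
    then show ?thesis using f(2) by (simp add: sqP_def)
  next
    assume "l = 2 \<and> m = 3"
    then show ?thesis using sqP_parallelogram[OF f(1), of i] f lm by auto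
  qed
qed simp

lemma triangle_convex_polygon:
  assumes "\<And>i. i < 3 \<Longrightarrow> trlam i (nu i) - trlam i 0 = 2"
  shows "convex_polygon 3 trP trlam nu"
proof
  show "trP (n + 3) = trP n" for n by (simp add: trP_def)
  show "inj_on trP {..<3}" by (simp add: lessThan_3 trP_simps inj_on_def)
  show "affine_fun (trlam i)" for i
    unfolding trlam_def
    by (rule affine_funI[where a = "if i = 0 then 0 else if i = 1 then -1 else 1"
          and b = "if i = 0 then 1 else if i = 1 then -1 else 0"
          and c = "if i = 1 then 1 else 0"]) simp
  show "trlam i (trP i) = 0" "trlam i (trP (Suc i)) = 0" if "i < 3" for i
    using less_3_cases[OF that] by (elim disjE; simp add: trlam_def trP_simps)+
  show "0 < trlam i (trP (i + l))" if "i < 3" "2 \<le> l" "l < 3" for i l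
  proof -
    have "l = 2" using that by linarith
    moreover have "trP (Suc (Suc (Suc 0))) = (0, 0)"
      using trP_simps by (simp only: numeral_3_eq_3)
    ultimately show ?thesis using less_3_cases[OF \<open>i < 3\<close>]
      by (elim disjE) (simp_all add: trlam_def trP_simps)
  qed
  fix f :: "real \<times> real \<Rightarrow> real" and i l m
  assume f: "affine_fun f" "f (trP i) < 0" "0 < f (trP (Suc i))" and lm: "1 \<le> l" "l < m" "m \<le> 3" "f (trP (i + l)) \<le> 0"
  have "l \<noteq> 1" using f lm by auto
  then have "m = 3" using lm by linarith
  then show "f (trP (i + m)) < 0" using f(2) by (simp add: trP_def)
qed (use assms in auto)

interpretation right: convex_polygon 3 trP trlam rightnu
  by (rule triangle_convex_polygon) (auto simp: trlam_def rightnu_def)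

interpretation equi: convex_polygon 3 trP trlam equinu
  by (rule triangle_convex_polygon) (auto simp: trlam_def equinu_def)

lemma sqV: "sq.V = {(0, 0), (1, 0), (1, 1), (0, 1)}"
  by (auto simp: sq.V_def lessThan_4 sqP_simps)

lemma trV: "right.V = {(0, 0), (1, 0), (0, 1)}" "equi.V = {(0, 0), (1, 0), (0, 1)}"
  by (auto simp: right.V_def equi.V_def lessThan_3 trP_simps)

lemma Ints_between: "(x::real) \<in> \<int> \<Longrightarrow> 0 \<le> x \<Longrightarrow> x \<le> 1 \<Longrightarrow> x = 0 \<or> x = 1"
proof -
  assume x: "x \<in> \<int>" "0 \<le> x" "x \<le> 1"
  then obtain m where "x = of_int m" by (auto elim: Ints_cases)
  then have "m = 0 \<or> m = 1" using x by (simp, linarith)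
  then show ?thesis using \<open>x = of_int m\<close> by auto
qed

lemma Ints_open_unit: "0 < (x::real) \<Longrightarrow> x < 1 \<Longrightarrow> x \<notin> \<int>"
  using Ints_between[of x] by auto

interpretation sq: lattice_polygon 4 sqP sqlam sqnu sqPhi
proof
  show "finite sqPhi" by (simp add: sqPhi_def)
  show "affine_fun \<phi>" if "\<phi> \<in> sqPhi" for \<phi>
    using that affine_coords[of 1 0 0] affine_coords[of 0 1 0] by (auto simp: sqPhi_def)
  show "\<exists>\<phi>\<in>sqPhi. \<phi> p \<in> \<int>" if "i < 4" "sqlam i p = 0" for i p
  proof -
    have "snd p = 0 \<or> fst p = 1 \<or> snd p = 1 \<or> fst p = 0"
      using that by (auto simp: sqlam_def split: if_splits)
    then have "snd p \<in> \<int> \<or> fst p \<in> \<int>" by auto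
    then show ?thesis by (auto simp: sqPhi_def)
  qed
  show "\<phi> p \<notin> \<int>" if "\<And>i. i < 4 \<Longrightarrow> 0 < sqlam i p" "\<phi> \<in> sqPhi" for p \<phi>
  proof -
    have "0 < snd p" "0 < 1 - fst p" "0 < 1 - snd p" "0 < fst p"
      using that(1)[of 0] that(1)[of 1] that(1)[of 2] that(1)[of 3] by (simp_all add: sqlam_def)
    then show ?thesis using that(2) Ints_open_unit[of "fst p"] Ints_open_unit[of "snd p"] by (auto simp: sqPhi_def)
  qed
  have refl: "sq.refl i p = (if i = 0 then (fst p, - snd p) else if i = 1 then (2 - fst p, snd p)
      else if i = 2 then (fst p, 2 - snd p) else (- fst p, snd p))" if "i < 4" for i p
    using less_4_cases[OF that] by (cases p) (elim disjE; simp add: sq.refl_def sqlam_def sqnu_def)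
  show "\<exists>\<psi>\<in>sqPhi. \<psi> p \<in> \<int>" if "i < 4" "\<phi> \<in> sqPhi" "\<phi> (sq.refl i p) \<in> \<int>" for i \<phi> p
  proof -
    have "snd p \<in> \<int> \<or> fst p \<in> \<int>"
      using less_4_cases[OF that(1)] that(2,3)
      Ints_diff[of 2 "2 - fst p"] Ints_diff[of 2 "2 - snd p"]
      by (elim disjE) (auto simp: refl sqPhi_def)
    then show ?thesis by (auto simp: sqPhi_def)
  qed
  show "lat p" if "\<phi> \<in> sqPhi" "\<psi> \<in> sqPhi" "\<phi> \<noteq> \<psi>" "\<phi> p \<in> \<int>" "\<psi> p \<in> \<int>" for \<phi> \<psi> p
    using that by (auto simp: sqPhi_def lat_def)
  show "lat q" if "q \<in> sq.V" for q using that by (auto simp: sqV lat_def)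
  show "p \<in> sq.V" if "\<And>i. i < 4 \<Longrightarrow> 0 \<le> sqlam i p" "lat p" for p
  proof -
    have "0 \<le> snd p" "fst p \<le> 1" "snd p \<le> 1" "0 \<le> fst p"
      using that(1)[of 0] that(1)[of 1] that(1)[of 2] that(1)[of 3] by (simp_all add: sqlam_def)
    then show ?thesis using Ints_between[of "fst p"] Ints_between[of "snd p"] that(2)
      by (cases p) (auto simp: lat_def sqV)
  qed
  show "lat (sq.refl i p)" if "i < 4" "lat p" for i p
    using less_4_cases[OF that(1)] that(2) by (elim disjE) (auto simp: refl lat_def)
qed

lemma tr_V_lat: "(\<And>i. i < 3 \<Longrightarrow> 0 \<le> trlam i p) \<Longrightarrow> lat p \<Longrightarrow> p \<in> {(0, 0), (1, 0), (0, 1)}"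
proof -
  assume *: "\<And>i. i < 3 \<Longrightarrow> 0 \<le> trlam i p" and "lat p"
  have "0 \<le> snd p" "fst p + snd p \<le> 1" "0 \<le> fst p"
    using *[of 0] *[of 1] *[of 2] by (simp_all add: trlam_def)
  then show ?thesis using Ints_between[of "fst p"] Ints_between[of "snd p"] \<open>lat p\<close>
    by (cases p) (auto simp: lat_def)
qed

lemma tr_interior:
  assumes "\<And>i. i < 3 \<Longrightarrow> 0 < trlam i p"
  shows "0 < snd p" "0 < fst p" "fst p + snd p < 1"
  using assms[of 0] assms[of 1] assms[of 2] by (simp_all add: trlam_def)

lemma right_refl:
  assumes "i < 3"
  shows "right.refl i p =
    (if i = 0 then (fst p, - snd p) else if i = 1 then (1 - snd p, 1 - fst p) else (- fst p, snd p))"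
  using less_3_cases[OF assms] by (cases p) (elim disjE; simp add: right.refl_def trlam_def rightnu_def)

lemma equi_refl:
  assumes "i < 3"
  shows "equi.refl i p =
    (if i = 0 then (fst p + snd p, - snd p) else if i = 1 then (1 - snd p, 1 - fst p) else (- fst p, fst p + snd p))"
  using less_3_cases[OF assms] by (cases p) (elim disjE; simp add: equi.refl_def trlam_def equinu_def)

lemma Ints_1_diff_iff: "1 - (x::real) \<in> \<int> \<longleftrightarrow> x \<in> \<int>" and Ints_2_diff_iff: "2 - (x::real) \<in> \<int> \<longleftrightarrow> x \<in> \<int>"
  using Ints_diff[of 1 "1 - x"] Ints_diff[of 1 x] Ints_diff[of 2 "2 - x"] Ints_diff[of 2 x] by auto

interpretation right: lattice_polygon 3 trP trlam rightnu rightPhi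
proof
  show "finite rightPhi" by (simp add: rightPhi_def)
  show "affine_fun \<phi>" if "\<phi> \<in> rightPhi" for \<phi>
    using that affine_coords[of 1 0 0] affine_coords[of 0 1 0] affine_coords[of "1/2" "1/2" "1/2"] affine_coords[of "1/2" "-1/2" "1/2"]
    by (auto simp: rightPhi_def add_divide_distrib diff_divide_distrib)
  show "\<exists>\<phi>\<in>rightPhi. \<phi> p \<in> \<int>" if "i < 3" "trlam i p = 0" for i p
  proof -
    have "snd p = 0 \<or> (fst p + snd p + 1) / 2 = 1 \<or> fst p = 0"
      using that by (auto simp: trlam_def split: if_splits)
    then have "snd p \<in> \<int> \<or> (fst p + snd p + 1) / 2 \<in> \<int> \<or> fst p \<in> \<int>" by auto
    then show ?thesis by (auto simp: rightPhi_def)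
  qed
  show "\<phi> p \<notin> \<int>" if "\<And>i. i < 3 \<Longrightarrow> 0 < trlam i p" "\<phi> \<in> rightPhi" for p \<phi>
  proof -
    have *: "0 < snd p" "0 < fst p" "fst p + snd p < 1" using tr_interior[of p] that(1) by blast+
    have "fst p \<notin> \<int>" "snd p \<notin> \<int>" "(fst p + snd p + 1) / 2 \<notin> \<int>" "(fst p - snd p + 1) / 2 \<notin> \<int>"
      using * by (intro Ints_open_unit; simp)+
    then show ?thesis using that(2) by (auto simp: rightPhi_def)
  qed
  show "\<exists>\<psi>\<in>rightPhi. \<psi> p \<in> \<int>" if "i < 3" "\<phi> \<in> rightPhi" "\<phi> (right.refl i p) \<in> \<int>" for i \<phi> p
  proof -
    have r: "(fst p + - snd p + 1) / 2 = (fst p - snd p + 1) / 2" "(fst p - - snd p + 1) / 2 = (fst p + snd p + 1) / 2"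
      "(1 - snd p + (1 - fst p) + 1) / 2 = 2 - (fst p + snd p + 1) / 2" "(1 - snd p - (1 - fst p) + 1) / 2 = (fst p - snd p + 1) / 2"
      "(- fst p + snd p + 1) / 2 = 1 - (fst p - snd p + 1) / 2" "(- fst p - snd p + 1) / 2 = 1 - (fst p + snd p + 1) / 2"
      by (simp_all add: field_simps)
    have "snd p \<in> \<int> \<or> fst p \<in> \<int> \<or> (fst p + snd p + 1) / 2 \<in> \<int> \<or> (fst p - snd p + 1) / 2 \<in> \<int>"
      using that(2,3) less_3_cases[OF that(1)] unfolding right_refl[OF that(1)] rightPhi_def insert_iff empty_iff
      by (elim disjE) (simp_all only: r fst_conv snd_conv Ints_1_diff_iff Ints_2_diff_iff minus_in_Ints_iff if_True if_False
          zero_neq_one one_neq_zero refl zero_neq_numeral numeral_eq_one_iff semiring_norm(85) numeral_neq_zero simp_thms)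
    then show ?thesis by (auto simp: rightPhi_def)
  qed
  show "lat p" if "\<phi> \<in> rightPhi" "\<psi> \<in> rightPhi" "\<phi> \<noteq> \<psi>" "\<phi> p \<in> \<int>" "\<psi> p \<in> \<int>" for \<phi> \<psi> p
  proof -
    define x y where "x = (fst p + snd p + 1) / 2" and "y = (fst p - snd p + 1) / 2"
    have e: "2 * x - 1 - fst p = snd p" "2 * x - 1 - snd p = fst p" "2 * y - 1 + snd p = fst p"
      "1 - 2 * y + fst p = snd p" "x + y - 1 = fst p" "x - y = snd p"
      by (simp_all add: x_def y_def field_simps)
    have "2 * x - 1 - fst p \<in> \<int>" if "fst p \<in> \<int>" "x \<in> \<int>" using that by auto
    moreover have "2 * x - 1 - snd p \<in> \<int>" if "snd p \<in> \<int>" "x \<in> \<int>" using that by auto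
    moreover have "2 * y - 1 + snd p \<in> \<int>" if "snd p \<in> \<int>" "y \<in> \<int>" using that by auto
    moreover have "1 - 2 * y + fst p \<in> \<int>" if "fst p \<in> \<int>" "y \<in> \<int>" using that by auto
    moreover have "x + y - 1 \<in> \<int>" "x - y \<in> \<int>" if "x \<in> \<int>" "y \<in> \<int>" using that by auto
    moreover have "fst p \<in> \<int> \<and> snd p \<in> \<int> \<or> fst p \<in> \<int> \<and> x \<in> \<int> \<or> fst p \<in> \<int> \<and> y \<in> \<int> \<or>
        snd p \<in> \<int> \<and> x \<in> \<int> \<or> snd p \<in> \<int> \<and> y \<in> \<int> \<or> x \<in> \<int> \<and> y \<in> \<int>"
      using that unfolding rightPhi_def x_def y_def by (elim insertE emptyE) simp_all
    ultimately show ?thesis unfolding lat_def e by blast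
  qed
  show "lat q" if "q \<in> right.V" for q using that by (auto simp: trV lat_def)
  show "p \<in> right.V" if "\<And>i. i < 3 \<Longrightarrow> 0 \<le> trlam i p" "lat p" for p
    using tr_V_lat[OF that] by (simp add: trV)
  show "lat (right.refl i p)" if "i < 3" "lat p" for i p
    using less_3_cases[OF that(1)] that(2) by (elim disjE) (auto simp: right_refl lat_def)
qed

interpretation equi: lattice_polygon 3 trP trlam equinu equiPhi
proof
  show "finite equiPhi" by (simp add: equiPhi_def)
  show "affine_fun \<phi>" if "\<phi> \<in> equiPhi" for \<phi>
    using that affine_coords[of 1 0 0] affine_coords[of 0 1 0] affine_coords[of 1 1 0]
    by (auto simp: equiPhi_def)
  show "\<exists>\<phi>\<in>equiPhi. \<phi> p \<in> \<int>" if "i < 3" "trlam i p = 0" for i p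
  proof -
    have "snd p = 0 \<or> fst p + snd p = 1 \<or> fst p = 0"
      using that by (auto simp: trlam_def split: if_splits)
    then have "snd p \<in> \<int> \<or> fst p + snd p \<in> \<int> \<or> fst p \<in> \<int>" by auto
    then show ?thesis by (auto simp: equiPhi_def)
  qed
  show "\<phi> p \<notin> \<int>" if "\<And>i. i < 3 \<Longrightarrow> 0 < trlam i p" "\<phi> \<in> equiPhi" for p \<phi>
  proof -
    have *: "0 < snd p" "0 < fst p" "fst p + snd p < 1" using tr_interior[of p] that(1) by blast+
    have "fst p \<notin> \<int>" "snd p \<notin> \<int>" "fst p + snd p \<notin> \<int>"
      using * by (intro Ints_open_unit; simp)+
    then show ?thesis using that(2) by (auto simp: equiPhi_def)
  qed
  show "\<exists>\<psi>\<in>equiPhi. \<psi> p \<in> \<int>" if "i < 3" "\<phi> \<in> equiPhi" "\<phi> (equi.refl i p) \<in> \<int>" for i \<phi> p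
  proof -
    have r: "fst p + snd p + - snd p = fst p" "1 - snd p + (1 - fst p) = 2 - (fst p + snd p)" "- fst p + (fst p + snd p) = snd p"
      by simp_all
    have "snd p \<in> \<int> \<or> fst p \<in> \<int> \<or> fst p + snd p \<in> \<int>"
      using that(2,3) less_3_cases[OF that(1)] unfolding equi_refl[OF that(1)] equiPhi_def insert_iff empty_iff
      by (elim disjE) (simp_all only: r fst_conv snd_conv Ints_1_diff_iff Ints_2_diff_iff minus_in_Ints_iff if_True if_False
          zero_neq_one one_neq_zero refl zero_neq_numeral numeral_eq_one_iff semiring_norm(85) numeral_neq_zero simp_thms)
    then show ?thesis by (auto simp: equiPhi_def)
  qed
  show "lat p" if "\<phi> \<in> equiPhi" "\<psi> \<in> equiPhi" "\<phi> \<noteq> \<psi>" "\<phi> p \<in> \<int>" "\<psi> p \<in> \<int>" for \<phi> \<psi> p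
    using that Ints_diff[of "fst p + snd p" "fst p"] Ints_diff[of "fst p + snd p" "snd p"]
    by (auto simp: equiPhi_def lat_def)
  show "lat q" if "q \<in> equi.V" for q using that by (auto simp: trV lat_def)
  show "p \<in> equi.V" if "\<And>i. i < 3 \<Longrightarrow> 0 \<le> trlam i p" "lat p" for p
    using tr_V_lat[OF that] by (simp add: trV)
  show "lat (equi.refl i p)" if "i < 3" "lat p" for i p
    using less_3_cases[OF that(1)] that(2) by (elim disjE) (auto simp: equi_refl lat_def)
qed

text \<open>Subtracting the smaller entry from the larger preserves coprimality and turns
  \<open>a + b + max a b\<close> into \<open>2 x + 3 y\<close>. The two orders give disjoint copies
  of \<open>cop 2 3 n\<close>, and equal entries give only \<open>(1, 1)\<close>; hence twice
  \<open>3 / (6 \<pi>\<^sup>2)\<close>.\<close>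

lemma cop_max_asymptotics:
  defines "G \<equiv> \<lambda>n. {(a, b). 0 < a \<and> 0 < b \<and> coprime a b \<and> a + b + max a b \<le> (n::nat)}"
  shows "finite (G n)" and "(\<lambda>n. real (card (G n)) / (real n)\<^sup>2) \<longlonglongrightarrow> 1 / pi\<^sup>2"
proof -
  have fin: "finite (cop 2 3 n)" for n
    using finite_subset[OF cop_subset_tri finite_tri] by simp
  define f g :: "nat \<times> nat \<Rightarrow> nat \<times> nat" where "f = (\<lambda>(x, y). (x + y, y))" and "g = (\<lambda>(x, y). (y, x + y))"
  have inj: "inj_on f A" "inj_on g A" for A
    by (auto simp: f_def g_def inj_on_def)
  have cp1: "coprime (x + y) y \<longleftrightarrow> coprime x y" for x y :: nat
    by (simp add: coprime_iff_gcd_eq_1)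
  have cp2: "coprime y (x + y) \<longleftrightarrow> coprime x y" for x y :: nat
    using cp1[of x y] coprime_commute[of y "x + y"] by simp
  note cp = cp1 cp2
  have G: "G n = (f ` cop 2 3 n \<union> g ` cop 2 3 n) \<union> (if 3 \<le> n then {(1, 1)} else {})" for n
  proof (intro equalityI subsetI)
    fix z assume "z \<in> G n"
    then obtain a b where z: "z = (a, b)" "0 < a" "0 < b" "coprime a b" "a + b + max a b \<le> n"
      by (auto simp: G_def)
    show "z \<in> (f ` cop 2 3 n \<union> g ` cop 2 3 n) \<union> (if 3 \<le> n then {(1, 1)} else {})"
    proof (cases a b rule: linorder_cases)
      case less
      then obtain x where x: "b = x + a" "x > 0" by (metis add.commute less_imp_add_positive)
      have "coprime x a" using z(4) unfolding x(1) cp .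
      then have "(x, a) \<in> cop 2 3 n" using z x by (simp add: cop_def)
      then show ?thesis using z(1) x by (auto simp: g_def intro!: image_eqI[of _ _ "(x, a)"])
    next
      case equal
      then have "a = 1" using z(4) by simp
      then show ?thesis using z equal by auto
    next
      case greater
      then obtain x where x: "a = x + b" "x > 0" by (metis add.commute less_imp_add_positive)
      have "coprime x b" using z(4) unfolding x(1) cp .
      then have "(x, b) \<in> cop 2 3 n" using z x by (simp add: cop_def)
      then show ?thesis using z(1) x by (auto simp: f_def intro!: image_eqI[of _ _ "(x, b)"])
    qed
  next
    fix z assume z: "z \<in> (f ` cop 2 3 n \<union> g ` cop 2 3 n) \<union> (if 3 \<le> n then {(1, 1)} else {})"
    then consider x y where "(x, y) \<in> cop 2 3 n" "z = (x + y, y)" | x y where "(x, y) \<in> cop 2 3 n" "z = (y, x + y)"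
      | "3 \<le> n" "z = (1, 1)"
      by (auto simp: f_def g_def split: if_splits)
    then show "z \<in> G n"
      by cases (auto simp: G_def cop_def cp)
  qed
  then show "finite (G n)" by (simp add: fin)
  have card: "real (card (G n)) = 2 * real (card (cop 2 3 n)) + (if 3 \<le> n then 1 else 0)" for n
  proof -
    have "f ` cop 2 3 n \<inter> g ` cop 2 3 n = {}" by (auto simp: f_def g_def cop_def)
    then have "card (f ` cop 2 3 n \<union> g ` cop 2 3 n) = 2 * card (cop 2 3 n)"
      by (simp add: card_Un_disjoint fin card_image inj)
    moreover have "(1, 1) \<notin> f ` cop 2 3 n \<union> g ` cop 2 3 n" by (auto simp: f_def g_def cop_def)
    ultimately show ?thesis unfolding G by (simp add: fin)
  qed
  have "(\<lambda>n. (if 3 \<le> n then 1 else 0) / (real n)\<^sup>2) \<longlonglongrightarrow> 0"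
  proof (rule Lim_transform_eventually)
    show "(\<lambda>n. 1 / (real n)\<^sup>2) \<longlonglongrightarrow> 0" by real_asymp
    show "\<forall>\<^sub>F n in sequentially. 1 / (real n)\<^sup>2 = (if 3 \<le> n then 1 else 0) / (real n)\<^sup>2"
      using eventually_ge_at_top[of 3] by eventually_elim simp
  qed
  moreover have "(\<lambda>n. real (card (cop 2 3 n)) / (real n)\<^sup>2) \<longlonglongrightarrow> 3 / (pi\<^sup>2 * real 2 * real 3)"
    by (rule card_cop_asymptotics) simp_all
  ultimately have "(\<lambda>n. 2 * (real (card (cop 2 3 n)) / (real n)\<^sup>2) + (if 3 \<le> n then 1 else 0) / (real n)\<^sup>2)
      \<longlonglongrightarrow> 2 * (3 / (pi\<^sup>2 * real 2 * real 3)) + 0"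
    by (intro tendsto_add tendsto_mult_left)
  then show "(\<lambda>n. real (card (G n)) / (real n)\<^sup>2) \<longlonglongrightarrow> 1 / pi\<^sup>2"
    unfolding card add_divide_distrib by simp
qed

lemma sqPhi_sum: "(\<Sum>\<phi>\<in>sqPhi. F \<phi>) = F (\<lambda>p. fst p) + (F (\<lambda>p. snd p) :: real)"
proof -
  have "(\<lambda>p. fst p) \<noteq> (\<lambda>p :: real \<times> real. snd p)" by (auto dest: fun_cong[of _ _ "(1, 5)"])
  then show ?thesis by (simp add: sqPhi_def)
qed

lemma equiPhi_sum: "(\<Sum>\<phi>\<in>equiPhi. F \<phi>) = F (\<lambda>p. fst p) + (F (\<lambda>p. snd p) + (F (\<lambda>p. fst p + snd p) :: real))"
proof -
  have "(\<lambda>p. fst p) \<noteq> (\<lambda>p :: real \<times> real. snd p)" "(\<lambda>p. fst p) \<noteq> (\<lambda>p :: real \<times> real. fst p + snd p)"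
    "(\<lambda>p. snd p) \<noteq> (\<lambda>p :: real \<times> real. fst p + snd p)"
    by (auto dest: fun_cong[of _ _ "(1, 5)"])
  then show ?thesis by (simp add: equiPhi_def)
qed

lemma rightPhi_sum: "(\<Sum>\<phi>\<in>rightPhi. F \<phi>) = F (\<lambda>p. fst p) + (F (\<lambda>p. snd p) +
    (F (\<lambda>p. (fst p + snd p + 1) / 2) + (F (\<lambda>p. (fst p - snd p + 1) / 2) :: real)))"
proof -
  have "(\<lambda>p. fst p) \<noteq> (\<lambda>p :: real \<times> real. snd p)" "(\<lambda>p. fst p) \<noteq> (\<lambda>p :: real \<times> real. (fst p + snd p + 1) / 2)"
    "(\<lambda>p. fst p) \<noteq> (\<lambda>p :: real \<times> real. (fst p - snd p + 1) / 2)"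
    "(\<lambda>p. snd p) \<noteq> (\<lambda>p :: real \<times> real. (fst p + snd p + 1) / 2)"
    "(\<lambda>p. snd p) \<noteq> (\<lambda>p :: real \<times> real. (fst p - snd p + 1) / 2)"
    "(\<lambda>p. (fst p + snd p + 1) / 2) \<noteq> (\<lambda>p :: real \<times> real. (fst p - snd p + 1) / 2)"
    by (auto dest: fun_cong[of _ _ "(1, 5)"])
  then show ?thesis by (simp add: rightPhi_def)
qed

text \<open>One family of grid lines is crossed along both directions that span the corner, the
  other only along the diagonal of the square. So the wall count is \<open>a + 2 b\<close> or
  \<open>2 a + b\<close>.\<close>

lemma sq_targets:
  assumes c: "c \<in> sq.V" and i: "i < 4" "sqlam i c > 0"
  shows "(\<lambda>m. real (\<Sum>n=1..<m. card (sq.targets c i n)) / (real m)\<^sup>2) \<longlonglongrightarrow> 3 / (2 * pi\<^sup>2)"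
proof -
  have lin: ?thesis if "unimod (sqP i - c) (sqP (Suc i) - c)" "0 < p" "0 < q" "p * q = 2"
    "\<And>a b. a > 0 \<Longrightarrow> b > 0 \<Longrightarrow> \<bar>a * (fst (sqP i) - fst c) + b * (fst (sqP (Suc i)) - fst c)\<bar> +
      \<bar>a * (snd (sqP i) - snd c) + b * (snd (sqP (Suc i)) - snd c)\<bar> = real p * a + real q * b" for p q :: nat
  proof -
    have "real p * real q = 2" using that(4) by (metis of_nat_mult of_nat_numeral)
    then have e: "pi\<^sup>2 * real p * real q = 2 * pi\<^sup>2" by (simp add: mult.assoc)
    show ?thesis unfolding e[symmetric]
      by (rule sq.targets_linear[OF c i that(1-3)]) (simp only: sqPhi_sum that(5))
  qed
  have "c = (0, 0) \<and> (i = 1 \<or> i = 2) \<or> c = (1, 0) \<and> (i = 2 \<or> i = 3) \<or>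
      c = (1, 1) \<and> (i = 3 \<or> i = 0) \<or> c = (0, 1) \<and> (i = 0 \<or> i = 1)"
    using c i less_4_cases[OF i(1)] by (auto simp: sqV sqlam_def)
  then consider "c = (0, 0)" "i = 1" | "c = (1, 0)" "i = 2" | "c = (1, 1)" "i = 3" | "c = (0, 1)" "i = 0"
    | "c = (0, 0)" "i = 2" | "c = (1, 0)" "i = 3" | "c = (1, 1)" "i = 0" | "c = (0, 1)" "i = 1"
    by blast
  then show ?thesis
  proof cases
    case 1 then show ?thesis by (intro lin[of 1 2]) (simp_all add: unimod_def lat_def sqP_simps abs_if)
  next
    case 2 then show ?thesis by (intro lin[of 1 2]) (simp_all add: unimod_def lat_def sqP_simps abs_if)
  next
    case 3 then show ?thesis by (intro lin[of 1 2]) (simp_all add: unimod_def lat_def sqP_simps abs_if)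
  next
    case 4 then show ?thesis by (intro lin[of 1 2]) (simp_all add: unimod_def lat_def sqP_simps abs_if)
  next
    case 5 then show ?thesis by (intro lin[of 2 1]) (simp_all add: unimod_def lat_def sqP_simps abs_if)
  next
    case 6 then show ?thesis by (intro lin[of 2 1]) (simp_all add: unimod_def lat_def sqP_simps abs_if)
  next
    case 7 then show ?thesis by (intro lin[of 2 1]) (simp_all add: unimod_def lat_def sqP_simps abs_if)
  next
    case 8 then show ?thesis by (intro lin[of 2 1]) (simp_all add: unimod_def lat_def sqP_simps abs_if)
  qed
qed

lemma sq_lang_asymptotics: "(\<lambda>n. real (card (sq.lang n)) / real n ^ 3) \<longlonglongrightarrow> 4 / pi\<^sup>2"
proof -
  have "{i. i < 4 \<and> 0 < sqlam i (0, 0)} = {1, 2}" "{i. i < 4 \<and> 0 < sqlam i (1, 0)} = {2, 3}"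
    "{i. i < 4 \<and> 0 < sqlam i (1, 1)} = {0, 3}" "{i. i < 4 \<and> 0 < sqlam i (0, 1)} = {0, 1}"
    by (auto simp: sqlam_def dest: less_4_cases)
  \<comment> \<open>Four vertices with two opposite sides each.\<close>
  then have "(\<Sum>c\<in>sq.V. \<Sum>i | i < 4 \<and> sqlam i c > 0. 3 / (2 * pi\<^sup>2)) = 12 / pi\<^sup>2"
    by (simp add: sqV)
  then show ?thesis using sq.card_lang_asymptotics[of "\<lambda>c i. 3 / (2 * pi\<^sup>2)", OF sq_targets] by simp
qed

lemma tr_cases:
  assumes c: "c \<in> {(0, 0), (1, 0), (0, 1)}" and i: "i < 3" "trlam i c > 0"
  shows "c = (0, 0) \<and> i = 1 \<or> c = (1, 0) \<and> i = 2 \<or> c = (0, 1) \<and> i = 0"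
  using c i(2) less_3_cases[OF i(1)] by (auto simp: trlam_def)

lemma tr_sets: "{i. i < 3 \<and> 0 < trlam i (0, 0)} = {1}" "{i. i < 3 \<and> 0 < trlam i (1, 0)} = {2}"
    "{i. i < 3 \<and> 0 < trlam i (0, 1)} = {0}"
  by (auto simp: trlam_def dest: less_3_cases)

text \<open>Each spanning direction of a corner crosses two of the three families of walls, so the
  count is \<open>2 a + 2 b\<close> throughout.\<close>

lemma equi_targets:
  assumes c: "c \<in> equi.V" and i: "i < 3" "trlam i c > 0"
  shows "(\<lambda>m. real (\<Sum>n=1..<m. card (equi.targets c i n)) / (real m)\<^sup>2) \<longlonglongrightarrow> 3 / (4 * pi\<^sup>2)"
proof -
  have lin: ?thesis if "unimod (trP i - c) (trP (Suc i) - c)"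
    "\<And>a b. a > 0 \<Longrightarrow> b > 0 \<Longrightarrow> \<bar>a * (fst (trP i) - fst c) + b * (fst (trP (Suc i)) - fst c)\<bar> +
      (\<bar>a * (snd (trP i) - snd c) + b * (snd (trP (Suc i)) - snd c)\<bar> +
       \<bar>a * (fst (trP i) + snd (trP i) - (fst c + snd c)) + b * (fst (trP (Suc i)) + snd (trP (Suc i)) - (fst c + snd c))\<bar>)
      = real 2 * a + real 2 * b"
    using equi.targets_linear[OF c i that(1), of 2 2] that(2)
    by (simp add: equiPhi_sum mult.commute)
  have "c = (0, 0) \<and> i = 1 \<or> c = (1, 0) \<and> i = 2 \<or> c = (0, 1) \<and> i = 0"
    using tr_cases c i unfolding trV by blast
  then show ?thesis
  proof (elim disjE conjE)
    assume "c = (0, 0)" "i = 1"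
    then show ?thesis by (intro lin) (simp_all add: unimod_def lat_def trP_simps abs_if)
  next
    assume "c = (1, 0)" "i = 2"
    then show ?thesis by (intro lin) (simp_all add: unimod_def lat_def trP_simps abs_if)
  next
    assume "c = (0, 1)" "i = 0"
    then show ?thesis by (intro lin) (simp_all add: unimod_def lat_def trP_simps abs_if)
  qed
qed

lemma equi_lang_asymptotics: "(\<lambda>n. real (card (equi.lang n)) / real n ^ 3) \<longlonglongrightarrow> 3 / (4 * pi\<^sup>2)"
proof -
  have "(\<Sum>c\<in>equi.V. \<Sum>i | i < 3 \<and> trlam i c > 0. 3 / (4 * pi\<^sup>2)) = 9 / (4 * pi\<^sup>2)"
    by (simp add: trV tr_sets)
  then show ?thesis using equi.card_lang_asymptotics[of "\<lambda>c i. 3 / (4 * pi\<^sup>2)", OF equi_targets] by simp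
qed

text \<open>At the right angle the two families of diagonals contribute \<open>(a + b) / 2\<close>
  and \<open>\<bar>a - b\<bar> / 2\<close>, together \<open>max a b\<close>, so the count is only
  piecewise linear. At the acute angles it is linear, with coefficient 3 along the hypotenuse and 2
  along the leg.\<close>

lemma right_targets:
  assumes c: "c \<in> right.V" and i: "i < 3" "trlam i c > 0"
  shows "(\<lambda>m. real (\<Sum>n=1..<m. card (right.targets c i n)) / (real m)\<^sup>2) \<longlonglongrightarrow>
    (if c = (0, 0) then 1 / pi\<^sup>2 else 1 / (2 * pi\<^sup>2))"
proof -
  have "c = (0, 0) \<and> i = 1 \<or> c = (1, 0) \<and> i = 2 \<or> c = (0, 1) \<and> i = 0"
    using tr_cases c i unfolding trV by blast
  then show ?thesis
  proof (elim disjE conjE)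
    assume ci: "c = (0, 0)" "i = 1"
    have G: "{(a, b). 0 < a \<and> 0 < b \<and> coprime a b \<and>
      (\<Sum>\<phi>\<in>rightPhi. \<bar>real a * (\<phi> (trP i) - \<phi> c) + real b * (\<phi> (trP (Suc i)) - \<phi> c)\<bar>) \<le> real n}
      = {(a, b). 0 < a \<and> 0 < b \<and> coprime a b \<and> a + b + max a b \<le> n}" for n
    proof -
      have "(\<Sum>\<phi>\<in>rightPhi. \<bar>real a * (\<phi> (trP i) - \<phi> c) + real b * (\<phi> (trP (Suc i)) - \<phi> c)\<bar>) = real (a + b + max a b)" for a b :: nat
        by (simp add: rightPhi_sum ci trP_simps abs_if max_def field_simps)
      then show ?thesis by (simp only: of_nat_le_iff)
    qed
    have "unimod (trP i - c) (trP (Suc i) - c)"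
      by (simp add: ci unimod_def lat_def trP_simps)
    then have "(\<lambda>m. real (\<Sum>n=1..<m. card (right.targets c i n)) / (real m)\<^sup>2) \<longlonglongrightarrow> 1 / pi\<^sup>2"
      by (rule right.targets_asymptotics[OF c i]; unfold G) (rule cop_max_asymptotics)+
    then show ?thesis using ci by simp
  next
    assume ci: "c = (1, 0)" "i = 2"
    have "unimod (trP i - c) (trP (Suc i) - c)"
      by (simp add: ci unimod_def lat_def trP_simps)
    then have "(\<lambda>m. real (\<Sum>n=1..<m. card (right.targets c i n)) / (real m)\<^sup>2) \<longlonglongrightarrow> 3 / (pi\<^sup>2 * real 3 * real 2)"
      by (rule right.targets_linear[OF c i]) (simp_all add: rightPhi_sum ci trP_simps abs_if field_simps)
    then show ?thesis using ci by (simp add: field_simps)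
  next
    assume ci: "c = (0, 1)" "i = 0"
    have "unimod (trP i - c) (trP (Suc i) - c)"
      by (simp add: ci unimod_def lat_def trP_simps)
    then have "(\<lambda>m. real (\<Sum>n=1..<m. card (right.targets c i n)) / (real m)\<^sup>2) \<longlonglongrightarrow> 3 / (pi\<^sup>2 * real 2 * real 3)"
      by (rule right.targets_linear[OF c i]) (simp_all add: rightPhi_sum ci trP_simps abs_if field_simps)
    then show ?thesis using ci by (simp add: field_simps)
  qed
qed

lemma right_lang_asymptotics: "(\<lambda>n. real (card (right.lang n)) / real n ^ 3) \<longlonglongrightarrow> 2 / (3 * pi\<^sup>2)"
proof -
  have "(\<Sum>c\<in>right.V. \<Sum>i | i < 3 \<and> trlam i c > 0. if c = (0, 0) then 1 / pi\<^sup>2 else 1 / (2 * pi\<^sup>2)) = 2 / pi\<^sup>2"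
    by (simp add: trV tr_sets)
  then show ?thesis
    using right.card_lang_asymptotics[of "\<lambda>c i. if c = (0, 0) then 1 / pi\<^sup>2 else 1 / (2 * pi\<^sup>2)", OF right_targets] by (simp add: mult.commute)
qed

section \<open>Transfer to the given square or triangle\<close>

lemma tr_hull:
  assumes "\<And>i. i < 3 \<Longrightarrow> trlam i p \<ge> 0"
  shows "p \<in> convex hull {(0, 0), (1, 0), (0, 1)}"
proof -
  have *: "0 \<le> snd p" "fst p + snd p \<le> 1" "0 \<le> fst p"
    using assms[of 0] assms[of 1] assms[of 2] by (simp_all add: trlam_def)
  have "p = (1 - fst p - snd p) *\<^sub>R (0, 0) + fst p *\<^sub>R (1, 0) + snd p *\<^sub>R (0, 1)"
    by (simp add: prod_eq_iff)
  then show ?thesis unfolding convex_hull_3 using *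
    by (intro CollectI exI[of _ "1 - fst p - snd p"] exI[of _ "fst p"] exI[of _ "snd p"]) auto
qed

text \<open>Bilinear interpolation: first along the bottom and the top side, then between the two
  points obtained.\<close>

lemma sq_hull:
  assumes "\<And>i. i < 4 \<Longrightarrow> sqlam i p \<ge> 0"
  shows "p \<in> convex hull {(0, 0), (1, 0), (1, 1), (0, 1)}"
proof -
  let ?H = "convex hull {(0, 0), (1, 0), (1, 1), (0, 1)} :: (real \<times> real) set"
  have *: "0 \<le> snd p" "fst p \<le> 1" "snd p \<le> 1" "0 \<le> fst p"
    using assms[of 0] assms[of 1] assms[of 2] assms[of 3] by (simp_all add: sqlam_def)
  have v: "(0, 0) \<in> ?H" "(1, 0) \<in> ?H" "(1, 1) \<in> ?H" "(0, 1) \<in> ?H" by (simp_all add: hull_inc)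
  have cv: "(1 - t) *\<^sub>R x + t *\<^sub>R y \<in> ?H" if "x \<in> ?H" "y \<in> ?H" "0 \<le> t" "t \<le> 1" for x y t
    using convex_convex_hull that unfolding convex_alt by blast
  have "(1 - fst p) *\<^sub>R (0, 0) + fst p *\<^sub>R (1, 0) \<in> ?H" "(1 - fst p) *\<^sub>R (0, 1) + fst p *\<^sub>R (1, 1) \<in> ?H"
    using cv v * by blast+
  then have "(1 - snd p) *\<^sub>R ((1 - fst p) *\<^sub>R (0, 0) + fst p *\<^sub>R (1, 0)) + snd p *\<^sub>R ((1 - fst p) *\<^sub>R (0, 1) + fst p *\<^sub>R (1, 1)) \<in> ?H"
    using cv * by blast
  moreover have "p = (1 - snd p) *\<^sub>R ((1 - fst p) *\<^sub>R (0, 0) + fst p *\<^sub>R (1, 0)) + snd p *\<^sub>R ((1 - fst p) *\<^sub>R (0, 1) + fst p *\<^sub>R (1, 1))"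
    by (simp add: prod_eq_iff algebra_simps)
  ultimately show ?thesis by simp
qed

lemma lim_complexity:
  assumes "\<And>n. n \<ge> 1 \<Longrightarrow> billiard_complexity Q lab n = card (A n)"
    and "(\<lambda>n. real (card (A n)) / real n ^ 3) \<longlonglongrightarrow> K"
  shows "(\<lambda>n. real (billiard_complexity Q lab n) / real n ^ 3) \<longlonglongrightarrow> K"
proof (rule Lim_transform_eventually[OF assms(2)])
  show "\<forall>\<^sub>F n in sequentially. real (card (A n)) / real n ^ 3 = real (billiard_complexity Q lab n) / real n ^ 3"
    using eventually_ge_at_top[of 1] by eventually_elim (simp add: assms(1))
qed

lemma square_complexity:
  assumes "is_square Q" and lab: "inj_on lab (sides Q)"
  shows "(\<lambda>n. real (billiard_complexity Q lab n) / real n ^ 3) \<longlonglongrightarrow> 4 / pi\<^sup>2"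
proof -
  obtain a u v where uv: "u \<noteq> 0" "norm u = norm v" "orthogonal u v"
    and Q: "Q = convex hull {a, a + u, a + u + v, a + v}"
    using assms unfolding is_square_def by blast
  have i: "u \<bullet> v = 0" "v \<bullet> u = 0" using uv(3) by (simp_all add: orthogonal_def inner_commute)
  interpret b: billiard_coordinates 4 sqP sqlam sqnu sqPhi a u v
  proof
    have "v \<bullet> v = u \<bullet> u" using uv(2) by (simp add: norm_eq)
    moreover have "u \<bullet> u > 0" using uv by simp
    ultimately show "u $ 1 * v $ 2 - u $ 2 * v $ 1 \<noteq> 0" by (intro det_nonzero) (simp add: i)
    show "(fst (sqnu i) *\<^sub>R u + snd (sqnu i) *\<^sub>R v) \<bullet> (fst (sqP (Suc i) - sqP i) *\<^sub>R u + snd (sqP (Suc i) - sqP i) *\<^sub>R v) = 0"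
      if "i < 4" for i
      using less_4_cases[OF that] by (elim disjE) (simp_all add: sqnu_def sqP_simps i)
    show "p \<in> convex hull sq.V" if "\<And>i. i < 4 \<Longrightarrow> 0 \<le> sqlam i p" for p
      using sq_hull[OF that] by (simp add: sqV)
  qed
  have "b.Q = Q" unfolding b.Q_def Q by (simp add: sqV b.emb_def b.L_def add.assoc)
  then have "billiard_complexity Q lab n = card (sq.lang n)" if "n \<ge> 1" for n
    using b.billiard_complexity_eq[OF that, of lab] lab by simp
  then show ?thesis by (rule lim_complexity[OF _ sq_lang_asymptotics])
qed

lemma right_triangle_complexity:
  assumes "is_isosceles_right_triangle Q" and lab: "inj_on lab (sides Q)"
  shows "(\<lambda>n. real (billiard_complexity Q lab n) / real n ^ 3) \<longlonglongrightarrow> 2 / (3 * pi\<^sup>2)"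
proof -
  obtain a b c where ab: "a \<noteq> b" "dist a b = dist a c" "orthogonal (b - a) (c - a)" and Q: "Q = convex hull {a, b, c}"
    using assms unfolding is_isosceles_right_triangle_def by blast
  define u v where "u = b - a" and "v = c - a"
  have uv: "u \<noteq> 0" "norm u = norm v" "orthogonal u v"
    using ab by (simp_all add: u_def v_def dist_norm norm_minus_commute)
  have i: "u \<bullet> v = 0" "v \<bullet> u = 0" using uv(3) by (simp_all add: orthogonal_def inner_commute)
  have n: "v \<bullet> v = u \<bullet> u" using uv(2) by (simp add: norm_eq)
  interpret b: billiard_coordinates 3 trP trlam rightnu rightPhi a u v
  proof
    have "u \<bullet> u > 0" using uv by simp
    then show "u $ 1 * v $ 2 - u $ 2 * v $ 1 \<noteq> 0" by (intro det_nonzero) (simp add: i n)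
    show "(fst (rightnu i) *\<^sub>R u + snd (rightnu i) *\<^sub>R v) \<bullet> (fst (trP (Suc i) - trP i) *\<^sub>R u + snd (trP (Suc i) - trP i) *\<^sub>R v) = 0"
      if "i < 3" for i
      using less_3_cases[OF that] by (elim disjE) (simp_all add: rightnu_def trP_simps i n inner_add_left inner_add_right inner_diff_left inner_diff_right)
    show "p \<in> convex hull right.V" if "\<And>i. i < 3 \<Longrightarrow> 0 \<le> trlam i p" for p
      using tr_hull[OF that] by (simp add: trV)
  qed
  have "a + u = b" "a + v = c" by (simp_all add: u_def v_def)
  then have "b.Q = Q" unfolding b.Q_def Q by (simp add: trV b.emb_def b.L_def)
  then have "billiard_complexity Q lab n = card (right.lang n)" if "n \<ge> 1" for n
    using b.billiard_complexity_eq[OF that, of lab] lab by simp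
  then show ?thesis by (rule lim_complexity[OF _ right_lang_asymptotics])
qed

lemma equilateral_triangle_complexity:
  assumes "is_equilateral_triangle Q" and lab: "inj_on lab (sides Q)"
  shows "(\<lambda>n. real (billiard_complexity Q lab n) / real n ^ 3) \<longlonglongrightarrow> 3 / (4 * pi\<^sup>2)"
proof -
  obtain a b c where ab: "a \<noteq> b" "dist a b = dist b c" "dist b c = dist c a" and Q: "Q = convex hull {a, b, c}"
    using assms unfolding is_equilateral_triangle_def by blast
  define u v where "u = b - a" and "v = c - a"
  have "norm u = dist a b" "norm v = dist c a" "norm (u - v) = dist b c"
    by (simp_all add: u_def v_def dist_norm norm_minus_commute)
  then have uv: "u \<noteq> 0" "norm u = norm v" "norm (u - v) = norm u"
    using ab by (auto simp: u_def)
  have n: "v \<bullet> v = u \<bullet> u" using uv(2) by (simp add: norm_eq)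
  have "(u - v) \<bullet> (u - v) = u \<bullet> u" using uv(3) by (simp add: norm_eq)
  then have i: "u \<bullet> v = (u \<bullet> u) / 2" "v \<bullet> u = (u \<bullet> u) / 2"
    using n by (simp_all add: inner_diff_left inner_diff_right inner_commute)
  interpret b: billiard_coordinates 3 trP trlam equinu equiPhi a u v
  proof
    have "u \<bullet> u > 0" using uv by simp
    then have "(u \<bullet> u) * (u \<bullet> u) > 0" by simp
    then show "u $ 1 * v $ 2 - u $ 2 * v $ 1 \<noteq> 0" by (intro det_nonzero) (simp add: i n power2_eq_square)
    show "(fst (equinu i) *\<^sub>R u + snd (equinu i) *\<^sub>R v) \<bullet> (fst (trP (Suc i) - trP i) *\<^sub>R u + snd (trP (Suc i) - trP i) *\<^sub>R v) = 0"
      if "i < 3" for i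
      using less_3_cases[OF that] by (elim disjE) (simp_all add: equinu_def trP_simps i n inner_add_left inner_add_right inner_diff_left inner_diff_right)
    show "p \<in> convex hull equi.V" if "\<And>i. i < 3 \<Longrightarrow> 0 \<le> trlam i p" for p
      using tr_hull[OF that] by (simp add: trV)
  qed
  have "a + u = b" "a + v = c" by (simp_all add: u_def v_def)
  then have "b.Q = Q" unfolding b.Q_def Q by (simp add: trV b.emb_def b.L_def)
  then have "billiard_complexity Q lab n = card (equi.lang n)" if "n \<ge> 1" for n
    using b.billiard_complexity_eq[OF that, of lab] lab by simp
  then show ?thesis by (rule lim_complexity[OF _ equi_lang_asymptotics])
qed

theorem theorem1p3:
  fixes Q :: "(real^2) set" and lab :: "(real^2) set \<Rightarrow> 'a" and A :: "'a set"
  assumes "finite A" and "bij_betw lab (sides Q) A"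
  shows "(is_square Q \<longrightarrow>
            (\<lambda>n. real (billiard_complexity Q lab n) / real n ^ 3) \<longlonglongrightarrow> 4 / pi\<^sup>2) \<and>
         (is_isosceles_right_triangle Q \<longrightarrow>
            (\<lambda>n. real (billiard_complexity Q lab n) / real n ^ 3) \<longlonglongrightarrow> 2 / (3 * pi\<^sup>2)) \<and>
         (is_equilateral_triangle Q \<longrightarrow>
            (\<lambda>n. real (billiard_complexity Q lab n) / real n ^ 3) \<longlonglongrightarrow> 3 / (4 * pi\<^sup>2))"
  using square_complexity right_triangle_complexity equilateral_triangle_complexity
    bij_betw_imp_inj_on[OF assms(2)] by blast

end
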